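(* Let $(M_n,H_n,J_n,P_n)_n$ be a sequence of standard forms. Let $H_\omega:=(H_n)_\omega$, let $J_\omega$ be defined on $H_\omega$ by $$J_\omega(\xi_n)_\omega:=(J_n\xi_n)_\omega,\qquad (\xi_n)_\omega\in H_\omega,$$ and let $$P_\omega:=\{(\xi_n)_\omega\in H_\omega:\ \xi_n\in P_n\text{ for all }n\in\mathbb{N}\}.$$ Then the quadruple $\left(\prod^\omega M_n,H_\omega,J_\omega,P_\omega\right)$ is again a standard form.
   Context: $\omega$ is a fixed free ultrafilter on $\mathbb{N}$. Standard form: a quadruple $(M,H,J,P)$, where $M$ is a von Neumann algebra acting on a Hilbert space $H$, $J$ is an antilinear isometry on $H$ with $J^2=1$, and $P\subset H$ is a closed convex cone which is self-dual, i.e. $P=P^0:=\{\xi\in H:\langle\xi,\eta\rangle\ge 0\ \forall\eta\in P\}$, is called a standard form if: (1) $JMJ=M'$; (2) $J\xi=\xi$ for $\xi\in P$; (3) $xJxJ(P)\subset P$ for $x\in M$; (4) $JxJ=x^*$ for $x\in\mathcal{Z}(M)$, the center of $M$. Groh–Raynaud ultraproduct: $(H_n)_\omega$ is the Hilbert space ultraproduct (bounded sequences modulo sequences with $\lim_{n\to\omega}\|\xi_n\|=0$), with elements $(\xi_n)_\omega$. For a bounded sequence $(a_n)_n$ with $a_n\in\mathbb{B}(H_n)$, put $\pi_\omega((a_n)_\omega)(\xi_n)_\omega=(a_n\xi_n)_\omega$. Here $\prod^\omega M_n$ is the strong operator closure in $\mathbb{B}(H_\omega)$ of $\{\pi_\omega((a_n)_\omega):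 a_n\in M_n,\ \sup_n\|a_n\|<\infty\}$, using the given standard representations $M_n\subset\mathbb{B}(H_n)$. *)

theory Defs
  imports "HOL-Analysis.Analysis" "HOL-Algebra.Module"
begin

section \<open>Complex Hilbert spaces with explicit carriers\<close>

text \<open>
  The members of a sequence of Hilbert spaces, their ultraproduct and the operators on all of
  these depend on parameters, so the spaces are records with a carrier set.
  As usual for modules in HOL-Algebra, the ring multiplication and unit of the record are unused.
\<close>

definition complex_ring :: "complex ring" where
  "complex_ring = \<lparr>carrier = UNIV, mult = (*), one = 1, zero = 0, add = (+)\<rparr>"

record 'a hilbert = "(complex, 'a) module" +
  inprod :: "'a \<Rightarrow> 'a \<Rightarrow> complex"

definition hnorm :: "('a, 'm) hilbert_scheme \<Rightarrow> 'a \<Rightarrow> real" where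
  "hnorm H x = sqrt (Re (inprod H x x))"

text \<open>\<^const>\<open>Metric_space\<close> requires non-negativity and symmetry also outside the
  carrier, whence the case distinction.\<close>

definition hdist :: "('a, 'm) hilbert_scheme \<Rightarrow> 'a \<Rightarrow> 'a \<Rightarrow> real" where
  "hdist H x y = (if x \<in> carrier H \<and> y \<in> carrier H then hnorm H (x \<ominus>\<^bsub>H\<^esub> y) else 0)"

abbreviation hmetric_topology :: "('a, 'm) hilbert_scheme \<Rightarrow> 'a topology" where
  "hmetric_topology H \<equiv> Metric_space.mtopology (carrier H) (hdist H)"

locale hilbert_space = module complex_ring H
  for H :: "('a, 'm) hilbert_scheme" (structure) +
  assumes inprod_add_left:
      "\<lbrakk>x \<in> carrier H; y \<in> carrier H; z \<in> carrier H\<rbrakk> \<Longrightarrow>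
        inprod H (x \<oplus> y) z = inprod H x z + inprod H y z"
    and inprod_smult_left:
      "\<lbrakk>x \<in> carrier H; y \<in> carrier H\<rbrakk> \<Longrightarrow> inprod H (c \<odot> x) y = c * inprod H x y"
    and inprod_commute:
      "\<lbrakk>x \<in> carrier H; y \<in> carrier H\<rbrakk> \<Longrightarrow> inprod H x y = cnj (inprod H y x)"
    and inprod_nonneg: "x \<in> carrier H \<Longrightarrow> inprod H x x \<in> \<real>\<^sub>\<ge>\<^sub>0"
    and inprod_definite: "\<lbrakk>x \<in> carrier H; inprod H x x = 0\<rbrakk> \<Longrightarrow> x = \<zero>"
    and complete: "Metric_space.mcomplete (carrier H) (hdist H)"


section \<open>Bounded operators and von Neumann algebras\<close>

text \<open>Operators are extensional functions, so that equality of operators is equality on the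
  carrier and sets of operators can be compared as sets.\<close>

definition bounded_ops :: "('a, 'm) hilbert_scheme \<Rightarrow> ('a \<Rightarrow> 'a) set" where
  "bounded_ops H = {T \<in> carrier H \<rightarrow>\<^sub>E carrier H.
     (\<forall>x\<in>carrier H. \<forall>y\<in>carrier H. T (x \<oplus>\<^bsub>H\<^esub> y) = T x \<oplus>\<^bsub>H\<^esub> T y) \<and>
     (\<forall>c. \<forall>x\<in>carrier H. T (c \<odot>\<^bsub>H\<^esub> x) = c \<odot>\<^bsub>H\<^esub> T x) \<and>
     (\<exists>C. \<forall>x\<in>carrier H. hnorm H (T x) \<le> C * hnorm H x)}"

definition opnorm :: "('a, 'm) hilbert_scheme \<Rightarrow> ('a \<Rightarrow> 'a) \<Rightarrow> real" where
  "opnorm H T = (SUP x\<in>{x \<in> carrier H. hnorm H x \<le> 1}. hnorm H (T x))"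

definition op_id :: "('a, 'm) hilbert_scheme \<Rightarrow> 'a \<Rightarrow> 'a" where
  "op_id H = (\<lambda>x\<in>carrier H. x)"

definition op_add :: "('a, 'm) hilbert_scheme \<Rightarrow> ('a \<Rightarrow> 'a) \<Rightarrow> ('a \<Rightarrow> 'a) \<Rightarrow> 'a \<Rightarrow> 'a" where
  "op_add H S T = (\<lambda>x\<in>carrier H. S x \<oplus>\<^bsub>H\<^esub> T x)"

definition op_smult :: "('a, 'm) hilbert_scheme \<Rightarrow> complex \<Rightarrow> ('a \<Rightarrow> 'a) \<Rightarrow> 'a \<Rightarrow> 'a" where
  "op_smult H c T = (\<lambda>x\<in>carrier H. c \<odot>\<^bsub>H\<^esub> T x)"

abbreviation op_comp :: "('a, 'm) hilbert_scheme \<Rightarrow> ('a \<Rightarrow> 'a) \<Rightarrow> ('a \<Rightarrow> 'a) \<Rightarrow> 'a \<Rightarrow> 'a" where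
  "op_comp H \<equiv> compose (carrier H)"

definition op_adjoint :: "('a, 'm) hilbert_scheme \<Rightarrow> ('a \<Rightarrow> 'a) \<Rightarrow> 'a \<Rightarrow> 'a" where
  "op_adjoint H T = (THE S. S \<in> bounded_ops H \<and>
     (\<forall>x\<in>carrier H. \<forall>y\<in>carrier H. inprod H (T x) y = inprod H x (S y)))"

text \<open>The strong operator topology: pointwise convergence in norm, on the bounded operators.\<close>

definition strong_op_topology :: "('a, 'm) hilbert_scheme \<Rightarrow> ('a \<Rightarrow> 'a) topology" where
  "strong_op_topology H =
     subtopology (product_topology (\<lambda>_. hmetric_topology H) (carrier H)) (bounded_ops H)"

definition commutant :: "('a, 'm) hilbert_scheme \<Rightarrow> ('a \<Rightarrow> 'a) set \<Rightarrow> ('a \<Rightarrow> 'a) set" where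
  "commutant H M = {T \<in> bounded_ops H. \<forall>S\<in>M. op_comp H T S = op_comp H S T}"

definition center :: "('a, 'm) hilbert_scheme \<Rightarrow> ('a \<Rightarrow> 'a) set \<Rightarrow> ('a \<Rightarrow> 'a) set" where
  "center H M = M \<inter> commutant H M"

locale von_neumann_algebra = hilbert_space H
  for H :: "('a, 'm) hilbert_scheme" (structure) and M :: "('a \<Rightarrow> 'a) set" +
  assumes bounded: "M \<subseteq> bounded_ops H"
    and id_closed: "op_id H \<in> M"
    and add_closed: "\<lbrakk>S \<in> M; T \<in> M\<rbrakk> \<Longrightarrow> op_add H S T \<in> M"
    and scalar_closed: "T \<in> M \<Longrightarrow> op_smult H c T \<in> M"
    and comp_closed: "\<lbrakk>S \<in> M; T \<in> M\<rbrakk> \<Longrightarrow> op_comp H S T \<in> M"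
    and adjoint_closed: "T \<in> M \<Longrightarrow> op_adjoint H T \<in> M"
    and strongly_closed: "closedin (strong_op_topology H) M"


section \<open>Standard forms\<close>

definition antilinear_isometry :: "('a, 'm) hilbert_scheme \<Rightarrow> ('a \<Rightarrow> 'a) \<Rightarrow> bool" where
  "antilinear_isometry H J \<longleftrightarrow> J \<in> carrier H \<rightarrow>\<^sub>E carrier H \<and>
     (\<forall>x\<in>carrier H. \<forall>y\<in>carrier H. J (x \<oplus>\<^bsub>H\<^esub> y) = J x \<oplus>\<^bsub>H\<^esub> J y) \<and>
     (\<forall>c. \<forall>x\<in>carrier H. J (c \<odot>\<^bsub>H\<^esub> x) = cnj c \<odot>\<^bsub>H\<^esub> J x) \<and>
     (\<forall>x\<in>carrier H. hnorm H (J x) = hnorm H x)"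

definition closed_convex_cone :: "('a, 'm) hilbert_scheme \<Rightarrow> 'a set \<Rightarrow> bool" where
  "closed_convex_cone H P \<longleftrightarrow> P \<subseteq> carrier H \<and> P \<noteq> {} \<and>
     closedin (hmetric_topology H) P \<and>
     (\<forall>x\<in>P. \<forall>y\<in>P. \<forall>t\<in>{0..1}.
        complex_of_real (1 - t) \<odot>\<^bsub>H\<^esub> x \<oplus>\<^bsub>H\<^esub> complex_of_real t \<odot>\<^bsub>H\<^esub> y \<in> P) \<and>
     (\<forall>x\<in>P. \<forall>t\<ge>0. complex_of_real t \<odot>\<^bsub>H\<^esub> x \<in> P)"

definition dual_cone :: "('a, 'm) hilbert_scheme \<Rightarrow> 'a set \<Rightarrow> 'a set" where
  "dual_cone H P = {x \<in> carrier H. \<forall>y\<in>P. inprod H x y \<in> \<real>\<^sub>\<ge>\<^sub>0}"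

definition conj_op :: "('a, 'm) hilbert_scheme \<Rightarrow> ('a \<Rightarrow> 'a) \<Rightarrow> ('a \<Rightarrow> 'a) \<Rightarrow> 'a \<Rightarrow> 'a" where
  "conj_op H J T = op_comp H J (op_comp H T J)"

locale standard_form = von_neumann_algebra H M
  for M :: "('a \<Rightarrow> 'a) set" and H :: "('a, 'm) hilbert_scheme" (structure)
    and J :: "'a \<Rightarrow> 'a" and P :: "'a set" +
  assumes J_antilinear_isometry: "antilinear_isometry H J"
    and J_involution: "op_comp H J J = op_id H"
    and P_closed_convex_cone: "closed_convex_cone H P"
    and P_self_dual: "P = dual_cone H P"
    and conj_commutant: "conj_op H J ` M = commutant H M"
    and J_fixes_P: "\<xi> \<in> P \<Longrightarrow> J \<xi> = \<xi>"
    and P_invariant: "x \<in> M \<Longrightarrow> op_comp H x (conj_op H J x) ` P \<subseteq> P"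
    and conj_center: "x \<in> center H M \<Longrightarrow> conj_op H J x = op_adjoint H x"


section \<open>Ultraproducts\<close>

definition free_ultrafilter :: "nat filter \<Rightarrow> bool" where
  "free_ultrafilter \<omega> \<longleftrightarrow> \<omega> \<noteq> bot \<and>
     (\<forall>A. eventually (\<lambda>n. n \<in> A) \<omega> \<or> eventually (\<lambda>n. n \<notin> A) \<omega>) \<and>
     (\<forall>m. eventually (\<lambda>n. n \<noteq> m) \<omega>)"

definition bounded_seqs :: "(nat \<Rightarrow> ('a, 'm) hilbert_scheme) \<Rightarrow> (nat \<Rightarrow> 'a) set" where
  "bounded_seqs H =
     {\<xi>. (\<forall>n. \<xi> n \<in> carrier (H n)) \<and> bdd_above (range (\<lambda>n. hnorm (H n) (\<xi> n)))}"

definition ultra_rel ::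
  "nat filter \<Rightarrow> (nat \<Rightarrow> ('a, 'm) hilbert_scheme) \<Rightarrow> ((nat \<Rightarrow> 'a) \<times> (nat \<Rightarrow> 'a)) set" where
  "ultra_rel \<omega> H = {(\<xi>, \<eta>). \<xi> \<in> bounded_seqs H \<and> \<eta> \<in> bounded_seqs H \<and>
     ((\<lambda>n. hnorm (H n) (\<xi> n \<ominus>\<^bsub>H n\<^esub> \<eta> n)) \<longlongrightarrow> 0) \<omega>}"

text \<open>The element of the ultraproduct represented by a bounded sequence.\<close>

definition ultra_class ::
  "nat filter \<Rightarrow> (nat \<Rightarrow> ('a, 'm) hilbert_scheme) \<Rightarrow> (nat \<Rightarrow> 'a) \<Rightarrow> (nat \<Rightarrow> 'a) set" where
  "ultra_class \<omega> H \<xi> = ultra_rel \<omega> H `` {\<xi>}"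

text \<open>Operations on classes are lifted from representatives in the style of
  \<^theory>\<open>HOL.Equiv_Relations\<close>: if the result does not depend on the representatives,
  the union over all representatives is the resulting class.\<close>

definition hilbert_ultraproduct ::
  "nat filter \<Rightarrow> (nat \<Rightarrow> ('a, 'm) hilbert_scheme) \<Rightarrow> (nat \<Rightarrow> 'a) set hilbert" where
  "hilbert_ultraproduct \<omega> H =
    \<lparr>carrier = bounded_seqs H // ultra_rel \<omega> H,
     mult = undefined, one = undefined,
     zero = ultra_class \<omega> H (\<lambda>n. \<zero>\<^bsub>H n\<^esub>),
     add = (\<lambda>X Y. \<Union>\<xi>\<in>X. \<Union>\<eta>\<in>Y. ultra_class \<omega> H (\<lambda>n. \<xi> n \<oplus>\<^bsub>H n\<^esub> \<eta> n)),
     smult = (\<lambda>c X. \<Union>\<xi>\<in>X. ultra_class \<omega> H (\<lambda>n. c \<odot>\<^bsub>H n\<^esub> \<xi> n)),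
     inprod = (\<lambda>X Y. the_elem (\<Union>\<xi>\<in>X. \<Union>\<eta>\<in>Y. {Lim \<omega> (\<lambda>n. inprod (H n) (\<xi> n) (\<eta> n))}))\<rparr>"

text \<open>The map \<open>(\<xi>\<^sub>n)\<^sub>\<omega> \<mapsto> (f\<^sub>n \<xi>\<^sub>n)\<^sub>\<omega>\<close>. It serves both for the operators
  \<open>\<pi>\<^sub>\<omega>((a\<^sub>n)\<^sub>\<omega>)\<close> and for \<open>J\<^sub>\<omega>\<close>.\<close>

definition ultra_map ::
  "nat filter \<Rightarrow> (nat \<Rightarrow> ('a, 'm) hilbert_scheme) \<Rightarrow> (nat \<Rightarrow> 'a \<Rightarrow> 'a) \<Rightarrow>
     (nat \<Rightarrow> 'a) set \<Rightarrow> (nat \<Rightarrow> 'a) set" where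
  "ultra_map \<omega> H f =
     (\<lambda>X\<in>carrier (hilbert_ultraproduct \<omega> H). \<Union>\<xi>\<in>X. ultra_class \<omega> H (\<lambda>n. f n (\<xi> n)))"

definition groh_raynaud_ultraproduct ::
  "nat filter \<Rightarrow> (nat \<Rightarrow> ('a, 'm) hilbert_scheme) \<Rightarrow> (nat \<Rightarrow> ('a \<Rightarrow> 'a) set) \<Rightarrow>
     ((nat \<Rightarrow> 'a) set \<Rightarrow> (nat \<Rightarrow> 'a) set) set" where
  "groh_raynaud_ultraproduct \<omega> H M =
     strong_op_topology (hilbert_ultraproduct \<omega> H) closure_of
       {ultra_map \<omega> H a | a. (\<forall>n. a n \<in> M n) \<and> bdd_above (range (\<lambda>n. opnorm (H n) (a n)))}"

definition ultra_cone ::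
  "nat filter \<Rightarrow> (nat \<Rightarrow> ('a, 'm) hilbert_scheme) \<Rightarrow> (nat \<Rightarrow> 'a set) \<Rightarrow>
     (nat \<Rightarrow> 'a) set set" where
  "ultra_cone \<omega> H P = {ultra_class \<omega> H \<xi> | \<xi>. \<xi> \<in> bounded_seqs H \<and> (\<forall>n. \<xi> n \<in> P n)}"

end

theory Submission
  imports Defs
begin

text \<open>
  The only axioms of a standard form that are hard to transfer to the ultraproduct are
  \<open>JMJ = M'\<close> and the invariance of the cone, because \<open>M\<^sub>\<omega>\<close> is a strong closure: its
  commutant could be larger than the closure of the sequences from the commutants, and elements of
  the closure could be limits of unbounded families only.  Both difficulties disappear
  with Raynaud's theorem: \<open>M\<^sub>\<omega>\<close> is the commutant of \<open>B\<close>, the set of operators that come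
  from bounded sequences in the \<open>M\<^sub>n'\<close>, and each of its elements is approximated, on finitely many
  vectors, by sequences \<open>(a\<^sub>n)\<close> from the \<open>M\<^sub>n\<close> with a uniform bound
  (\<open>groh_raynaud_eq_commutant\<close>, \<open>bicommutant_approximation\<close>).

  The proof of Raynaud's theorem rests on one elementary fact about a unital *-algebra \<open>N\<close> of
  operators (\<open>approximate_transport\<close>): for vectors \<open>\<xi>\<close> and \<open>\<eta>\<close> there is a projection \<open>q\<close> in the
  commutant of \<open>N\<close> such that, for every \<open>e > 0\<close>, a contraction \<open>v\<close> in \<open>N\<close> brings \<open>v\<xi>\<close> within
  squared distance \<open>\<parallel>q\<eta>\<parallel>\<^sup>2 - \<parallel>q\<xi>\<parallel>\<^sup>2 + e\<close> of \<open>\<eta>\<close>.  Here \<open>q\<close> projects onto the closure of \<open>Nw\<close>,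
  where \<open>w\<close> is \<open>\<eta>\<close> minus its nearest point in the closure of the convex set of all \<open>v\<xi>\<close>; a
  variational argument shows that contractions for which \<open>v\<xi>\<close> is close to this nearest point are almost
  isometric on \<open>q\<xi>\<close>.  Applied to the diagonal action of \<open>M\<^sub>n\<close> on \<open>H\<^sub>n\<^sup>k\<close> (\<open>matrix_transport\<close>), it
  produces projections that are matrices over \<open>M\<^sub>n'\<close>.  Their ultraproduct is a matrix over \<open>B\<close>,
  hence commutes with every \<open>T\<close> in the commutant of \<open>B\<close>.  For a contraction \<open>T\<close>, the vectors \<open>\<xi>\<close>
  representing \<open>X\<^sub>1, \<dots>, X\<^sub>k\<close> and \<open>\<eta>\<close> representing \<open>TX\<^sub>1, \<dots>, TX\<^sub>k\<close> therefore make the difference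
  \<open>\<parallel>q\<eta>\<parallel>\<^sup>2 - \<parallel>q\<xi>\<parallel>\<^sup>2\<close> non-positive in the limit, and \<open>T\<close> is approximated by contractions from the
  \<open>M\<^sub>n\<close>.

  The remaining axioms follow.  Commutants of self-adjoint sets are von Neumann algebras, and
  \<open>J\<^sub>\<omega>\<close> exchanges \<open>B\<close> with the corresponding set for the \<open>M\<^sub>n\<close>, which gives
  \<open>J\<^sub>\<omega>M\<^sub>\<omega>J\<^sub>\<omega> = M\<^sub>\<omega>'\<close>.  Vectors fixed by \<open>J\<^sub>n\<close> are differences of orthogonal elements of \<open>P\<^sub>n\<close> with
  norm control (\<open>Moreau_decomposition\<close>); this passes to the ultraproduct and shows that \<open>P\<^sub>\<omega>\<close> is
  total and self-dual.  Uniformly bounded approximation gives the invariance of \<open>P\<^sub>\<omega>\<close>, and the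
  condition on the centre follows from the other axioms (\<open>conj_center_ultra\<close>).
\<close>


section \<open>Inner product spaces with explicit carriers\<close>

lemma carrier_complex_ring [simp]: "carrier complex_ring = UNIV"
  by (simp add: complex_ring_def)

lemma complex_ring_simps [simp]:
  "a \<oplus>\<^bsub>complex_ring\<^esub> b = a + b" "a \<otimes>\<^bsub>complex_ring\<^esub> b = a * b"
  "\<one>\<^bsub>complex_ring\<^esub> = 1" "\<zero>\<^bsub>complex_ring\<^esub> = 0"
  by (simp_all add: complex_ring_def)

lemma cring_complex_ring: "cring complex_ring"
proof (rule cringI)
  show "abelian_group complex_ring"
    by (rule abelian_groupI) (auto intro: exI[of _ "- _"] simp: add_eq_0_iff)
  show "comm_monoid complex_ring"
    by (rule comm_monoidI) auto
qed (auto simp: ring_distribs)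

text \<open>Completeness is split off because it refers to the metric space given by the norm:
  that the norm of a power or of an ultraproduct defines a metric has to be established before
  completeness can be stated.\<close>

locale pre_hilbert_space = module complex_ring H
  for H :: "('a, 'm) hilbert_scheme" (structure) +
  assumes inprod_add_left:
      "\<lbrakk>x \<in> carrier H; y \<in> carrier H; z \<in> carrier H\<rbrakk> \<Longrightarrow>
        inprod H (x \<oplus> y) z = inprod H x z + inprod H y z"
    and inprod_smult_left:
      "\<lbrakk>x \<in> carrier H; y \<in> carrier H\<rbrakk> \<Longrightarrow> inprod H (c \<odot> x) y = c * inprod H x y"
    and inprod_commute:
      "\<lbrakk>x \<in> carrier H; y \<in> carrier H\<rbrakk> \<Longrightarrow> inprod H x y = cnj (inprod H y x)"
    and inprod_nonneg: "x \<in> carrier H \<Longrightarrow> inprod H x x \<in> \<real>\<^sub>\<ge>\<^sub>0"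
    and inprod_definite: "\<lbrakk>x \<in> carrier H; inprod H x x = 0\<rbrakk> \<Longrightarrow> x = \<zero>"
begin

lemma scale_closed [simp, intro]: "x \<in> carrier H \<Longrightarrow> c \<odot> x \<in> carrier H"
  by (rule smult_closed) auto

lemma inprod_add_right:
  assumes "x \<in> carrier H" "y \<in> carrier H" "z \<in> carrier H"
  shows "inprod H x (y \<oplus> z) = inprod H x y + inprod H x z"
  by (metis M.add.m_closed assms complex_cnj_add inprod_add_left inprod_commute)

lemma inprod_smult_right:
  assumes "x \<in> carrier H" "y \<in> carrier H"
  shows "inprod H x (c \<odot> y) = cnj c * inprod H x y"
  by (metis assms complex_cnj_mult inprod_commute inprod_smult_left scale_closed)

lemma inprod_zero_left [simp]: "x \<in> carrier H \<Longrightarrow> inprod H \<zero> x = 0"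
  using inprod_add_left[of \<zero> \<zero> x] by simp

lemma inprod_zero_right [simp]: "x \<in> carrier H \<Longrightarrow> inprod H x \<zero> = 0"
  using inprod_add_right[of x \<zero> \<zero>] by simp

lemma inprod_uminus_left:
  assumes "x \<in> carrier H" "y \<in> carrier H"
  shows "inprod H (\<ominus> x) y = - inprod H x y"
  using inprod_add_left[of x "\<ominus> x" y] assms by (simp add: M.r_neg add_eq_0_iff)

lemma inprod_minus_left:
  assumes "x \<in> carrier H" "y \<in> carrier H" "z \<in> carrier H"
  shows "inprod H (x \<ominus> y) z = inprod H x z - inprod H y z"
  using assms by (simp add: a_minus_def inprod_add_left inprod_uminus_left)

lemma inprod_minus_right:
  assumes "x \<in> carrier H" "y \<in> carrier H" "z \<in> carrier H"
  shows "inprod H x (y \<ominus> z) = inprod H x y - inprod H x z"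
  using assms inprod_commute[of x "y \<ominus> z"] inprod_commute[of x y] inprod_commute[of x z]
  by (simp add: inprod_minus_left)

lemmas inprod_linear = inprod_add_left inprod_add_right inprod_smult_left inprod_smult_right
  inprod_minus_left inprod_minus_right

lemma inprod_self: "x \<in> carrier H \<Longrightarrow> inprod H x x = complex_of_real ((hnorm H x)\<^sup>2)"
  using inprod_nonneg[of x]
  by (auto simp: hnorm_def complex_nonneg_Reals_iff complex_eq_iff)

lemma Re_inprod_self: "x \<in> carrier H \<Longrightarrow> Re (inprod H x x) = (hnorm H x)\<^sup>2"
  by (simp add: inprod_self)

lemma hnorm_nonneg [simp]: "x \<in> carrier H \<Longrightarrow> 0 \<le> hnorm H x"
  using inprod_nonneg[of x] by (auto simp: hnorm_def complex_nonneg_Reals_iff)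

lemma hnorm_eq_0: "x \<in> carrier H \<Longrightarrow> hnorm H x = 0 \<longleftrightarrow> x = \<zero>"
  using inprod_definite[of x] inprod_self[of x] inprod_self[of \<zero>] by auto

lemma hnorm_zero [simp]: "hnorm H \<zero> = 0"
  by (simp add: hnorm_eq_0)

lemma minus_eq_zero_iff: "x \<in> carrier H \<Longrightarrow> y \<in> carrier H \<Longrightarrow> x \<ominus> y = \<zero> \<longleftrightarrow> x = y"
  using M.minus_equality[of x "\<ominus> y"] by (auto simp: a_minus_def M.r_neg)

text \<open>Vector identities are proved by testing them against all vectors, which turns them into
  identities between complex numbers.\<close>

lemma vector_eqI:
  assumes "x \<in> carrier H" "y \<in> carrier H"
    and "\<And>z. z \<in> carrier H \<Longrightarrow> inprod H x z = inprod H y z"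
  shows "x = y"
proof -
  have "inprod H (x \<ominus> y) (x \<ominus> y) = 0"
    using assms by (simp add: inprod_minus_left)
  then have "x \<ominus> y = \<zero>"
    using assms by (intro inprod_definite) auto
  then show ?thesis using assms by (simp add: minus_eq_zero_iff)
qed

lemma minus_self [simp]: "x \<in> carrier H \<Longrightarrow> x \<ominus> x = \<zero>"
  by (simp add: minus_eq_zero_iff)

lemma minus_zero [simp]: "x \<in> carrier H \<Longrightarrow> x \<ominus> \<zero> = x"
  by (rule vector_eqI) (auto simp: inprod_minus_left)

lemma minus_as_add:
  assumes "x \<in> carrier H" "y \<in> carrier H"
  shows "x \<ominus> y = x \<oplus> (-1) \<odot> y"
  by (rule vector_eqI) (use assms in \<open>auto simp: inprod_linear\<close>)

lemma hnorm_smult [simp]: "x \<in> carrier H \<Longrightarrow> hnorm H (c \<odot> x) = cmod c * hnorm H x"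
proof -
  assume x: "x \<in> carrier H"
  have "(hnorm H (c \<odot> x))\<^sup>2 = (cmod c * hnorm H x)\<^sup>2"
  proof -
    have "inprod H (c \<odot> x) (c \<odot> x) = complex_of_real ((cmod c)\<^sup>2 * (hnorm H x)\<^sup>2)"
      using x complex_norm_square[of c]
      by (simp add: inprod_smult_left inprod_smult_right inprod_self[OF x])
    then show ?thesis
      using x Re_inprod_self[of "c \<odot> x"] by (simp add: power_mult_distrib)
  qed
  then show ?thesis
    using x by (simp add: power2_eq_iff_nonneg)
qed

lemma hnorm_add_sq:
  assumes "x \<in> carrier H" "y \<in> carrier H"
  shows "(hnorm H (x \<oplus> y))\<^sup>2 = (hnorm H x)\<^sup>2 + 2 * Re (inprod H x y) + (hnorm H y)\<^sup>2"
  using assms inprod_commute[of y x]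
  by (simp flip: Re_inprod_self add: inprod_linear)

lemma hnorm_minus_sq:
  assumes "x \<in> carrier H" "y \<in> carrier H"
  shows "(hnorm H (x \<ominus> y))\<^sup>2 = (hnorm H x)\<^sup>2 - 2 * Re (inprod H x y) + (hnorm H y)\<^sup>2"
  using assms inprod_commute[of y x]
  by (simp flip: Re_inprod_self add: inprod_linear)

lemma hnorm_minus_commute:
  assumes "x \<in> carrier H" "y \<in> carrier H"
  shows "hnorm H (x \<ominus> y) = hnorm H (y \<ominus> x)"
  by (rule power2_eq_imp_eq)
    (use assms inprod_commute[of y x] in \<open>simp_all add: hnorm_minus_sq\<close>)

lemma Cauchy_Schwarz:
  assumes x: "x \<in> carrier H" and y: "y \<in> carrier H"
  shows "cmod (inprod H x y) \<le> hnorm H x * hnorm H y"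
proof (cases "hnorm H y = 0")
  case True
  then show ?thesis using assms by (simp add: hnorm_eq_0)
next
  case False
  define c where "c = inprod H x y / (hnorm H y)\<^sup>2"
  have "0 \<le> (hnorm H (x \<ominus> c \<odot> y))\<^sup>2" by simp
  also have "\<dots> = (hnorm H x)\<^sup>2 - 2 * Re (cnj c * inprod H x y) + (cmod c)\<^sup>2 * (hnorm H y)\<^sup>2"
    using assms by (simp add: hnorm_minus_sq inprod_linear power_mult_distrib)
  also have "cnj c * inprod H x y = complex_of_real ((cmod (inprod H x y))\<^sup>2 / (hnorm H y)\<^sup>2)"
    by (simp add: c_def complex_norm_square[symmetric] mult.commute)
  also have "(cmod c)\<^sup>2 * (hnorm H y)\<^sup>2 = (cmod (inprod H x y))\<^sup>2 / (hnorm H y)\<^sup>2"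
    using False by (simp add: c_def norm_divide power_divide norm_power) (simp add: divide_simps flip: power_mult power_add)
  finally have "(cmod (inprod H x y))\<^sup>2 / (hnorm H y)\<^sup>2 \<le> (hnorm H x)\<^sup>2" by simp
  then have "(cmod (inprod H x y))\<^sup>2 \<le> (hnorm H x * hnorm H y)\<^sup>2"
    using False by (simp add: power_mult_distrib divide_le_eq)
  then show ?thesis
    using power2_le_imp_le assms by fastforce
qed

lemma hnorm_triangle:
  assumes "x \<in> carrier H" "y \<in> carrier H"
  shows "hnorm H (x \<oplus> y) \<le> hnorm H x + hnorm H y"
proof (rule power2_le_imp_le)
  have "Re (inprod H x y) \<le> hnorm H x * hnorm H y"
    using Cauchy_Schwarz[OF assms] complex_Re_le_cmod order_trans by blast
  then show "(hnorm H (x \<oplus> y))\<^sup>2 \<le> (hnorm H x + hnorm H y)\<^sup>2"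
    using assms by (simp add: hnorm_add_sq power2_sum)
qed (use assms in auto)

lemma hnorm_triangle_minus:
  assumes "x \<in> carrier H" "y \<in> carrier H" "z \<in> carrier H"
  shows "hnorm H (x \<ominus> z) \<le> hnorm H (x \<ominus> y) + hnorm H (y \<ominus> z)"
proof -
  have "x \<ominus> z = (x \<ominus> y) \<oplus> (y \<ominus> z)"
    by (rule vector_eqI) (use assms in \<open>auto simp: inprod_linear\<close>)
  then show ?thesis
    using hnorm_triangle[of "x \<ominus> y" "y \<ominus> z"] assms by auto
qed

lemma hnorm_le_minus:
  assumes "x \<in> carrier H" "y \<in> carrier H"
  shows "hnorm H x \<le> hnorm H (x \<ominus> y) + hnorm H y"
proof -
  have "x = (x \<ominus> y) \<oplus> y"
    by (rule vector_eqI) (use assms in \<open>auto simp: inprod_linear\<close>)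
  then show ?thesis
    using hnorm_triangle[of "x \<ominus> y" y] assms by auto
qed

lemma parallelogram:
  assumes "x \<in> carrier H" "y \<in> carrier H"
  shows "(hnorm H (x \<ominus> y))\<^sup>2 + (hnorm H (x \<oplus> y))\<^sup>2 = 2 * (hnorm H x)\<^sup>2 + 2 * (hnorm H y)\<^sup>2"
  using assms by (simp add: hnorm_add_sq hnorm_minus_sq)

sublocale dist: Metric_space "carrier H" "hdist H"
proof
  fix x y z
  show "0 \<le> hdist H x y" by (simp add: hdist_def)
  show "hdist H x y = hdist H y x" by (auto simp: hdist_def hnorm_minus_commute)
  show "hdist H x y = 0 \<longleftrightarrow> x = y" if "x \<in> carrier H" "y \<in> carrier H"
    using that by (simp add: hdist_def hnorm_eq_0 minus_eq_zero_iff)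
  show "hdist H x z \<le> hdist H x y + hdist H y z"
    if "x \<in> carrier H" "y \<in> carrier H" "z \<in> carrier H"
    using that by (simp add: hdist_def hnorm_triangle_minus)
qed

lemma tendsto_inprod:
  assumes s: "\<And>n. s n \<in> carrier H" "p \<in> carrier H" "((\<lambda>n. hnorm H (s n \<ominus> p)) \<longlongrightarrow> 0) F"
    and t: "\<And>n. t n \<in> carrier H" "q \<in> carrier H" "((\<lambda>n. hnorm H (t n \<ominus> q)) \<longlongrightarrow> 0) F"
  shows "((\<lambda>n. inprod H (s n) (t n)) \<longlongrightarrow> inprod H p q) F"
proof -
  let ?b = "\<lambda>n. hnorm H (s n \<ominus> p) * (hnorm H (t n \<ominus> q) + hnorm H q) + hnorm H p * hnorm H (t n \<ominus> q)"
  have bound: "norm (inprod H (s n) (t n) - inprod H p q) \<le> ?b n" for n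
  proof -
    have "inprod H (s n) (t n) - inprod H p q = inprod H (s n \<ominus> p) (t n) + inprod H p (t n \<ominus> q)"
      using s t by (simp add: inprod_linear)
    also have "cmod \<dots> \<le> cmod (inprod H (s n \<ominus> p) (t n)) + cmod (inprod H p (t n \<ominus> q))"
      by (rule norm_triangle_ineq)
    also have "\<dots> \<le> hnorm H (s n \<ominus> p) * hnorm H (t n) + hnorm H p * hnorm H (t n \<ominus> q)"
      using s t by (intro add_mono Cauchy_Schwarz) auto
    also have "\<dots> \<le> ?b n"
      using s t hnorm_le_minus[of "t n" q] by (intro add_mono mult_left_mono) auto
    finally show ?thesis .
  qed
  have "(?b \<longlongrightarrow> 0 * (0 + hnorm H q) + hnorm H p * 0) F"
    using s t by (intro tendsto_intros)
  then have "(?b \<longlongrightarrow> 0) F" by simp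
  then have "((\<lambda>n. inprod H (s n) (t n) - inprod H p q) \<longlongrightarrow> 0) F"
    by (rule Lim_null_comparison[rotated]) (simp add: bound)
  then show ?thesis by (simp add: LIM_zero_iff)
qed

lemma tendsto_hnorm:
  assumes "\<And>n. s n \<in> carrier H" "p \<in> carrier H" "((\<lambda>n. hnorm H (s n \<ominus> p)) \<longlongrightarrow> 0) F"
  shows "((\<lambda>n. hnorm H (s n)) \<longlongrightarrow> hnorm H p) F"
  unfolding hnorm_def using tendsto_inprod[OF assms assms] by (intro tendsto_intros)

lemma tendsto_minus_const:
  assumes "\<And>n. s n \<in> carrier H" "p \<in> carrier H" "((\<lambda>n. hnorm H (s n \<ominus> p)) \<longlongrightarrow> 0) F"
    and x: "x \<in> carrier H"
  shows "((\<lambda>n. hnorm H ((x \<ominus> s n) \<ominus> (x \<ominus> p))) \<longlongrightarrow> 0) F"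
proof -
  have "(x \<ominus> s n) \<ominus> (x \<ominus> p) = p \<ominus> s n" for n
    by (rule vector_eqI) (use assms in \<open>auto simp: inprod_linear\<close>)
  then show ?thesis
    using assms hnorm_minus_commute[of p] by simp
qed

lemma tendsto_hnorm_minus:
  assumes "\<And>n. s n \<in> carrier H" "p \<in> carrier H" "((\<lambda>n. hnorm H (s n \<ominus> p)) \<longlongrightarrow> 0) F"
    and "x \<in> carrier H"
  shows "((\<lambda>n. hnorm H (x \<ominus> s n)) \<longlongrightarrow> hnorm H (x \<ominus> p)) F"
  by (rule tendsto_hnorm[OF _ _ tendsto_minus_const]) (use assms in auto)

lemma hnorm_le_sum:
  assumes z: "z \<in> carrier H" and u: "\<And>j. j < k \<Longrightarrow> u j \<in> carrier H"
    and eq: "\<And>w. w \<in> carrier H \<Longrightarrow> inprod H z w = (\<Sum>j<k. inprod H (u j) w)"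
  shows "hnorm H z \<le> (\<Sum>j<(k::nat). hnorm H (u j))"
proof (cases "hnorm H z = 0")
  case True
  then show ?thesis using u by (auto intro: sum_nonneg)
next
  case False
  then have pos: "hnorm H z > 0" using hnorm_nonneg[OF z] by simp
  have "hnorm H z * hnorm H z = cmod (inprod H z z)"
    using z by (simp add: inprod_self power2_eq_square norm_mult)
  also have "\<dots> \<le> (\<Sum>j<k. cmod (inprod H (u j) z))"
    unfolding eq[OF z] by (rule norm_sum)
  also have "\<dots> \<le> (\<Sum>j<k. hnorm H (u j) * hnorm H z)"
    using u z by (intro sum_mono Cauchy_Schwarz) auto
  also have "\<dots> = (\<Sum>j<k. hnorm H (u j)) * hnorm H z" by (simp add: sum_distrib_right)
  finally show ?thesis using pos by simp
qed

lemma hilbert_spaceI: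
  assumes "\<And>s. \<lbrakk>\<And>n. s n \<in> carrier H; \<And>e. e > 0 \<Longrightarrow> \<exists>N. \<forall>m\<ge>N. \<forall>n\<ge>N. hnorm H (s m \<ominus> s n) < e\<rbrakk>
    \<Longrightarrow> \<exists>p\<in>carrier H. (\<lambda>n::nat. hnorm H (s n \<ominus> p)) \<longlonglongrightarrow> 0"
  shows "hilbert_space H"
proof (intro hilbert_space.intro hilbert_space_axioms.intro)
  show "dist.mcomplete"
    unfolding dist.mcomplete_def
  proof (intro allI impI)
    fix s assume "dist.MCauchy s"
    then have s: "\<And>n. s n \<in> carrier H"
      "\<And>e. e > 0 \<Longrightarrow> \<exists>N. \<forall>m\<ge>N. \<forall>n\<ge>N. hnorm H (s m \<ominus> s n) < e"
      unfolding dist.MCauchy_def by (auto simp: hdist_def image_subset_iff)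
    then obtain p where "p \<in> carrier H" "(\<lambda>n. hnorm H (s n \<ominus> p)) \<longlonglongrightarrow> 0"
      using assms by blast
    then show "\<exists>p. limitin dist.mtopology s p sequentially"
      using s(1) by (intro exI[of _ p]) (simp add: dist.limitin_metric_dist_null hdist_def)
  qed
qed (unfold_locales, auto intro: inprod_add_left inprod_smult_left inprod_commute inprod_nonneg
    inprod_definite)

end

sublocale hilbert_space \<subseteq> pre_hilbert_space
  by unfold_locales
    (auto intro: inprod_add_left inprod_smult_left inprod_commute inprod_nonneg inprod_definite)

context hilbert_space
begin

lemma Cauchy_limit:
  assumes s: "\<And>n. s n \<in> carrier H"
    and cauchy: "\<And>e. e > 0 \<Longrightarrow> \<exists>N. \<forall>m\<ge>N. \<forall>n\<ge>N. hnorm H (s m \<ominus> s n) < e"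
  obtains p where "p \<in> carrier H" "(\<lambda>n. hnorm H (s n \<ominus> p)) \<longlonglongrightarrow> 0"
proof -
  have "dist.MCauchy s"
    unfolding dist.MCauchy_def hdist_def using s cauchy by (simp add: image_subset_iff)
  then obtain p where "limitin dist.mtopology s p sequentially"
    using complete by (auto simp: dist.mcomplete_def)
  then have "p \<in> carrier H" "(\<lambda>n. hdist H (s n) p) \<longlonglongrightarrow> 0"
    by (auto simp: dist.limitin_metric_dist_null)
  then show thesis using that s by (simp add: hdist_def)
qed

end


section \<open>Nearest points, orthogonal projections and linear functionals\<close>

context hilbert_space
begin

text \<open>The nearest point of the closure of a convex set, together with a sequence in the set
  that converges to it.  A minimising sequence is a Cauchy sequence by the parallelogram identity,
  and comparing the limit with the points of the segment towards \<open>k\<close> gives the variational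
  inequality.\<close>

lemma nearest_point:
  assumes S: "S \<subseteq> carrier H" "S \<noteq> {}"
    and conv: "\<And>x y t. \<lbrakk>x \<in> S; y \<in> S; 0 \<le> t; t \<le> 1\<rbrakk> \<Longrightarrow>
      complex_of_real (1 - t) \<odot> x \<oplus> complex_of_real t \<odot> y \<in> S"
    and x: "x \<in> carrier H"
  obtains p s where "p \<in> carrier H" "\<And>n. s n \<in> S" "(\<lambda>n::nat. hnorm H (s n \<ominus> p)) \<longlonglongrightarrow> 0"
    "\<And>k. k \<in> S \<Longrightarrow> Re (inprod H (k \<ominus> p) (x \<ominus> p)) \<le> 0"
proof -
  define D where "D = Inf ((\<lambda>s. (hnorm H (x \<ominus> s))\<^sup>2) ` S)"
  have bdd: "bdd_below ((\<lambda>s. (hnorm H (x \<ominus> s))\<^sup>2) ` S)"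
    by (intro bdd_belowI2[of _ 0]) simp
  have D_le: "D \<le> (hnorm H (x \<ominus> k))\<^sup>2" if "k \<in> S" for k
    unfolding D_def using that bdd by (auto intro: cInf_lower)
  have "\<exists>s\<in>S. (hnorm H (x \<ominus> s))\<^sup>2 < D + 1 / Suc n" for n :: nat
  proof -
    have "Inf ((\<lambda>s. (hnorm H (x \<ominus> s))\<^sup>2) ` S) < D + 1 / Suc n" by (simp add: D_def)
    then obtain v where "v \<in> (\<lambda>s. (hnorm H (x \<ominus> s))\<^sup>2) ` S" "v < D + 1 / Suc n"
      using cInf_lessD[of "(\<lambda>s. (hnorm H (x \<ominus> s))\<^sup>2) ` S"] S(2) by (metis image_is_empty)
    then show ?thesis by blast
  qed
  then obtain s where s: "\<And>n. s n \<in> S" "\<And>n::nat. (hnorm H (x \<ominus> s n))\<^sup>2 < D + 1 / Suc n"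
    by metis
  have sc: "s n \<in> carrier H" for n using s(1) S(1) by auto
  have close: "(hnorm H (s m \<ominus> s n))\<^sup>2 \<le> 2 / Suc m + 2 / Suc n" for m n
  proof -
    define mid where "mid = complex_of_real (1 - 1/2) \<odot> s m \<oplus> complex_of_real (1/2) \<odot> s n"
    have mid: "mid \<in> S" unfolding mid_def by (rule conv) (use s in auto)
    then have midc: "mid \<in> carrier H" using S by auto
    have 1: "(x \<ominus> s n) \<ominus> (x \<ominus> s m) = s m \<ominus> s n"
      by (rule vector_eqI) (use x sc in \<open>auto simp: inprod_linear\<close>)
    have 2: "(x \<ominus> s n) \<oplus> (x \<ominus> s m) = 2 \<odot> (x \<ominus> mid)"
      by (rule vector_eqI) (use x sc midc in \<open>auto simp: inprod_linear mid_def algebra_simps\<close>)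
    have "(hnorm H (s m \<ominus> s n))\<^sup>2 + 4 * (hnorm H (x \<ominus> mid))\<^sup>2
        = 2 * (hnorm H (x \<ominus> s n))\<^sup>2 + 2 * (hnorm H (x \<ominus> s m))\<^sup>2"
      using parallelogram[of "x \<ominus> s n" "x \<ominus> s m"] x sc midc unfolding 1 2
      by (simp add: power_mult_distrib)
    then show ?thesis
      using D_le[OF mid] s(2)[of m] s(2)[of n] by argo
  qed
  obtain p where p: "p \<in> carrier H" "(\<lambda>n. hnorm H (s n \<ominus> p)) \<longlonglongrightarrow> 0"
  proof (rule Cauchy_limit[of s])
    fix e :: real assume e: "e > 0"
    then obtain N :: nat where N: "4 / e\<^sup>2 < N" using reals_Archimedean2 by blast
    have "hnorm H (s m \<ominus> s n) < e" if "m \<ge> N" "n \<ge> N" for m n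
    proof (rule power2_less_imp_less)
      have "4 / e\<^sup>2 < Suc N" using N by simp
      then have "4 / real (Suc N) < e\<^sup>2" using e by (simp add: field_simps)
      moreover have "2 / real (Suc m) \<le> 2 / real (Suc N)" "2 / real (Suc n) \<le> 2 / real (Suc N)"
        using that by (auto intro!: divide_left_mono)
      ultimately show "(hnorm H (s m \<ominus> s n))\<^sup>2 < e\<^sup>2" using close[of m n] by argo
    qed (use e in auto)
    then show "\<exists>N. \<forall>m\<ge>N. \<forall>n\<ge>N. hnorm H (s m \<ominus> s n) < e" by blast
  qed (use sc in auto)
  have lim_norm: "(\<lambda>n. (hnorm H (y \<ominus> s n))\<^sup>2) \<longlonglongrightarrow> (hnorm H (y \<ominus> p))\<^sup>2" if "y \<in> carrier H" for y
    by (intro tendsto_power tendsto_hnorm_minus sc p that)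
  have le_D: "(hnorm H (x \<ominus> p))\<^sup>2 \<le> D"
  proof (rule LIMSEQ_le[OF lim_norm[OF x]])
    have "(\<lambda>n. D + 1 / real (Suc n)) \<longlonglongrightarrow> D + 0"
      by (intro tendsto_add tendsto_const LIMSEQ_Suc lim_1_over_n)
    then show "(\<lambda>n. D + 1 / real (Suc n)) \<longlonglongrightarrow> D" by simp
  qed (use s(2) in \<open>auto intro: less_imp_le\<close>)
  have "Re (inprod H (k \<ominus> p) (x \<ominus> p)) \<le> 0" if k: "k \<in> S" for k
  proof -
    have kc: "k \<in> carrier H" using k S by auto
    let ?r = "Re (inprod H (k \<ominus> p) (x \<ominus> p))" and ?N = "(hnorm H (k \<ominus> p))\<^sup>2"
    have step: "2 * ?r \<le> t * ?N" if t: "0 < t" "t \<le> 1" for t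
    proof -
      have ineq: "D \<le> (hnorm H (x \<ominus> s n))\<^sup>2 - 2 * t * Re (inprod H (k \<ominus> s n) (x \<ominus> s n))
          + t\<^sup>2 * (hnorm H (k \<ominus> s n))\<^sup>2" for n
      proof -
        define y where "y = complex_of_real (1 - t) \<odot> s n \<oplus> complex_of_real t \<odot> k"
        have y: "y \<in> S" unfolding y_def by (rule conv) (use s k t in auto)
        have eq: "x \<ominus> y = (x \<ominus> s n) \<ominus> complex_of_real t \<odot> (k \<ominus> s n)"
          by (rule vector_eqI) (use x sc kc in \<open>auto simp: inprod_linear y_def algebra_simps\<close>)
        have "(hnorm H (x \<ominus> y))\<^sup>2 = (hnorm H (x \<ominus> s n))\<^sup>2
            - 2 * (t * Re (inprod H (x \<ominus> s n) (k \<ominus> s n))) + t\<^sup>2 * (hnorm H (k \<ominus> s n))\<^sup>2"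
          unfolding eq using x sc kc
          by (subst hnorm_minus_sq) (auto simp: inprod_smult_right power_mult_distrib)
        moreover have "Re (inprod H (x \<ominus> s n) (k \<ominus> s n)) = Re (inprod H (k \<ominus> s n) (x \<ominus> s n))"
          using inprod_commute[of "x \<ominus> s n" "k \<ominus> s n"] x sc kc by simp
        ultimately show ?thesis using D_le[OF y] by simp
      qed
      have "(\<lambda>n. (hnorm H (x \<ominus> s n))\<^sup>2 - 2 * t * Re (inprod H (k \<ominus> s n) (x \<ominus> s n))
          + t\<^sup>2 * (hnorm H (k \<ominus> s n))\<^sup>2)
        \<longlonglongrightarrow> (hnorm H (x \<ominus> p))\<^sup>2 - 2 * t * ?r + t\<^sup>2 * ?N"
        using x kc sc p
        by (intro tendsto_add tendsto_diff tendsto_mult tendsto_const tendsto_Re lim_norm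
            tendsto_inprod tendsto_minus_const) auto
      then have "D \<le> (hnorm H (x \<ominus> p))\<^sup>2 - 2 * t * ?r + t\<^sup>2 * ?N"
        by (rule LIMSEQ_le_const) (use ineq in auto)
      then have "2 * t * ?r \<le> t\<^sup>2 * ?N" using le_D by simp
      then have "t * (2 * ?r) \<le> t * (t * ?N)" by (simp add: power2_eq_square mult_ac)
      then show ?thesis using t(1) mult_le_cancel_left_pos by blast
    qed
    show ?thesis
    proof (rule ccontr)
      assume "\<not> ?r \<le> 0"
      then have r: "?r > 0" by simp
      define t where "t = min 1 (?r / (?N + 1))"
      have N: "?N + 1 > 0" by (simp add: add_nonneg_pos)
      have "t > 0" "t \<le> 1" using r N by (auto simp: t_def intro!: divide_pos_pos)
      then have "2 * ?r \<le> t * ?N" by (rule step)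
      also have "t * ?N \<le> ?r / (?N + 1) * ?N" unfolding t_def by (intro mult_right_mono) auto
      also have "\<dots> \<le> ?r"
      proof -
        have "?r * ?N \<le> ?r * (?N + 1)" using r by (intro mult_left_mono) auto
        then show ?thesis using N by (simp add: divide_le_eq)
      qed
      finally show False using r by simp
    qed
  qed
  then show thesis using that p s(1) by blast
qed

definition linear_subset :: "'a set \<Rightarrow> bool" where
  "linear_subset S \<longleftrightarrow> S \<subseteq> carrier H \<and> \<zero> \<in> S \<and>
     (\<forall>x\<in>S. \<forall>y\<in>S. x \<oplus> y \<in> S) \<and> (\<forall>c. \<forall>x\<in>S. c \<odot> x \<in> S)"

definition orth :: "'a set \<Rightarrow> 'a set" where
  "orth S = {y \<in> carrier H. \<forall>s\<in>S. inprod H s y = 0}"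

text \<open>Orthogonality of \<open>x \<ominus> p\<close> to \<open>S\<close> determines \<open>p\<close> only within the closure of \<open>S\<close>;
  the closure is expressed by an approximating sequence.\<close>

definition proj :: "'a set \<Rightarrow> 'a \<Rightarrow> 'a" where
  "proj S x = (SOME p. p \<in> carrier H \<and> x \<ominus> p \<in> orth S \<and>
     (\<exists>s. (\<forall>n::nat. s n \<in> S) \<and> (\<lambda>n. hnorm H (s n \<ominus> p)) \<longlonglongrightarrow> 0))"

lemma linear_subsetD:
  assumes "linear_subset S"
  shows "S \<subseteq> carrier H" "\<zero> \<in> S" "x \<in> S \<Longrightarrow> y \<in> S \<Longrightarrow> x \<oplus> y \<in> S" "x \<in> S \<Longrightarrow> c \<odot> x \<in> S"
  using assms by (auto simp: linear_subset_def)

lemma proj_exists: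
  assumes S: "linear_subset S" and x: "x \<in> carrier H"
  shows "\<exists>p. p \<in> carrier H \<and> x \<ominus> p \<in> orth S \<and>
     (\<exists>s. (\<forall>n::nat. s n \<in> S) \<and> (\<lambda>n. hnorm H (s n \<ominus> p)) \<longlonglongrightarrow> 0)"
proof -
  note S' = linear_subsetD[OF S]
  obtain p s where p: "p \<in> carrier H" "\<And>n. s n \<in> S" "(\<lambda>n::nat. hnorm H (s n \<ominus> p)) \<longlonglongrightarrow> 0"
    and var: "\<And>k. k \<in> S \<Longrightarrow> Re (inprod H (k \<ominus> p) (x \<ominus> p)) \<le> 0"
    using nearest_point[of S x] S' x by blast
  have "inprod H k (x \<ominus> p) = 0" if k: "k \<in> S" for k
  proof (rule ccontr)
    let ?z = "inprod H k (x \<ominus> p)" and ?b = "Re (inprod H p (x \<ominus> p))"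
    assume "?z \<noteq> 0"
    then have z: "(cmod ?z)\<^sup>2 > 0" by simp
    have kc: "k \<in> carrier H" using k S' by auto
    \<comment> \<open>test the variational inequality with all multiples of \<open>k\<close>\<close>
    have "r * (cmod ?z)\<^sup>2 \<le> ?b" for r :: real
    proof -
      have "Re (inprod H ((r * cnj ?z) \<odot> k \<ominus> p) (x \<ominus> p)) \<le> 0"
        using S' k by (intro var) auto
      then have "Re (r * cnj ?z * ?z) \<le> ?b"
        using kc p x by (simp add: inprod_minus_left inprod_smult_left)
      also have "r * cnj ?z * ?z = complex_of_real (r * (cmod ?z)\<^sup>2)"
        by (simp only: of_real_mult complex_norm_square) (simp only: mult_ac)
      finally show ?thesis by simp
    qed
    from this[of "(?b + 1) / (cmod ?z)\<^sup>2"] show False using z by simp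
  qed
  then have "x \<ominus> p \<in> orth S" using x p by (auto simp: orth_def)
  then show ?thesis using p by blast
qed

lemma
  assumes "linear_subset S" "x \<in> carrier H"
  shows proj_closed [simp]: "proj S x \<in> carrier H"
    and proj_orth: "x \<ominus> proj S x \<in> orth S"
    and proj_approx: "\<exists>s. (\<forall>n::nat. s n \<in> S) \<and> (\<lambda>n. hnorm H (s n \<ominus> proj S x)) \<longlonglongrightarrow> 0"
  using someI_ex[OF proj_exists[OF assms]] unfolding proj_def[symmetric] by auto

lemma proj_inprod_orth:
  assumes "linear_subset S" "x \<in> carrier H" "y \<in> orth S"
  shows "inprod H (proj S x) y = 0"
proof -
  obtain s where s: "\<And>n::nat. s n \<in> S" "(\<lambda>n. hnorm H (s n \<ominus> proj S x)) \<longlonglongrightarrow> 0"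
    using proj_approx[OF assms(1,2)] by blast
  have y: "y \<in> carrier H" using assms by (auto simp: orth_def)
  have sc: "s n \<in> carrier H" for n using s(1)[of n] linear_subsetD(1)[OF assms(1)] by auto
  have "(\<lambda>n. inprod H (s n) y) \<longlonglongrightarrow> inprod H (proj S x) y"
    by (rule tendsto_inprod) (use s sc y assms in auto)
  moreover have "inprod H (s n) y = 0" for n
    using s(1)[of n] assms by (auto simp: orth_def)
  ultimately show ?thesis by (simp add: LIMSEQ_const_iff)
qed

text \<open>Instead of lying in the closure of \<open>S\<close>, the candidate may be orthogonal to the
  orthogonal complement of \<open>S\<close>.  Operators preserve this condition by moving them to the
  other side of the inner product, so no limits are involved in its verification.\<close>

lemma proj_unique:
  assumes S: "linear_subset S" and x: "x \<in> carrier H" and p: "p \<in> carrier H"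
    and orth: "x \<ominus> p \<in> orth S" and oo: "\<And>y. y \<in> orth S \<Longrightarrow> inprod H p y = 0"
  shows "proj S x = p"
proof -
  let ?d = "p \<ominus> proj S x"
  have eq: "?d = (x \<ominus> proj S x) \<ominus> (x \<ominus> p)"
    by (rule vector_eqI) (use assms in \<open>auto simp: inprod_linear\<close>)
  have d: "?d \<in> orth S"
    unfolding eq using proj_orth[OF S x] orth x p S linear_subsetD(1)[OF S]
    by (auto simp: orth_def inprod_minus_right subsetD)
  have "inprod H ?d ?d = 0"
    using oo[OF d] proj_inprod_orth[OF S x d] S x p by (subst inprod_minus_left) auto
  then have "?d = \<zero>" using S x p by (intro inprod_definite) auto
  then show ?thesis using S x p by (simp add: minus_eq_zero_iff)
qed

lemma proj_mem:
  assumes S: "linear_subset S" and s: "s \<in> S"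
  shows "proj S s = s"
proof (rule proj_unique[OF S])
  show sc: "s \<in> carrier H" "s \<in> carrier H" using s linear_subsetD(1)[OF S] by auto
  have "s \<ominus> s = \<zero>" using sc by simp
  then show "s \<ominus> s \<in> orth S" using linear_subsetD(1)[OF S] by (auto simp: orth_def)
qed (use s in \<open>auto simp: orth_def\<close>)

lemma proj_inprod_proj:
  assumes "linear_subset S" "x \<in> carrier H" "y \<in> carrier H"
  shows "inprod H (proj S x) y = inprod H (proj S x) (proj S y)"
  using proj_inprod_orth[OF assms(1,2) proj_orth[OF assms(1,3)]] assms
  by (simp add: inprod_minus_right)

lemma proj_selfadjoint:
  assumes "linear_subset S" "x \<in> carrier H" "y \<in> carrier H"
  shows "inprod H (proj S x) y = inprod H x (proj S y)"
  using proj_inprod_proj[OF assms] proj_inprod_proj[OF assms(1,3,2)] assms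
    inprod_commute[of x "proj S y"] inprod_commute[of "proj S x" "proj S y"] by simp

lemma hnorm_proj_le:
  assumes "linear_subset S" "x \<in> carrier H"
  shows "hnorm H (proj S x) \<le> hnorm H x"
proof (rule power2_le_imp_le)
  have "inprod H (x \<ominus> proj S x) (proj S x) = 0"
    using proj_inprod_proj[OF assms assms(2)] proj_selfadjoint[OF assms assms(2)] assms
    by (simp add: inprod_minus_left)
  then have "Re (inprod H x (proj S x)) = (hnorm H (proj S x))\<^sup>2"
    using assms by (simp add: inprod_minus_left inprod_self)
  then show "(hnorm H (proj S x))\<^sup>2 \<le> (hnorm H x)\<^sup>2"
    using hnorm_minus_sq[OF assms(2) proj_closed[OF assms]]
      zero_le_power2[of "hnorm H (x \<ominus> proj S x)"] by linarith
qed (use assms in auto)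

text \<open>When an operator and its adjoint preserve \<open>S\<close>, they preserve the orthogonal complement
  as well.\<close>

lemma proj_commute:
  assumes S: "linear_subset S" and x: "x \<in> carrier H"
    and a: "\<And>x. x \<in> carrier H \<Longrightarrow> a x \<in> carrier H" "\<And>x. x \<in> S \<Longrightarrow> a x \<in> S"
    and b: "\<And>x. x \<in> carrier H \<Longrightarrow> b x \<in> carrier H" "\<And>x. x \<in> S \<Longrightarrow> b x \<in> S"
    and adj: "\<And>x y. x \<in> carrier H \<Longrightarrow> y \<in> carrier H \<Longrightarrow> inprod H (a x) y = inprod H x (b y)"
  shows "proj S (a x) = a (proj S x)"
proof (rule proj_unique[OF S])
  have adj': "inprod H y (a x) = inprod H (b y) x" if "x \<in> carrier H" "y \<in> carrier H" for x y
    using adj[OF that] inprod_commute[of y "a x"] inprod_commute[of "b y" x] that a b by simp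
  note Sc = linear_subsetD(1)[OF S]
  show "a x \<ominus> a (proj S x) \<in> orth S"
  proof -
    have "inprod H s (a x \<ominus> a (proj S x)) = 0" if s: "s \<in> S" for s
    proof -
      have "s \<in> carrier H" using Sc s by auto
      then have "inprod H s (a x \<ominus> a (proj S x)) = inprod H (b s) (x \<ominus> proj S x)"
        using S x a b by (simp add: inprod_minus_right adj')
      also have "\<dots> = 0" using proj_orth[OF S x] b(2)[OF s] by (auto simp: orth_def)
      finally show ?thesis .
    qed
    then show ?thesis using S x a by (auto simp: orth_def)
  qed
  fix y assume y: "y \<in> orth S"
  then have yc: "y \<in> carrier H" by (auto simp: orth_def)
  have "b y \<in> orth S"
    using y yc b a Sc adj by (auto simp: orth_def simp flip: adj)
  then show "inprod H (a (proj S x)) y = 0"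
    using proj_inprod_orth[OF S x] S x yc by (simp add: adj)
qed (use S x a in auto)

lemma proj_add:
  assumes "linear_subset S" "x \<in> carrier H" "y \<in> carrier H"
  shows "proj S (x \<oplus> y) = proj S x \<oplus> proj S y"
  by (rule vector_eqI) (use assms in \<open>auto simp: proj_selfadjoint inprod_linear\<close>)

lemma proj_minus:
  assumes "linear_subset S" "x \<in> carrier H" "y \<in> carrier H"
  shows "proj S (x \<ominus> y) = proj S x \<ominus> proj S y"
  by (rule vector_eqI) (use assms in \<open>auto simp: proj_selfadjoint inprod_linear\<close>)

text \<open>A vector orthogonal to the kernel, rescaled, represents the functional.\<close>

lemma Riesz_representation:
  assumes add: "\<And>x y. x \<in> carrier H \<Longrightarrow> y \<in> carrier H \<Longrightarrow> f (x \<oplus> y) = f x + f y"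
    and smult: "\<And>c x. x \<in> carrier H \<Longrightarrow> f (c \<odot> x) = c * f x"
    and bound: "\<And>x. x \<in> carrier H \<Longrightarrow> cmod (f x) \<le> C * hnorm H x"
  obtains z where "z \<in> carrier H" "\<And>x. x \<in> carrier H \<Longrightarrow> f x = inprod H x z"
proof (cases "\<forall>x\<in>carrier H. f x = 0")
  case True
  then show thesis using that[of \<zero>] by auto
next
  case False
  then obtain u where u: "u \<in> carrier H" "f u \<noteq> 0" by blast
  have minus: "f (x \<ominus> y) = f x - f y" if "x \<in> carrier H" "y \<in> carrier H" for x y
  proof -
    have "x = (x \<ominus> y) \<oplus> y"
      by (rule vector_eqI) (use that in \<open>auto simp: inprod_linear\<close>)
    then show ?thesis using add[of "x \<ominus> y" y] that by auto
  qed
  define S where "S = {x \<in> carrier H. f x = 0}"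
  have f0: "f \<zero> = 0" using smult[of \<zero> 0] by simp
  have S: "linear_subset S"
    by (auto simp: S_def linear_subset_def add smult f0)
  obtain s where s: "\<And>n::nat. s n \<in> S" "(\<lambda>n. hnorm H (s n \<ominus> proj S u)) \<longlonglongrightarrow> 0"
    using proj_approx[OF S u(1)] by blast
  have sc: "s n \<in> carrier H" "f (s n) = 0" for n using s(1)[of n] by (auto simp: S_def)
  have "f (proj S u) = 0"
  proof -
    have "(\<lambda>n. C * hnorm H (s n \<ominus> proj S u)) \<longlonglongrightarrow> C * 0"
      by (intro tendsto_intros s)
    moreover have "cmod (f (proj S u)) \<le> C * hnorm H (s n \<ominus> proj S u)" for n
      using bound[of "s n \<ominus> proj S u"] sc S u by (simp add: minus)
    ultimately have "cmod (f (proj S u)) \<le> C * 0"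
      by (intro LIMSEQ_le_const) auto
    then show ?thesis by simp
  qed
  define w where "w = u \<ominus> proj S u"
  have w: "w \<in> carrier H" "f w \<noteq> 0" "w \<in> orth S"
    using u S \<open>f (proj S u) = 0\<close> proj_orth[OF S u(1)] by (auto simp: w_def minus)
  then have "w \<noteq> \<zero>" using f0 by auto
  then have nw: "inprod H w w \<noteq> 0" using w inprod_definite by blast
  have cnw: "cnj (inprod H w w) = inprod H w w" using inprod_commute[of w w] w by simp
  show thesis
  proof (rule that[of "(cnj (f w) / inprod H w w) \<odot> w"])
    fix x assume x: "x \<in> carrier H"
    have "f w \<odot> x \<ominus> f x \<odot> w \<in> S"
      using x w by (auto simp: S_def minus smult)
    then have "inprod H (f w \<odot> x \<ominus> f x \<odot> w) w = 0" using w by (auto simp: orth_def)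
    then have "f w * inprod H x w = f x * inprod H w w"
      using x w by (simp add: inprod_linear)
    then show "f x = inprod H x ((cnj (f w) / inprod H w w) \<odot> w)"
      using x w nw cnw by (simp add: inprod_linear field_simps)
  next
    show "(cnj (f w) / inprod H w w) \<odot> w \<in> carrier H" using w(1) by (rule scale_closed)
  qed
qed

end


section \<open>Bounded operators and adjoints\<close>

context hilbert_space
begin

lemma scale_0 [simp]: "x \<in> carrier H \<Longrightarrow> 0 \<odot> x = \<zero>"
  by (rule vector_eqI) (auto simp: inprod_linear)

lemma bounded_opsD:
  assumes "T \<in> bounded_ops H"
  shows "x \<in> carrier H \<Longrightarrow> T x \<in> carrier H" "x \<notin> carrier H \<Longrightarrow> T x = undefined"
    "x \<in> carrier H \<Longrightarrow> y \<in> carrier H \<Longrightarrow> T (x \<oplus> y) = T x \<oplus> T y"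
    "x \<in> carrier H \<Longrightarrow> T (c \<odot> x) = c \<odot> T x"
  using assms PiE_arb[of T "carrier H" "\<lambda>_. carrier H"] PiE_mem[of T "carrier H" "\<lambda>_. carrier H"]
  by (simp_all add: bounded_ops_def)

lemma bounded_ops_bound:
  assumes "T \<in> bounded_ops H"
  obtains C where "C \<ge> 0" "\<And>x. x \<in> carrier H \<Longrightarrow> hnorm H (T x) \<le> C * hnorm H x"
proof -
  obtain C where C: "\<And>x. x \<in> carrier H \<Longrightarrow> hnorm H (T x) \<le> C * hnorm H x"
    using assms unfolding bounded_ops_def by blast
  show thesis
  proof (rule that[of "max C 0"])
    fix x assume "x \<in> carrier H"
    then show "hnorm H (T x) \<le> max C 0 * hnorm H x"
      using C[of x] mult_right_mono[of C "max C 0" "hnorm H x"] by simp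
  qed simp
qed

lemma bounded_ops_minus:
  assumes "T \<in> bounded_ops H" "x \<in> carrier H" "y \<in> carrier H"
  shows "T (x \<ominus> y) = T x \<ominus> T y"
  using assms bounded_opsD[OF assms(1)] by (simp add: minus_as_add)

lemma bounded_ops_eqI:
  assumes "S \<in> bounded_ops H" "T \<in> bounded_ops H" "\<And>x. x \<in> carrier H \<Longrightarrow> S x = T x"
  shows "S = T"
  using assms bounded_opsD(2) by (metis ext)

text \<open>The existence of an adjoint forces linearity.\<close>

lemma bounded_opsI:
  assumes T: "T \<in> carrier H \<rightarrow>\<^sub>E carrier H" and S: "\<And>x. x \<in> carrier H \<Longrightarrow> S x \<in> carrier H"
    and adj: "\<And>x y. x \<in> carrier H \<Longrightarrow> y \<in> carrier H \<Longrightarrow> inprod H (T x) y = inprod H x (S y)"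
    and bound: "\<And>x. x \<in> carrier H \<Longrightarrow> hnorm H (T x) \<le> C * hnorm H x"
  shows "T \<in> bounded_ops H"
proof -
  have Tc: "T x \<in> carrier H" if "x \<in> carrier H" for x using T that by auto
  have "T (x \<oplus> y) = T x \<oplus> T y" if "x \<in> carrier H" "y \<in> carrier H" for x y
    by (rule vector_eqI) (use that Tc S in \<open>auto simp: inprod_linear adj\<close>)
  moreover have "T (c \<odot> x) = c \<odot> T x" if "x \<in> carrier H" for x c
    by (rule vector_eqI) (use that Tc S in \<open>auto simp: inprod_linear adj\<close>)
  moreover have "\<exists>C. \<forall>x\<in>carrier H. hnorm H (T x) \<le> C * hnorm H x" using bound by blast
  ultimately show ?thesis using T by (simp add: bounded_ops_def)
qed

text \<open>For \<open>T\<close> bounded by \<open>C\<close>, this is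
  \<open>\<parallel>Sy\<parallel>\<^sup>2 = \<langle>TSy, y\<rangle> \<le> C \<parallel>Sy\<parallel> \<parallel>y\<parallel>\<close>.\<close>

lemma hnorm_adjoint_le:
  assumes T: "\<And>x. x \<in> carrier H \<Longrightarrow> T x \<in> carrier H" and S: "\<And>x. x \<in> carrier H \<Longrightarrow> S x \<in> carrier H"
    and adj: "\<And>x y. x \<in> carrier H \<Longrightarrow> y \<in> carrier H \<Longrightarrow> inprod H (T x) y = inprod H x (S y)"
    and C: "C \<ge> 0" "\<And>x. x \<in> carrier H \<Longrightarrow> hnorm H (T x) \<le> C * hnorm H x"
    and y: "y \<in> carrier H"
  shows "hnorm H (S y) \<le> C * hnorm H y"
proof -
  have "(hnorm H (S y))\<^sup>2 = Re (inprod H (T (S y)) y)"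
    using y S by (simp add: adj inprod_self)
  also have "\<dots> \<le> hnorm H (T (S y)) * hnorm H y"
    using Cauchy_Schwarz[OF T[OF S[OF y]] y] complex_Re_le_cmod order_trans by blast
  also have "\<dots> \<le> (C * hnorm H (S y)) * hnorm H y"
    using y S C by (intro mult_right_mono) auto
  finally have "hnorm H (S y) * hnorm H (S y) \<le> hnorm H (S y) * (C * hnorm H y)"
    by (simp add: power2_eq_square mult_ac)
  then show ?thesis
    using S[OF y] C y by (cases "hnorm H (S y) = 0") (auto simp: mult_le_cancel_left less_le)
qed

lemma adjoint_exists:
  assumes T: "T \<in> bounded_ops H"
  shows "\<exists>!S. S \<in> bounded_ops H \<and>
     (\<forall>x\<in>carrier H. \<forall>y\<in>carrier H. inprod H (T x) y = inprod H x (S y))"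
proof -
  note Tc = bounded_opsD[OF T]
  obtain C where C: "C \<ge> 0" "\<And>x. x \<in> carrier H \<Longrightarrow> hnorm H (T x) \<le> C * hnorm H x"
    using bounded_ops_bound[OF T] by blast
  have "\<exists>z\<in>carrier H. \<forall>x\<in>carrier H. inprod H (T x) y = inprod H x z" if y: "y \<in> carrier H" for y
  proof (rule Riesz_representation[of "\<lambda>x. inprod H (T x) y" "C * hnorm H y"])
    fix x assume x: "x \<in> carrier H"
    have "cmod (inprod H (T x) y) \<le> hnorm H (T x) * hnorm H y"
      using Tc x y by (intro Cauchy_Schwarz) auto
    also have "\<dots> \<le> (C * hnorm H x) * hnorm H y"
      using C x y by (intro mult_right_mono) auto
    finally show "cmod (inprod H (T x) y) \<le> C * hnorm H y * hnorm H x" by (simp add: mult_ac)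
  qed (use Tc y in \<open>auto simp: inprod_linear\<close>)
  then obtain S0 where S0: "\<And>y. y \<in> carrier H \<Longrightarrow> S0 y \<in> carrier H"
    "\<And>x y. x \<in> carrier H \<Longrightarrow> y \<in> carrier H \<Longrightarrow> inprod H (T x) y = inprod H x (S0 y)"
    by metis
  define S where "S = restrict S0 (carrier H)"
  have S: "\<And>y. y \<in> carrier H \<Longrightarrow> S y \<in> carrier H"
    "\<And>x y. x \<in> carrier H \<Longrightarrow> y \<in> carrier H \<Longrightarrow> inprod H (T x) y = inprod H x (S y)"
    using S0 by (auto simp: S_def)
  have S': "inprod H (S y) x = inprod H y (T x)" if "x \<in> carrier H" "y \<in> carrier H" for x y
    using S(2)[OF that] inprod_commute[of y "T x"] inprod_commute[of "S y" x] that S Tc by simp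
  have "S \<in> bounded_ops H"
  proof (rule bounded_opsI[of S T C])
    show "hnorm H (S y) \<le> C * hnorm H y" if "y \<in> carrier H" for y
      by (rule hnorm_adjoint_le[OF Tc(1) S C that])
  qed (use S S' Tc in \<open>auto simp: S_def\<close>)
  moreover have "R = S" if "R \<in> bounded_ops H"
    "\<forall>x\<in>carrier H. \<forall>y\<in>carrier H. inprod H (T x) y = inprod H x (R y)" for R
  proof (rule bounded_ops_eqI[OF that(1) \<open>S \<in> bounded_ops H\<close>])
    fix y assume y: "y \<in> carrier H"
    note Rc = bounded_opsD(1)[OF that(1)]
    have "inprod H (R y) x = inprod H (S y) x" if "x \<in> carrier H" for x
      using \<open>\<forall>x\<in>carrier H. \<forall>y\<in>carrier H. inprod H (T x) y = inprod H x (R y)\<close> S that y Rc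
        inprod_commute[of "R y" x] inprod_commute[of "S y" x] by simp
    then show "R y = S y" using vector_eqI Rc S y by simp
  qed
  ultimately show ?thesis using S(2) by (intro ex1I[of _ S]) simp_all
qed

lemma
  assumes "T \<in> bounded_ops H"
  shows op_adjoint_bounded: "op_adjoint H T \<in> bounded_ops H"
    and inprod_op_adjoint: "\<And>x y. x \<in> carrier H \<Longrightarrow> y \<in> carrier H \<Longrightarrow>
      inprod H (T x) y = inprod H x (op_adjoint H T y)"
  using theI'[OF adjoint_exists[OF assms]] unfolding op_adjoint_def[symmetric] by auto

lemma inprod_op_adjoint':
  assumes "T \<in> bounded_ops H" "x \<in> carrier H" "y \<in> carrier H"
  shows "inprod H (op_adjoint H T y) x = inprod H y (T x)"
  using inprod_op_adjoint[OF assms] inprod_commute[of y "T x"]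
    inprod_commute[of "op_adjoint H T y" x] assms bounded_opsD(1)[OF assms(1)]
    bounded_opsD(1)[OF op_adjoint_bounded[OF assms(1)]] by simp

lemma op_adjoint_eqI:
  assumes "T \<in> bounded_ops H" "S \<in> bounded_ops H"
    and "\<And>x y. x \<in> carrier H \<Longrightarrow> y \<in> carrier H \<Longrightarrow> inprod H (T x) y = inprod H x (S y)"
  shows "op_adjoint H T = S"
  unfolding op_adjoint_def using assms by (intro the1_equality[OF adjoint_exists]) simp_all

lemma op_adjoint_adjoint:
  assumes "T \<in> bounded_ops H"
  shows "op_adjoint H (op_adjoint H T) = T"
  by (rule op_adjoint_eqI[OF op_adjoint_bounded[OF assms] assms]) (rule inprod_op_adjoint'[OF assms])

lemma hnorm_op_adjoint_le:
  assumes T: "T \<in> bounded_ops H" and C: "C \<ge> 0" "\<And>x. x \<in> carrier H \<Longrightarrow> hnorm H (T x) \<le> C * hnorm H x"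
    and y: "y \<in> carrier H"
  shows "hnorm H (op_adjoint H T y) \<le> C * hnorm H y"
  by (rule hnorm_adjoint_le[OF bounded_opsD(1)[OF T] bounded_opsD(1)[OF op_adjoint_bounded[OF T]]
      inprod_op_adjoint[OF T] C y])

lemma op_comp_apply: "x \<in> carrier H \<Longrightarrow> op_comp H S T x = S (T x)"
  by (simp add: compose_def)

lemma op_id_bounded: "op_id H \<in> bounded_ops H"
  by (auto simp: bounded_ops_def op_id_def intro!: exI[of _ 1])

lemma op_add_bounded:
  assumes S: "S \<in> bounded_ops H" and T: "T \<in> bounded_ops H"
  shows "op_add H S T \<in> bounded_ops H"
proof -
  note c = bounded_opsD[OF S] bounded_opsD[OF T]
  obtain C D where C: "\<And>x. x \<in> carrier H \<Longrightarrow> hnorm H (S x) \<le> C * hnorm H x"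
    and D: "\<And>x. x \<in> carrier H \<Longrightarrow> hnorm H (T x) \<le> D * hnorm H x"
    using bounded_ops_bound[OF S] bounded_ops_bound[OF T] by metis
  show ?thesis
  proof (rule bounded_opsI[of _ "\<lambda>y. op_adjoint H S y \<oplus> op_adjoint H T y" "C + D"])
    fix x assume x: "x \<in> carrier H"
    then show "hnorm H (op_add H S T x) \<le> (C + D) * hnorm H x"
      using hnorm_triangle[of "S x" "T x"] C[OF x] D[OF x] c
      by (simp add: op_add_def distrib_right)
  qed (use c bounded_opsD[OF op_adjoint_bounded[OF S]] bounded_opsD[OF op_adjoint_bounded[OF T]] in
      \<open>auto simp: op_add_def inprod_linear inprod_op_adjoint S T\<close>)
qed

lemma op_smult_bounded:
  assumes T: "T \<in> bounded_ops H"
  shows "op_smult H c T \<in> bounded_ops H"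
proof -
  note cl = bounded_opsD[OF T]
  obtain D where D: "\<And>x. x \<in> carrier H \<Longrightarrow> hnorm H (T x) \<le> D * hnorm H x"
    using bounded_ops_bound[OF T] by metis
  show ?thesis
  proof (rule bounded_opsI[of _ "\<lambda>y. cnj c \<odot> op_adjoint H T y" "cmod c * D"])
    fix x assume x: "x \<in> carrier H"
    then show "hnorm H (op_smult H c T x) \<le> cmod c * D * hnorm H x"
      using D[OF x] cl by (simp add: op_smult_def mult_left_mono mult.assoc)
  qed (use cl bounded_opsD[OF op_adjoint_bounded[OF T]] in
      \<open>auto simp: op_smult_def inprod_linear inprod_op_adjoint T\<close>)
qed

lemma op_comp_bounded:
  assumes S: "S \<in> bounded_ops H" and T: "T \<in> bounded_ops H"
  shows "op_comp H S T \<in> bounded_ops H"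
proof -
  note c = bounded_opsD[OF S] bounded_opsD[OF T]
  obtain C D where C: "C \<ge> 0" "\<And>x. x \<in> carrier H \<Longrightarrow> hnorm H (S x) \<le> C * hnorm H x"
    and D: "\<And>x. x \<in> carrier H \<Longrightarrow> hnorm H (T x) \<le> D * hnorm H x"
    using bounded_ops_bound[OF S] bounded_ops_bound[OF T] by metis
  show ?thesis
  proof (rule bounded_opsI[of _ "\<lambda>y. op_adjoint H T (op_adjoint H S y)" "C * D"])
    fix x assume x: "x \<in> carrier H"
    have "hnorm H (S (T x)) \<le> C * hnorm H (T x)" by (rule C(2)[OF bounded_opsD(1)[OF T x]])
    also have "\<dots> \<le> C * (D * hnorm H x)" using C D x by (intro mult_left_mono) auto
    finally show "hnorm H (op_comp H S T x) \<le> C * D * hnorm H x"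
      using x by (simp add: op_comp_apply mult.assoc)
  qed (use c bounded_opsD[OF op_adjoint_bounded[OF S]] bounded_opsD[OF op_adjoint_bounded[OF T]] in
      \<open>auto simp: op_comp_apply inprod_op_adjoint S T compose_def\<close>)
qed

lemma
  assumes T: "T \<in> bounded_ops H"
  shows opnorm_bound: "x \<in> carrier H \<Longrightarrow> hnorm H (T x) \<le> opnorm H T * hnorm H x"
    and opnorm_nonneg: "opnorm H T \<ge> 0"
proof -
  obtain C where C: "C \<ge> 0" "\<And>x. x \<in> carrier H \<Longrightarrow> hnorm H (T x) \<le> C * hnorm H x"
    using bounded_ops_bound[OF T] by blast
  have bdd: "bdd_above ((\<lambda>x. hnorm H (T x)) ` {x \<in> carrier H. hnorm H x \<le> 1})"
  proof (rule bdd_aboveI2)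
    fix x assume "x \<in> {x \<in> carrier H. hnorm H x \<le> 1}"
    then show "hnorm H (T x) \<le> C" using C(2)[of x] C(1) mult_left_mono[of "hnorm H x" 1 C] by auto
  qed
  have upper: "hnorm H (T x) \<le> opnorm H T" if "x \<in> carrier H" "hnorm H x \<le> 1" for x
    unfolding opnorm_def using that bdd by (intro cSUP_upper) auto
  have T0: "T \<zero> = \<zero>" using bounded_opsD(4)[OF T, of \<zero> 0] bounded_opsD(1)[OF T, of \<zero>] by simp
  show "opnorm H T \<ge> 0" using upper[of \<zero>] T0 by simp
  assume x: "x \<in> carrier H"
  show "hnorm H (T x) \<le> opnorm H T * hnorm H x"
  proof (cases "hnorm H x = 0")
    case True
    then show ?thesis using x T0 by (simp add: hnorm_eq_0)
  next
    case False
    then have pos: "hnorm H x > 0" using x hnorm_nonneg[of x] by linarith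
    have "hnorm H (T (complex_of_real (1 / hnorm H x) \<odot> x)) \<le> opnorm H T"
      using x pos by (intro upper) (auto simp: norm_divide)
    then have "hnorm H (T x) / hnorm H x \<le> opnorm H T"
      using x pos bounded_opsD[OF T] by (simp add: norm_divide)
    then show ?thesis using pos by (simp add: divide_le_eq)
  qed
qed

lemma opnorm_le:
  assumes "T \<in> bounded_ops H" "C \<ge> 0" "\<And>x. x \<in> carrier H \<Longrightarrow> hnorm H (T x) \<le> C * hnorm H x"
  shows "opnorm H T \<le> C"
  unfolding opnorm_def
proof (rule cSUP_least)
  show "{x \<in> carrier H. hnorm H x \<le> 1} \<noteq> {}" using M.zero_closed by force
  fix x assume "x \<in> {x \<in> carrier H. hnorm H x \<le> 1}"
  then show "hnorm H (T x) \<le> C"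
    using assms(3)[of x] assms(2) mult_left_mono[of "hnorm H x" 1 C] by auto
qed

end


section \<open>The strong operator topology and commutants\<close>

context hilbert_space
begin

text \<open>A basic open set of the product topology restricts finitely many coordinates, and
  finitely many balls contain balls of a common radius.\<close>

lemma strong_closure_iff:
  assumes S: "S \<subseteq> bounded_ops H"
  shows "T \<in> (strong_op_topology H) closure_of S \<longleftrightarrow> T \<in> bounded_ops H \<and>
    (\<forall>F e. finite F \<longrightarrow> F \<subseteq> carrier H \<longrightarrow> e > 0 \<longrightarrow> (\<exists>A\<in>S. \<forall>x\<in>F. hnorm H (A x \<ominus> T x) < e))"
    (is "?L \<longleftrightarrow> ?R")
proof -
  let ?X = "product_topology (\<lambda>_. dist.mtopology) (carrier H)"
  have in_X: "A \<in> topspace ?X" if "A \<in> bounded_ops H" for A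
    using that by (auto simp: bounded_ops_def)
  have "strong_op_topology H closure_of S = bounded_ops H \<inter> ?X closure_of S"
    unfolding strong_op_topology_def
    using S by (intro closure_of_subtopology_open) auto
  then have L: "?L \<longleftrightarrow> T \<in> bounded_ops H \<and> T \<in> ?X closure_of S" by auto
  have "T \<in> ?X closure_of S \<longleftrightarrow>
    (\<forall>F e. finite F \<longrightarrow> F \<subseteq> carrier H \<longrightarrow> e > 0 \<longrightarrow> (\<exists>A\<in>S. \<forall>x\<in>F. hnorm H (A x \<ominus> T x) < e))"
    if T: "T \<in> bounded_ops H"
  proof (intro iffI allI impI)
    note Tc = bounded_opsD(1)[OF T]
    fix F e assume cl: "T \<in> ?X closure_of S" and F: "finite F" "F \<subseteq> carrier H" and e: "(e::real) > 0"
    let ?U = "Pi\<^sub>E (carrier H) (\<lambda>x. if x \<in> F then dist.mball (T x) e else carrier H)"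
    have "openin ?X ?U"
    proof (subst openin_PiE_gen, intro disjI2 conjI ballI)
      show "finite {x \<in> carrier H. (if x \<in> F then dist.mball (T x) e else carrier H)
          \<noteq> topspace dist.mtopology}"
        by (rule finite_subset[OF _ F(1)]) auto
      show "openin dist.mtopology (if x \<in> F then dist.mball (T x) e else carrier H)" if "x \<in> carrier H" for x
        using openin_topspace[of dist.mtopology] by auto
    qed
    moreover have "T \<in> ?U"
      using T e Tc F by (auto simp: PiE_iff extensional_def bounded_opsD(2) hdist_def)
    ultimately obtain A where A: "A \<in> S" "A \<in> ?U" using cl by (auto simp: in_closure_of)
    have "hnorm H (A x \<ominus> T x) < e" if x: "x \<in> F" for x
    proof -
      have "A x \<in> dist.mball (T x) e" using A(2) x F(2) PiE_mem[OF A(2), of x] by auto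
      then show ?thesis using hnorm_minus_commute[of "A x" "T x"] by (auto simp: hdist_def)
    qed
    then show "\<exists>A\<in>S. \<forall>x\<in>F. hnorm H (A x \<ominus> T x) < e" using A by blast
  next
    note Tc = bounded_opsD(1)[OF T]
    assume R: "\<forall>F e. finite F \<longrightarrow> F \<subseteq> carrier H \<longrightarrow> e > 0 \<longrightarrow> (\<exists>A\<in>S. \<forall>x\<in>F. hnorm H (A x \<ominus> T x) < e)"
    show "T \<in> ?X closure_of S"
      unfolding in_closure_of
    proof (intro conjI allI impI)
      show "T \<in> topspace ?X" using in_X[OF T] .
      fix V assume V: "T \<in> V \<and> openin ?X V"
      then have "\<exists>U. finite {i \<in> carrier H. U i \<noteq> topspace dist.mtopology} \<and>
          (\<forall>i\<in>carrier H. openin dist.mtopology (U i)) \<and> T \<in> Pi\<^sub>E (carrier H) U \<and>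
          Pi\<^sub>E (carrier H) U \<subseteq> V"
        by (simp add: openin_product_topology_alt)
      then obtain U where U: "finite {i \<in> carrier H. U i \<noteq> topspace dist.mtopology}"
        "\<And>i. i \<in> carrier H \<Longrightarrow> openin dist.mtopology (U i)" "T \<in> Pi\<^sub>E (carrier H) U"
        "Pi\<^sub>E (carrier H) U \<subseteq> V"
        by blast
      define F where "F = {i \<in> carrier H. U i \<noteq> carrier H}"
      have F: "finite F" "F \<subseteq> carrier H" using U(1) by (auto simp: F_def)
      have "\<exists>r>0. dist.mball (T i) r \<subseteq> U i" if "i \<in> F" for i
      proof -
        have i: "i \<in> carrier H" using that F by auto
        then have "T i \<in> U i" using U(3) by auto
        then show ?thesis using U(2)[OF i] by (simp add: dist.openin_mtopology)
      qed
      then obtain r where r: "\<And>i. i \<in> F \<Longrightarrow> r i > 0 \<and> dist.mball (T i) (r i) \<subseteq> U i" by metis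
      define e where "e = Min (insert 1 (r ` F))"
      have e: "e > 0" "\<And>i. i \<in> F \<Longrightarrow> e \<le> r i" using F r by (auto simp: e_def)
      obtain A where A: "A \<in> S" "\<And>x. x \<in> F \<Longrightarrow> hnorm H (A x \<ominus> T x) < e"
        using R F e by meson
      have Ab: "A \<in> bounded_ops H" using A S by auto
      have "A \<in> Pi\<^sub>E (carrier H) U"
      proof (rule PiE_I)
        fix x assume x: "x \<in> carrier H"
        show "A x \<in> U x"
        proof (cases "x \<in> F")
          case True
          have "hnorm H (T x \<ominus> A x) < r x"
            using A(2)[OF True] e(2)[OF True] hnorm_minus_commute[of "A x" "T x"] x Tc
              bounded_opsD(1)[OF Ab] by auto
          then have "A x \<in> dist.mball (T x) (r x)"
            using x Tc bounded_opsD(1)[OF Ab] by (auto simp: hdist_def)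
          then show ?thesis using r True by blast
        next
          case False
          then show ?thesis using x bounded_opsD(1)[OF Ab] by (auto simp: F_def)
        qed
      qed (use bounded_opsD(2)[OF Ab] in auto)
      then show "\<exists>y. y \<in> S \<and> y \<in> V" using A(1) U(4) by auto
    qed
  qed
  then show ?thesis using L by blast
qed

lemma mem_commutant_iff:
  "T \<in> commutant H B \<longleftrightarrow> T \<in> bounded_ops H \<and> (\<forall>b\<in>B. \<forall>x\<in>carrier H. T (b x) = b (T x))"
proof -
  have "op_comp H T b = op_comp H b T \<longleftrightarrow> (\<forall>x\<in>carrier H. T (b x) = b (T x))" for b
    by (auto simp: compose_def fun_eq_iff restrict_def)
  then show ?thesis by (auto simp: commutant_def)
qed

lemma topspace_strong_op_topology: "topspace (strong_op_topology H) = bounded_ops H"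
  by (auto simp: strong_op_topology_def bounded_ops_def)

lemma commutant_closed:
  assumes B: "B \<subseteq> bounded_ops H"
  shows "closedin (strong_op_topology H) (commutant H B)"
proof -
  have sub: "commutant H B \<subseteq> bounded_ops H" by (auto simp: commutant_def)
  have "T \<in> commutant H B" if T: "T \<in> strong_op_topology H closure_of commutant H B" for T
    unfolding mem_commutant_iff
  proof (intro conjI ballI)
    show Tb: "T \<in> bounded_ops H" using T strong_closure_iff[OF sub] by blast
    fix b x assume b: "b \<in> B" and x: "x \<in> carrier H"
    have bb: "b \<in> bounded_ops H" using b B by auto
    note Tc = bounded_opsD(1)[OF Tb] and bc = bounded_opsD(1)[OF bb]
    obtain D where D: "D \<ge> 0" "\<And>x. x \<in> carrier H \<Longrightarrow> hnorm H (b x) \<le> D * hnorm H x"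
      using bounded_ops_bound[OF bb] by blast
    have "hnorm H (T (b x) \<ominus> b (T x)) \<le> 0"
    proof (rule field_le_epsilon)
      fix e :: real assume e: "e > 0"
      define d where "d = e / (D + 1)"
      have d: "d > 0" using e D by (simp add: d_def)
      have "\<forall>F e. finite F \<longrightarrow> F \<subseteq> carrier H \<longrightarrow> e > 0 \<longrightarrow>
          (\<exists>A\<in>commutant H B. \<forall>x\<in>F. hnorm H (A x \<ominus> T x) < e)"
        using T strong_closure_iff[OF sub] by blast
      from this[rule_format, of "{x, b x}" d]
      obtain A where A: "A \<in> commutant H B" "hnorm H (A x \<ominus> T x) < d" "hnorm H (A (b x) \<ominus> T (b x)) < d"
        using x bc[OF x] d by auto
      have Ab: "A \<in> bounded_ops H" and com: "A (b x) = b (A x)"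
        using A(1) b x by (auto simp: mem_commutant_iff)
      note Ac = bounded_opsD(1)[OF Ab]
      have "hnorm H (T (b x) \<ominus> b (T x)) \<le> hnorm H (T (b x) \<ominus> A (b x)) + hnorm H (A (b x) \<ominus> b (T x))"
        using x Tc bc Ac by (intro hnorm_triangle_minus) auto
      also have "hnorm H (T (b x) \<ominus> A (b x)) = hnorm H (A (b x) \<ominus> T (b x))"
        using x Tc bc Ac by (intro hnorm_minus_commute) auto
      also have "A (b x) \<ominus> b (T x) = b (A x \<ominus> T x)"
        using x Tc Ac by (simp add: com bounded_ops_minus[OF bb])
      also have "hnorm H (b (A x \<ominus> T x)) \<le> D * hnorm H (A x \<ominus> T x)"
        using x Tc Ac by (intro D) auto
      also have "\<dots> \<le> D * d" using A D by (intro mult_left_mono) auto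
      finally have "hnorm H (T (b x) \<ominus> b (T x)) \<le> d + D * d" using A by simp
      also have "\<dots> = (D + 1) * d" by (simp add: algebra_simps)
      also have "\<dots> = e" using D by (simp add: d_def)
      finally show "hnorm H (T (b x) \<ominus> b (T x)) \<le> 0 + e" by simp
    qed
    moreover have "hnorm H (T (b x) \<ominus> b (T x)) \<ge> 0" using x Tc bc by simp
    ultimately have "hnorm H (T (b x) \<ominus> b (T x)) = 0" by linarith
    then show "T (b x) = b (T x)" using x Tc bc by (simp add: hnorm_eq_0 minus_eq_zero_iff)
  qed
  then show ?thesis
    using sub by (intro closure_of_subset_eq[THEN iffD1] conjI) (auto simp: topspace_strong_op_topology)
qed

text \<open>An operator commutes with \<open>S\<close> if \<open>S\<close> lies in its commutant, which is
  strongly closed.\<close>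

lemma commutant_closure:
  assumes S: "S \<subseteq> bounded_ops H"
  shows "commutant H (strong_op_topology H closure_of S) = commutant H S"
proof
  have sub: "S \<subseteq> strong_op_topology H closure_of S"
    using S by (intro closure_of_subset) (simp add: topspace_strong_op_topology)
  then show "commutant H (strong_op_topology H closure_of S) \<subseteq> commutant H S"
    unfolding commutant_def by blast
  show "commutant H S \<subseteq> commutant H (strong_op_topology H closure_of S)"
  proof
    fix T assume T: "T \<in> commutant H S"
    then have Tb: "T \<in> bounded_ops H" by (simp add: commutant_def)
    have "S \<subseteq> commutant H {T}"
      using T S unfolding subset_iff mem_commutant_iff by auto
    moreover have "closedin (strong_op_topology H) (commutant H {T})"
      using Tb by (intro commutant_closed) auto
    ultimately have "strong_op_topology H closure_of S \<subseteq> commutant H {T}"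
      by (rule closure_of_minimal)
    then show "T \<in> commutant H (strong_op_topology H closure_of S)"
      using Tb unfolding subset_iff mem_commutant_iff by auto
  qed
qed

text \<open>Taking adjoints is not strongly continuous, so the strong closure of a
  *-algebra is not visibly closed under adjoints.  For a commutant this is pure algebra, which is why
  the ultraproduct algebra will be identified with a commutant.\<close>

lemma commutant_von_neumann_algebra:
  assumes B: "B \<subseteq> bounded_ops H" and adj: "\<And>b. b \<in> B \<Longrightarrow> op_adjoint H b \<in> B"
  shows "von_neumann_algebra H (commutant H B)"
proof unfold_locales
  note bc = bounded_opsD[OF subsetD[OF B]]
  show "commutant H B \<subseteq> bounded_ops H" by (auto simp: commutant_def)
  show "op_id H \<in> commutant H B"
    using op_id_bounded bc by (auto simp: mem_commutant_iff op_id_def)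
  show "closedin (strong_op_topology H) (commutant H B)" by (rule commutant_closed[OF B])
  fix S T c assume T: "T \<in> commutant H B"
  then have Tb: "T \<in> bounded_ops H" and Tcom: "\<And>b x. b \<in> B \<Longrightarrow> x \<in> carrier H \<Longrightarrow> T (b x) = b (T x)"
    by (auto simp: mem_commutant_iff)
  note Tc = bounded_opsD(1)[OF Tb]
  show "op_smult H c T \<in> commutant H B"
    unfolding mem_commutant_iff using op_smult_bounded[OF Tb] Tc Tcom bc by (simp add: op_smult_def)
  show "op_adjoint H T \<in> commutant H B"
    unfolding mem_commutant_iff
  proof (intro conjI ballI)
    show "op_adjoint H T \<in> bounded_ops H" by (rule op_adjoint_bounded[OF Tb])
    fix b x assume b: "b \<in> B" and x: "x \<in> carrier H"
    have bb: "b \<in> bounded_ops H" using b B by auto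
    note ac = bounded_opsD(1)[OF op_adjoint_bounded[OF Tb]] bounded_opsD(1)[OF op_adjoint_bounded[OF bb]]
    show "op_adjoint H T (b x) = b (op_adjoint H T x)"
    proof (rule vector_eqI)
      fix z assume z: "z \<in> carrier H"
      have "inprod H (op_adjoint H T (b x)) z = inprod H x (op_adjoint H b (T z))"
        using b x z Tc bc by (simp add: inprod_op_adjoint'[OF Tb] inprod_op_adjoint[OF bb])
      also have "op_adjoint H b (T z) = T (op_adjoint H b z)"
        using Tcom[OF adj[OF b] z] by simp
      also have "inprod H x (T (op_adjoint H b z)) = inprod H (b (op_adjoint H T x)) z"
        using x z ac by (simp add: inprod_op_adjoint[OF bb] inprod_op_adjoint'[OF Tb])
      finally show "inprod H (op_adjoint H T (b x)) z = inprod H (b (op_adjoint H T x)) z" .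
    qed (use x b ac bc in auto)
  qed
  assume S: "S \<in> commutant H B"
  then have Sb: "S \<in> bounded_ops H" and Scom: "\<And>b x. b \<in> B \<Longrightarrow> x \<in> carrier H \<Longrightarrow> S (b x) = b (S x)"
    by (auto simp: mem_commutant_iff)
  note Sc = bounded_opsD(1)[OF Sb]
  show "op_add H S T \<in> commutant H B"
    unfolding mem_commutant_iff using op_add_bounded[OF Sb Tb] Tc Sc Tcom Scom bc by (simp add: op_add_def)
  show "op_comp H S T \<in> commutant H B"
    unfolding mem_commutant_iff using op_comp_bounded[OF Sb Tb] Tc Sc Tcom Scom bc by (simp add: compose_def)
qed

end


section \<open>Moving one vector close to another by contractions of an operator algebra\<close>

context hilbert_space
begin

text \<open>Replacing \<open>p\<close> by \<open>s m\<close> changes the inner products by at most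
  \<open>R \<parallel>s m - p\<parallel>\<close>, uniformly in \<open>n\<close>.\<close>

lemma weakly_null_closure:
  assumes z: "\<And>n. z n \<in> carrier H" "\<And>n. hnorm H (z n) \<le> R"
    and null: "\<And>m. ((\<lambda>n. inprod H (z n) (s m)) \<longlongrightarrow> 0) F"
    and s: "\<And>m::nat. s m \<in> carrier H" "p \<in> carrier H" "(\<lambda>m. hnorm H (s m \<ominus> p)) \<longlonglongrightarrow> 0"
  shows "((\<lambda>n. inprod H (z n) p) \<longlongrightarrow> 0) F"
proof (rule tendstoI)
  fix e :: real assume e: "e > 0"
  have R: "R \<ge> 0" using z(1) z(2) hnorm_nonneg order_trans by blast
  have "(\<lambda>m. R * hnorm H (s m \<ominus> p)) \<longlonglongrightarrow> R * 0" by (intro tendsto_intros s)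
  then have "\<forall>\<^sub>F m in sequentially. R * hnorm H (s m \<ominus> p) < e / 2"
    using e by (intro order_tendstoD(2)[where a = "e / 2"]) auto
  then obtain m where m: "R * hnorm H (s m \<ominus> p) < e / 2"
    using eventually_happens sequentially_bot by blast
  have "\<forall>\<^sub>F n in F. cmod (inprod H (z n) (s m)) < e / 2"
    using tendstoD[OF null[of m], of "e / 2"] e by simp
  then show "\<forall>\<^sub>F n in F. dist (inprod H (z n) p) 0 < e"
  proof (rule eventually_mono)
    fix n assume n: "cmod (inprod H (z n) (s m)) < e / 2"
    have "inprod H (z n) p = inprod H (z n) (s m) - inprod H (z n) (s m \<ominus> p)"
      using z s by (simp add: inprod_linear)
    then have "cmod (inprod H (z n) p) \<le> cmod (inprod H (z n) (s m)) + cmod (inprod H (z n) (s m \<ominus> p))"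
      using norm_triangle_ineq4 by metis
    also have "cmod (inprod H (z n) (s m \<ominus> p)) \<le> hnorm H (z n) * hnorm H (s m \<ominus> p)"
      using z s by (intro Cauchy_Schwarz) auto
    also have "\<dots> \<le> R * hnorm H (s m \<ominus> p)"
      using z s by (intro mult_right_mono) auto
    finally show "dist (inprod H (z n) p) 0 < e" using n m by simp
  qed
qed

end

text \<open>A von Neumann algebra without the closedness in the strong operator topology, so that
  the diagonal copy of a von Neumann algebra on a power is an instance.\<close>

locale star_algebra = hilbert_space H
  for H :: "('a, 'm) hilbert_scheme" (structure) and N :: "('a \<Rightarrow> 'a) set" +
  assumes N_bounded: "N \<subseteq> bounded_ops H"
    and N_id: "op_id H \<in> N"
    and N_add: "\<lbrakk>S \<in> N; T \<in> N\<rbrakk> \<Longrightarrow> op_add H S T \<in> N"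
    and N_smult: "T \<in> N \<Longrightarrow> op_smult H c T \<in> N"
    and N_comp: "\<lbrakk>S \<in> N; T \<in> N\<rbrakk> \<Longrightarrow> op_comp H S T \<in> N"
    and N_adjoint: "T \<in> N \<Longrightarrow> op_adjoint H T \<in> N"
begin

lemma N_closed [simp]: "T \<in> N \<Longrightarrow> x \<in> carrier H \<Longrightarrow> T x \<in> carrier H"
  using N_bounded bounded_opsD(1) by blast

definition contractions :: "('a \<Rightarrow> 'a) set" where
  "contractions = {v \<in> N. \<forall>x\<in>carrier H. hnorm H (v x) \<le> hnorm H x}"

text \<open>For a contraction \<open>v\<close>, the operators \<open>v\<close> and \<open>1 - v\<^sup>*v\<close> form a column of norm at
  most 1, since \<open>(1 - v\<^sup>*v)\<^sup>2 \<le> 1 - v\<^sup>*v\<close>.\<close>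

lemma contraction_defect:
  assumes v: "v \<in> contractions" and x: "x \<in> carrier H"
  shows "(hnorm H (x \<ominus> op_adjoint H v (v x)))\<^sup>2 \<le> (hnorm H x)\<^sup>2 - (hnorm H (v x))\<^sup>2"
proof -
  have vN: "v \<in> N" and vb: "v \<in> bounded_ops H"
    and vle: "\<And>x. x \<in> carrier H \<Longrightarrow> hnorm H (v x) \<le> 1 * hnorm H x"
    using v N_bounded by (auto simp: contractions_def)
  have vx: "v x \<in> carrier H" "op_adjoint H v (v x) \<in> carrier H"
    using vN x N_adjoint by auto
  have "inprod H x (op_adjoint H v (v x)) = inprod H (v x) (v x)"
    using inprod_op_adjoint[OF vb x vx(1)] by simp
  moreover have "hnorm H (op_adjoint H v (v x)) \<le> hnorm H (v x)"
    using hnorm_op_adjoint_le[OF vb _ vle vx(1)] by simp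
  then have "(hnorm H (op_adjoint H v (v x)))\<^sup>2 \<le> (hnorm H (v x))\<^sup>2"
    using vx by (intro power_mono) auto
  ultimately show ?thesis
    using x vx by (simp add: hnorm_minus_sq inprod_self)
qed

text \<open>Adding \<open>\<theta> g (1 - v\<^sup>*v)\<close> to a contraction \<open>v\<close> changes the norm only to second
  order in \<open>\<theta>\<close>, by the Cauchy-Schwarz inequality for the column of \<open>v\<close> and \<open>1 - v\<^sup>*v\<close>.\<close>

lemma perturbed_contraction:
  fixes \<theta> :: complex
  assumes v: "v \<in> contractions" and g: "g \<in> N" and C: "C \<ge> 0"
      "\<And>x. x \<in> carrier H \<Longrightarrow> hnorm H (g x) \<le> C * hnorm H x"
  defines "R \<equiv> sqrt (1 + (cmod \<theta> * C)\<^sup>2)"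
  obtains y where "y \<in> contractions"
    "\<And>x. x \<in> carrier H \<Longrightarrow> R \<odot> y x = v x \<oplus> \<theta> \<odot> g (x \<ominus> op_adjoint H v (v x))"
proof -
  have vN: "v \<in> N" using v by (auto simp: contractions_def)
  define c where "c = op_add H (op_id H) (op_smult H (-1) (op_comp H (op_adjoint H v) v))"
  have cN: "c \<in> N" unfolding c_def by (intro N_add N_id N_smult N_comp N_adjoint vN)
  have c: "c x = x \<ominus> op_adjoint H v (v x)" if x: "x \<in> carrier H" for x
    by (rule vector_eqI) (use x vN N_adjoint in
        \<open>auto simp: c_def op_add_def op_id_def op_smult_def compose_def inprod_linear\<close>)
  have R: "R > 0" "R\<^sup>2 = 1 + (cmod \<theta> * C)\<^sup>2"
    by (auto simp: R_def add_pos_nonneg)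
  define y where "y = op_smult H (1 / R) (op_add H v (op_smult H \<theta> (op_comp H g c)))"
  have yN: "y \<in> N" unfolding y_def by (intro N_add N_smult N_comp vN g cN)
  have y: "R \<odot> y x = v x \<oplus> \<theta> \<odot> g (c x)" if x: "x \<in> carrier H" for x
    by (rule vector_eqI) (use x vN cN g R in
        \<open>auto simp: y_def op_add_def op_smult_def compose_def inprod_linear\<close>)
  have "hnorm H (y x) \<le> hnorm H x" if x: "x \<in> carrier H" for x
  proof -
    let ?\<alpha> = "hnorm H (v x)" and ?\<beta> = "hnorm H (c x)"
    have "R * hnorm H (y x) = hnorm H (R \<odot> y x)" using x yN R by simp
    also have "\<dots> \<le> ?\<alpha> + hnorm H (\<theta> \<odot> g (c x))"
      unfolding y[OF x] using x vN g cN by (intro hnorm_triangle) auto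
    also have "\<dots> \<le> ?\<alpha> + cmod \<theta> * (C * ?\<beta>)"
      using x g cN C(2)[of "c x"] by (simp add: mult_left_mono)
    finally have 1: "R * hnorm H (y x) \<le> ?\<alpha> + (cmod \<theta> * C) * ?\<beta>" by (simp add: mult.assoc)
    have "(R * hnorm H (y x))\<^sup>2 \<le> (?\<alpha> + (cmod \<theta> * C) * ?\<beta>)\<^sup>2"
      by (rule power_mono[OF 1]) (use x yN R in auto)
    also have "\<dots> \<le> (1 + (cmod \<theta> * C)\<^sup>2) * (?\<alpha>\<^sup>2 + ?\<beta>\<^sup>2)"
    proof -
      have "0 \<le> (?\<beta> - (cmod \<theta> * C) * ?\<alpha>)\<^sup>2" by simp
      then show ?thesis by (simp add: power2_sum power2_diff power_mult_distrib algebra_simps)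
    qed
    also have "\<dots> \<le> (1 + (cmod \<theta> * C)\<^sup>2) * (hnorm H x)\<^sup>2"
      using contraction_defect[OF v x] c[OF x] by (intro mult_left_mono) auto
    also have "\<dots> = (R * hnorm H x)\<^sup>2" by (simp add: power_mult_distrib R)
    finally have "R * hnorm H (y x) \<le> R * hnorm H x"
      by (rule power2_le_imp_le) (use R x in auto)
    then show ?thesis using R by simp
  qed
  then have "y \<in> contractions" using yN by (auto simp: contractions_def)
  then show thesis using that y c by simp
qed

text \<open>Let \<open>p\<close> be the nearest point to \<open>\<eta>\<close> in the closure of the vectors \<open>v\<xi>\<close> with \<open>v\<close>
  a contraction, \<open>w = \<eta> - p\<close>, and let \<open>q\<close> be the projection onto the closure of \<open>S = Nw\<close>.
  Contractions \<open>v\<^sub>n\<close> with \<open>v\<^sub>n\<xi> \<rightarrow> p\<close> almost maximise the real part of \<open>\<langle>v\<xi>, w\<rangle>\<close>.  As this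
  quantity can gain only to second order from the perturbations of \<open>perturbed_contraction\<close>, the first
  order term vanishes in the limit: \<open>(1 - v\<^sub>n\<^sup>*v\<^sub>n)\<xi>\<close> tends weakly to zero against \<open>Nw\<close>, hence
  against \<open>q\<xi>\<close>.  This says that \<open>\<parallel>qv\<^sub>n\<xi>\<parallel>\<close> tends to \<open>\<parallel>q\<xi>\<parallel>\<close>, so \<open>\<parallel>qp\<parallel> = \<parallel>q\<xi>\<parallel>\<close>.  Since
  \<open>q\<eta> = qp + w\<close> and \<open>\<langle>p, w\<rangle>\<close> has non-negative real part, \<open>\<parallel>w\<parallel>\<^sup>2 \<le> \<parallel>q\<eta>\<parallel>\<^sup>2 - \<parallel>q\<xi>\<parallel>\<^sup>2\<close>.\<close>

lemma approximate_transport: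
  assumes \<xi>: "\<xi> \<in> carrier H" and \<eta>: "\<eta> \<in> carrier H"
  obtains S where "linear_subset S" "\<And>a s. a \<in> N \<Longrightarrow> s \<in> S \<Longrightarrow> a s \<in> S"
    "\<And>e. e > 0 \<Longrightarrow> \<exists>v\<in>contractions. (hnorm H (\<eta> \<ominus> v \<xi>))\<^sup>2
        \<le> (hnorm H (proj S \<eta>))\<^sup>2 - (hnorm H (proj S \<xi>))\<^sup>2 + e"
proof -
  define K where "K = (\<lambda>v. v \<xi>) ` contractions"
  have KI: "v \<xi> \<in> K" if "v \<in> contractions" for v using that by (auto simp: K_def)
  have zero_contr: "op_smult H 0 (op_id H) \<in> contractions"
    using N_smult[OF N_id] by (auto simp: contractions_def op_smult_def op_id_def)
  have K: "K \<subseteq> carrier H" "K \<noteq> {}"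
    using \<xi> zero_contr by (auto simp: K_def contractions_def)
  have conv: "complex_of_real (1 - t) \<odot> x \<oplus> complex_of_real t \<odot> y \<in> K"
    if xy: "x \<in> K" "y \<in> K" and "0 \<le> t" "t \<le> 1" for x y t
  proof -
    obtain u v where uv: "x = u \<xi>" "y = v \<xi>" "u \<in> contractions" "v \<in> contractions"
      using xy by (auto simp: K_def)
    define z where "z = op_add H (op_smult H (complex_of_real (1 - t)) u) (op_smult H (complex_of_real t) v)"
    have N: "u \<in> N" "v \<in> N" using uv by (auto simp: contractions_def)
    then have zN: "z \<in> N" unfolding z_def by (intro N_add N_smult)
    have z: "z h = complex_of_real (1 - t) \<odot> u h \<oplus> complex_of_real t \<odot> v h" if "h \<in> carrier H" for h
      using that by (simp add: z_def op_add_def op_smult_def)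
    have "hnorm H (z h) \<le> hnorm H h" if h: "h \<in> carrier H" for h
    proof -
      have "hnorm H (z h) \<le> hnorm H (complex_of_real (1 - t) \<odot> u h) + hnorm H (complex_of_real t \<odot> v h)"
        unfolding z[OF h] using h N by (intro hnorm_triangle) auto
      also have "\<dots> = (1 - t) * hnorm H (u h) + t * hnorm H (v h)"
        using h N that \<open>0 \<le> t\<close> \<open>t \<le> 1\<close> by (simp del: of_real_diff)
      also have "\<dots> \<le> (1 - t) * hnorm H h + t * hnorm H h"
        using uv h \<open>0 \<le> t\<close> \<open>t \<le> 1\<close> by (intro add_mono mult_left_mono) (auto simp: contractions_def)
      finally show ?thesis by (simp add: algebra_simps)
    qed
    then have "z \<in> contractions" using zN by (auto simp: contractions_def)
    then show ?thesis using z[OF \<xi>] uv by (metis KI)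
  qed
  obtain p s where p: "p \<in> carrier H" and s: "\<And>n. s n \<in> K" "(\<lambda>n::nat. hnorm H (s n \<ominus> p)) \<longlonglongrightarrow> 0"
    and var: "\<And>k. k \<in> K \<Longrightarrow> Re (inprod H (k \<ominus> p) (\<eta> \<ominus> p)) \<le> 0"
    by (rule nearest_point[OF K _ \<eta>], erule (3) conv, rule that)
  have "\<forall>n. \<exists>v. v \<in> contractions \<and> s n = v \<xi>"
    using s(1) by (auto simp: K_def image_iff)
  then obtain v where v: "\<And>n. v n \<in> contractions" "\<And>n. s n = v n \<xi>"
    by metis
  have vN: "v n \<in> N" for n using v by (auto simp: contractions_def)
  have vb: "v n \<in> bounded_ops H" for n using vN N_bounded by auto
  have vc: "v n \<xi> \<in> carrier H" for n using vN \<xi> by auto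
  have vlim: "(\<lambda>n. hnorm H (v n \<xi> \<ominus> p)) \<longlonglongrightarrow> 0" using s v by simp
  define w where "w = \<eta> \<ominus> p"
  have w: "w \<in> carrier H" using \<eta> p by (auto simp: w_def)
  define \<sigma> where "\<sigma> = Re (inprod H p w)"
  have var': "Re (inprod H (y \<xi>) w) \<le> \<sigma>" if "y \<in> contractions" for y
    using var[OF KI[OF that]] p w \<xi> that
    by (auto simp: \<sigma>_def contractions_def inprod_minus_left simp flip: w_def)
  have "\<sigma> \<ge> 0" using var'[OF zero_contr] \<xi> w by (simp add: op_smult_def op_id_def)
  define S where "S = (\<lambda>a. a w) ` N"
  have S: "linear_subset S"
    unfolding linear_subset_def
  proof (intro conjI ballI allI)
    show "S \<subseteq> carrier H" using w by (auto simp: S_def)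
    have "\<zero> = op_smult H 0 (op_id H) w" using w by (simp add: op_smult_def op_id_def)
    then show "\<zero> \<in> S" unfolding S_def using N_smult[OF N_id] by blast
    show "x \<oplus> y \<in> S" if xy: "x \<in> S" "y \<in> S" for x y
    proof -
      obtain a b where ab: "a \<in> N" "b \<in> N" "x = a w" "y = b w" using xy by (auto simp: S_def)
      then have "x \<oplus> y = op_add H a b w" using w by (simp add: op_add_def)
      then show ?thesis unfolding S_def using N_add ab by blast
    qed
    show "c \<odot> x \<in> S" if x: "x \<in> S" for c x
    proof -
      obtain a where a: "a \<in> N" "x = a w" using x by (auto simp: S_def)
      then have "c \<odot> x = op_smult H c a w" using w by (simp add: op_smult_def)
      then show ?thesis unfolding S_def using N_smult a by blast
    qed
  qed
  have NS: "a x \<in> S" if ax: "a \<in> N" "x \<in> S" for a x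
  proof -
    obtain b where b: "b \<in> N" "x = b w" using ax by (auto simp: S_def)
    then have "a x = op_comp H a b w" using w by (simp add: op_comp_apply)
    then show ?thesis unfolding S_def using N_comp b ax by blast
  qed
  have wS: "w \<in> S" using w imageI[OF N_id, of "\<lambda>a. a w"] by (simp add: S_def op_id_def)
  define c where "c n = \<xi> \<ominus> op_adjoint H (v n) (v n \<xi>)" for n
  have cc: "c n \<in> carrier H" for n using \<xi> vN N_adjoint by (auto simp: c_def)
  have c_le: "hnorm H (c n) \<le> hnorm H \<xi>" for n
    by (rule power2_le_imp_le) (use contraction_defect[OF v(1) \<xi>, of n] \<xi> in
        \<open>auto simp: c_def intro: order_trans\<close>)
  \<comment> \<open>the first order variation of the functional at an almost maximal contraction is almost zero\<close>
  have cnull: "(\<lambda>n. inprod H (c n) (a w)) \<longlonglongrightarrow> 0" if a: "a \<in> N" for a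
  proof -
    define g where "g = op_adjoint H a"
    have g: "g \<in> N" using a N_adjoint by (simp add: g_def)
    have ab: "a \<in> bounded_ops H" and gb: "g \<in> bounded_ops H" using a g N_bounded by auto
    have gca: "inprod H (g (c n)) w = inprod H (c n) (a w)" for n
      unfolding g_def by (rule inprod_op_adjoint'[OF ab w cc])
    obtain C where C: "C \<ge> 0" "\<And>x. x \<in> carrier H \<Longrightarrow> hnorm H (g x) \<le> C * hnorm H x"
      using bounded_ops_bound[OF gb] by blast
    define \<delta> where "\<delta> n = \<sigma> - Re (inprod H (v n \<xi>) w)" for n
    have "(\<lambda>n. Re (inprod H (v n \<xi>) w)) \<longlonglongrightarrow> \<sigma>"
      unfolding \<sigma>_def by (intro tendsto_Re tendsto_inprod vc p vlim w) (simp add: w)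
    then have \<delta>: "\<delta> \<longlonglongrightarrow> 0"
      unfolding \<delta>_def by (auto intro: tendsto_eq_intros)
    have main: "t * cmod (inprod H (c n) (a w)) \<le> \<delta> n + t\<^sup>2 * (C\<^sup>2 * \<sigma>)" if t: "t > 0" for t n
    proof -
      let ?z = "inprod H (g (c n)) w"
      \<comment> \<open>the phase that makes the perturbation increase the functional\<close>
      obtain \<theta> where \<theta>: "cmod \<theta> = t" "\<theta> * ?z = complex_of_real (t * cmod ?z)"
      proof (cases "?z = 0")
        case True then show ?thesis using that[of "complex_of_real t"] t by simp
      next
        case False
        have "cnj ?z * ?z = complex_of_real (cmod ?z) * complex_of_real (cmod ?z)"
          using complex_norm_square[of ?z] by (simp add: power2_eq_square mult.commute)
        then show ?thesis using that[of "t * (cnj ?z / cmod ?z)"] t False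
          by (simp add: norm_mult norm_divide field_simps)
      qed
      define R where "R = sqrt (1 + (cmod \<theta> * C)\<^sup>2)"
      obtain y where y: "y \<in> contractions"
        "R \<odot> y \<xi> = v n \<xi> \<oplus> \<theta> \<odot> g (c n)"
        using perturbed_contraction[OF v(1)[of n] g C, of \<theta>] \<xi> unfolding R_def c_def by metis
      have yc: "y \<xi> \<in> carrier H" using y \<xi> by (auto simp: contractions_def)
      have R1: "1 \<le> R" by (simp add: R_def)
      have "R \<le> R\<^sup>2" using R1 by (simp add: power2_eq_square mult_left_mono[of 1 R R, simplified])
      then have R2: "R \<le> 1 + t\<^sup>2 * C\<^sup>2" by (simp add: R_def \<theta> power_mult_distrib)
      have "R * Re (inprod H (y \<xi>) w) = Re (inprod H (R \<odot> y \<xi>) w)"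
        using yc w by (simp add: inprod_smult_left)
      also have "\<dots> = Re (inprod H (v n \<xi>) w) + t * cmod ?z"
        unfolding y(2) using vc w g cc \<theta> by (simp add: inprod_linear)
      finally have "Re (inprod H (v n \<xi>) w) + t * cmod ?z \<le> R * \<sigma>"
        using mult_left_mono[OF var'[OF y(1)], of R] R1 by simp
      also have "R * \<sigma> \<le> (1 + t\<^sup>2 * C\<^sup>2) * \<sigma>" by (rule mult_right_mono[OF R2 \<open>\<sigma> \<ge> 0\<close>])
      finally show ?thesis by (simp add: gca \<delta>_def algebra_simps)
    qed
    show ?thesis
    proof (rule tendstoI)
      fix e :: real assume e: "e > 0"
      \<comment> \<open>small enough for the second order term to contribute at most \<open>e / 2\<close>\<close>
      define t where "t = e / (2 * (C\<^sup>2 * \<sigma> + 1))"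
      have pos: "C\<^sup>2 * \<sigma> + 1 > 0" using \<open>\<sigma> \<ge> 0\<close> by (simp add: add_nonneg_pos)
      have t: "t > 0" using e pos by (simp add: t_def)
      have "t * (C\<^sup>2 * \<sigma>) \<le> t * (C\<^sup>2 * \<sigma> + 1)" using t by (intro mult_left_mono) auto
      also have "\<dots> = e / 2" 
      proof -
        have "e / (2 * D) * D = e / 2" if "D > 0" for D :: real using that by simp
        from this[OF pos] show ?thesis unfolding t_def .
      qed
      finally have te: "t * (C\<^sup>2 * \<sigma>) \<le> e / 2" .
      have "\<forall>\<^sub>F n in sequentially. \<delta> n < t * (e / 2)"
        using \<delta> t e by (intro order_tendstoD(2)) auto
      then show "\<forall>\<^sub>F n in sequentially. dist (inprod H (c n) (a w)) 0 < e"
      proof (rule eventually_mono)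
        fix n assume n: "\<delta> n < t * (e / 2)"
        have "t * cmod (inprod H (c n) (a w)) \<le> \<delta> n + t * (t * (C\<^sup>2 * \<sigma>))"
          using main[OF t, of n] by (simp add: power2_eq_square mult.assoc)
        also have "\<dots> < t * (e / 2) + t * (e / 2)"
          using n te t by (intro add_less_le_mono mult_left_mono) auto
        finally have "t * cmod (inprod H (c n) (a w)) < t * e" by (simp add: field_simps)
        then show "dist (inprod H (c n) (a w)) 0 < e" using t by simp
      qed
    qed
  qed
  let ?q = "proj S"
  have comm: "?q (v n \<xi>) = v n (?q \<xi>)" for n
    using vb vN N_adjoint NS by (intro proj_commute[OF S \<xi>, where b = "op_adjoint H (v n)"])
      (auto simp: inprod_op_adjoint)
  have "(\<lambda>n. inprod H (c n) (?q \<xi>)) \<longlonglongrightarrow> 0"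
  proof -
    obtain r where r: "\<And>m::nat. r m \<in> S" "(\<lambda>m. hnorm H (r m \<ominus> ?q \<xi>)) \<longlonglongrightarrow> 0"
      using proj_approx[OF S \<xi>] by blast
    have "(\<lambda>n. inprod H (c n) (r m)) \<longlonglongrightarrow> 0" for m
      using r(1)[of m] cnull by (auto simp: S_def)
    then show ?thesis
      by (rule weakly_null_closure[OF cc c_le, where s = r])
        (use r S \<xi> linear_subsetD(1)[OF S] in auto)
  qed
  moreover have "inprod H (c n) (?q \<xi>) = inprod H \<xi> (?q \<xi>) - inprod H (v n \<xi>) (?q (v n \<xi>))" for n
    using \<xi> S vb vc N_adjoint vN
    by (simp add: c_def inprod_minus_left inprod_op_adjoint' comm)
  ultimately have "(\<lambda>n. inprod H \<xi> (?q \<xi>) - inprod H (v n \<xi>) (?q (v n \<xi>))) \<longlonglongrightarrow> 0" by simp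
  moreover have "(\<lambda>n. inprod H \<xi> (?q \<xi>) - inprod H (v n \<xi>) (?q (v n \<xi>)))
      \<longlonglongrightarrow> inprod H \<xi> (?q \<xi>) - inprod H p (?q p)"
  proof (intro tendsto_diff tendsto_const tendsto_inprod vc p vlim)
    show "(\<lambda>n. hnorm H (?q (v n \<xi>) \<ominus> ?q p)) \<longlonglongrightarrow> 0"
    proof (rule tendsto_sandwich[OF _ _ tendsto_const vlim])
      show "\<forall>\<^sub>F n in sequentially. 0 \<le> hnorm H (?q (v n \<xi>) \<ominus> ?q p)"
        using S vc p by simp
      show "\<forall>\<^sub>F n in sequentially. hnorm H (?q (v n \<xi>) \<ominus> ?q p) \<le> hnorm H (v n \<xi> \<ominus> p)"
        using S vc p hnorm_proj_le[OF S] by (simp flip: proj_minus)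
    qed
  qed (use S vc p in auto)
  ultimately have eq: "inprod H \<xi> (?q \<xi>) = inprod H p (?q p)"
    using LIMSEQ_unique by fastforce
  have sq: "inprod H x (?q x) = complex_of_real ((hnorm H (?q x))\<^sup>2)" if "x \<in> carrier H" for x
    using that S proj_inprod_proj[OF S that that] proj_selfadjoint[OF S that that]
    by (simp add: inprod_self)
  have qeq: "(hnorm H (?q \<xi>))\<^sup>2 = (hnorm H (?q p))\<^sup>2"
    using eq unfolding sq[OF \<xi>] sq[OF p] of_real_eq_iff .
  have "\<eta> = p \<oplus> w" by (rule vector_eqI) (use \<eta> p in \<open>auto simp: w_def inprod_linear\<close>)
  then have "?q \<eta> = ?q p \<oplus> w" using proj_add[OF S p w] proj_mem[OF S wS] by simp
  then have "(hnorm H (?q \<eta>))\<^sup>2 = (hnorm H (?q p))\<^sup>2 + 2 * \<sigma> + (hnorm H w)\<^sup>2"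
    using S p w proj_selfadjoint[OF S p w] proj_mem[OF S wS] by (simp add: hnorm_add_sq \<sigma>_def)
  then have bound: "(hnorm H w)\<^sup>2 \<le> (hnorm H (?q \<eta>))\<^sup>2 - (hnorm H (?q \<xi>))\<^sup>2"
    using qeq \<open>\<sigma> \<ge> 0\<close> by simp
  have "\<exists>v\<in>contractions. (hnorm H (\<eta> \<ominus> v \<xi>))\<^sup>2
        \<le> (hnorm H (?q \<eta>))\<^sup>2 - (hnorm H (?q \<xi>))\<^sup>2 + e" if e: "e > 0" for e
  proof -
    have "(\<lambda>n. (hnorm H (\<eta> \<ominus> v n \<xi>))\<^sup>2) \<longlonglongrightarrow> (hnorm H w)\<^sup>2"
      unfolding w_def by (intro tendsto_power tendsto_hnorm_minus vc p vlim \<eta>)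
    then have "\<forall>\<^sub>F n in sequentially. (hnorm H (\<eta> \<ominus> v n \<xi>))\<^sup>2 < (hnorm H w)\<^sup>2 + e"
      using e by (intro order_tendstoD(2)) auto
    then obtain n where "(hnorm H (\<eta> \<ominus> v n \<xi>))\<^sup>2 < (hnorm H w)\<^sup>2 + e"
      using eventually_happens sequentially_bot by blast
    then show ?thesis using bound v(1)[of n] by (intro bexI[of _ "v n"]) auto
  qed
  then show thesis using that S NS by blast
qed

end

lemma von_neumann_algebra_star_algebra:
  assumes "von_neumann_algebra H M"
  shows "star_algebra H M"
proof -
  interpret von_neumann_algebra H M by fact
  show ?thesis
    by unfold_locales (use bounded id_closed add_closed scalar_closed comp_closed adjoint_closed in auto)
qed


section \<open>Finite powers of a Hilbert space\<close>

definition hilbert_power :: "nat \<Rightarrow> ('a, 'm) hilbert_scheme \<Rightarrow> (nat \<Rightarrow> 'a) hilbert" where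
  "hilbert_power k H =
    \<lparr>carrier = {..<k} \<rightarrow>\<^sub>E carrier H, mult = undefined, one = undefined,
     zero = (\<lambda>i\<in>{..<k}. \<zero>\<^bsub>H\<^esub>), add = (\<lambda>x y. \<lambda>i\<in>{..<k}. x i \<oplus>\<^bsub>H\<^esub> y i),
     smult = (\<lambda>c x. \<lambda>i\<in>{..<k}. c \<odot>\<^bsub>H\<^esub> x i),
     inprod = (\<lambda>x y. \<Sum>i<k. inprod H (x i) (y i))\<rparr>"

lemma hilbert_power_simps:
  "carrier (hilbert_power k H) = {..<k} \<rightarrow>\<^sub>E carrier H"
  "\<zero>\<^bsub>hilbert_power k H\<^esub> = (\<lambda>i\<in>{..<k}. \<zero>\<^bsub>H\<^esub>)"
  "x \<oplus>\<^bsub>hilbert_power k H\<^esub> y = (\<lambda>i\<in>{..<k}. x i \<oplus>\<^bsub>H\<^esub> y i)"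
  "c \<odot>\<^bsub>hilbert_power k H\<^esub> x = (\<lambda>i\<in>{..<k}. c \<odot>\<^bsub>H\<^esub> x i)"
  "inprod (hilbert_power k H) x y = (\<Sum>i<k. inprod H (x i) (y i))"
  by (simp_all add: hilbert_power_def)

definition diag_op :: "nat \<Rightarrow> ('a, 'm) hilbert_scheme \<Rightarrow> ('a \<Rightarrow> 'a) \<Rightarrow> (nat \<Rightarrow> 'a) \<Rightarrow> nat \<Rightarrow> 'a" where
  "diag_op k H a = (\<lambda>x\<in>carrier (hilbert_power k H). \<lambda>i\<in>{..<k}. a (x i))"

definition single :: "nat \<Rightarrow> ('a, 'm) hilbert_scheme \<Rightarrow> nat \<Rightarrow> 'a \<Rightarrow> nat \<Rightarrow> 'a" where
  "single k H j x = (\<lambda>i\<in>{..<k}. if i = j then x else \<zero>\<^bsub>H\<^esub>)"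

context hilbert_space
begin

lemma pre_hilbert_power: "pre_hilbert_space (hilbert_power k H)"
proof (intro pre_hilbert_space.intro moduleI pre_hilbert_space_axioms.intro)
  let ?K = "hilbert_power k H"
  have mem: "x i \<in> carrier H" if "x \<in> carrier ?K" "i < k" for x i
    using that by (auto simp: hilbert_power_simps)
  have ext: "x = y" if "x \<in> carrier ?K" "y \<in> carrier ?K" "\<And>i. i < k \<Longrightarrow> x i = y i" for x y
    by (rule PiE_ext[of x "{..<k}" "\<lambda>_. carrier H"]) (use that in \<open>auto simp: hilbert_power_simps\<close>)
  have add: "x \<oplus>\<^bsub>?K\<^esub> y \<in> carrier ?K" if "x \<in> carrier ?K" "y \<in> carrier ?K" for x y
    using that mem by (auto simp: hilbert_power_simps(3) hilbert_power_simps(1)[of k])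
  have smult: "c \<odot>\<^bsub>?K\<^esub> x \<in> carrier ?K" if "x \<in> carrier ?K" for c x
    using that mem by (auto simp: hilbert_power_simps(4) hilbert_power_simps(1)[of k])
  have zero: "\<zero>\<^bsub>?K\<^esub> \<in> carrier ?K" by (auto simp: hilbert_power_simps)
  have app: "(x \<oplus>\<^bsub>?K\<^esub> y) i = x i \<oplus> y i" "(c \<odot>\<^bsub>?K\<^esub> x) i = c \<odot> x i" "\<zero>\<^bsub>?K\<^esub> i = \<zero>" if "i < k" for x y i c
    using that by (auto simp: hilbert_power_simps)
  show "cring complex_ring" by (rule cring_complex_ring)
  show "abelian_group ?K"
  proof (rule abelian_groupI)
    fix x assume x: "x \<in> carrier ?K"
    have "(-1) \<odot>\<^bsub>?K\<^esub> x \<oplus>\<^bsub>?K\<^esub> x = \<zero>\<^bsub>?K\<^esub>"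
    proof (rule ext)
      fix i assume i: "i < k"
      have "(-1) \<odot> x i \<oplus> x i = \<zero>"
        by (rule vector_eqI) (use mem[OF x i] in \<open>auto simp: inprod_linear\<close>)
      then show "((-1) \<odot>\<^bsub>?K\<^esub> x \<oplus>\<^bsub>?K\<^esub> x) i = \<zero>\<^bsub>?K\<^esub> i" using i by (simp add: app)
    qed (intro add smult zero x)+
    then show "\<exists>y\<in>carrier ?K. y \<oplus>\<^bsub>?K\<^esub> x = \<zero>\<^bsub>?K\<^esub>" using smult[OF x] by blast
  qed (auto intro!: ext add zero simp: app mem M.a_assoc M.a_comm M.a_lcomm)
  fix a b :: complex and x y z assume x: "x \<in> carrier ?K"
  show "a \<odot>\<^bsub>?K\<^esub> x \<in> carrier ?K" by (rule smult[OF x])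
  show "(a \<oplus>\<^bsub>complex_ring\<^esub> b) \<odot>\<^bsub>?K\<^esub> x = a \<odot>\<^bsub>?K\<^esub> x \<oplus>\<^bsub>?K\<^esub> b \<odot>\<^bsub>?K\<^esub> x"
    using x smult_l_distr[of a b] by (intro ext add smult) (auto simp: app mem)
  show "(a \<otimes>\<^bsub>complex_ring\<^esub> b) \<odot>\<^bsub>?K\<^esub> x = a \<odot>\<^bsub>?K\<^esub> (b \<odot>\<^bsub>?K\<^esub> x)"
    using x smult_assoc1[of a b] by (intro ext add smult) (auto simp: app mem)
  show "\<one>\<^bsub>complex_ring\<^esub> \<odot>\<^bsub>?K\<^esub> x = x"
    using x smult_one by (intro ext add smult) (auto simp: app mem)
  show "inprod ?K x x \<in> \<real>\<^sub>\<ge>\<^sub>0"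
    using mem[OF x] inprod_nonneg
    by (auto simp: hilbert_power_simps(5) complex_nonneg_Reals_iff intro!: sum_nonneg)
  show "x = \<zero>\<^bsub>?K\<^esub>" if "inprod ?K x x = 0"
  proof (rule ext)
    fix i assume i: "i < k"
    have "(\<Sum>i<k. (hnorm H (x i))\<^sup>2) = Re (inprod ?K x x)"
      using mem[OF x] by (simp add: hilbert_power_simps(5) Re_inprod_self)
    then have "(\<Sum>i<k. (hnorm H (x i))\<^sup>2) = 0" using that by simp
    then have "(hnorm H (x i))\<^sup>2 = 0"
      by (subst (asm) sum_nonneg_eq_0_iff) (use i in auto)
    then show "x i = \<zero>\<^bsub>?K\<^esub> i" using mem[OF x i] by (simp add: hnorm_eq_0 app i)
  qed (intro x zero)+
  assume y: "y \<in> carrier ?K"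
  show "a \<odot>\<^bsub>?K\<^esub> (x \<oplus>\<^bsub>?K\<^esub> y) = a \<odot>\<^bsub>?K\<^esub> x \<oplus>\<^bsub>?K\<^esub> a \<odot>\<^bsub>?K\<^esub> y"
    using x y smult_r_distr[of a] by (intro ext add smult) (auto simp: app mem)
  show "inprod ?K (a \<odot>\<^bsub>?K\<^esub> x) y = a * inprod ?K x y"
    using x y by (simp add: hilbert_power_simps(5) app inprod_smult_left mem sum_distrib_left)
  show "inprod ?K x y = cnj (inprod ?K y x)"
    unfolding hilbert_power_simps(5) cnj_sum
    by (intro sum.cong refl inprod_commute) (auto intro: mem[OF x] mem[OF y])
  assume z: "z \<in> carrier ?K"
  show "inprod ?K (x \<oplus>\<^bsub>?K\<^esub> y) z = inprod ?K x z + inprod ?K y z"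
    using x y z by (simp add: hilbert_power_simps(5) app inprod_add_left mem sum.distrib)
qed

lemma hilbert_power_minus:
  assumes "x \<in> carrier (hilbert_power k H)" "y \<in> carrier (hilbert_power k H)"
  shows "x \<ominus>\<^bsub>hilbert_power k H\<^esub> y = (\<lambda>i\<in>{..<k}. x i \<ominus> y i)"
proof -
  interpret K: pre_hilbert_space "hilbert_power k H" by (rule pre_hilbert_power)
  have mem: "x i \<in> carrier H" if "x \<in> carrier (hilbert_power k H)" "i < k" for x i
    using that by (auto simp: hilbert_power_simps)
  show ?thesis
  proof (rule K.vector_eqI)
    show "(\<lambda>i\<in>{..<k}. x i \<ominus> y i) \<in> carrier (hilbert_power k H)"
      using mem[OF assms(1)] mem[OF assms(2)] by (auto simp: hilbert_power_simps(1))
    fix z assume z: "z \<in> carrier (hilbert_power k H)"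
    show "inprod (hilbert_power k H) (x \<ominus>\<^bsub>hilbert_power k H\<^esub> y) z
        = inprod (hilbert_power k H) (\<lambda>i\<in>{..<k}. x i \<ominus> y i) z"
      using mem[OF assms(1)] mem[OF assms(2)] mem[OF z] z assms
      by (simp add: K.inprod_minus_left) (simp add: hilbert_power_simps(5) inprod_minus_left sum_subtractf)
  qed (use assms in auto)
qed

lemma hnorm_hilbert_power:
  assumes "x \<in> carrier (hilbert_power k H)"
  shows "hnorm (hilbert_power k H) x = sqrt (\<Sum>i<k. (hnorm H (x i))\<^sup>2)"
proof -
  have "x i \<in> carrier H" if "i < k" for i
    using assms that by (auto simp: hilbert_power_simps)
  then show ?thesis
    unfolding hnorm_def[of "hilbert_power k H"] by (simp add: hilbert_power_simps(5) Re_inprod_self)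
qed

lemma hnorm_component_le:
  assumes "x \<in> carrier (hilbert_power k H)" "i < k"
  shows "hnorm H (x i) \<le> hnorm (hilbert_power k H) x"
proof -
  have "(hnorm H (x i))\<^sup>2 \<le> (\<Sum>i<k. (hnorm H (x i))\<^sup>2)"
    using assms(2) by (intro member_le_sum) auto
  then show ?thesis
    by (simp add: hnorm_hilbert_power[OF assms(1)] real_le_rsqrt)
qed

lemma hilbert_power: "hilbert_space (hilbert_power k H)"
proof -
  let ?K = "hilbert_power k H"
  interpret K: pre_hilbert_space ?K by (rule pre_hilbert_power)
  show ?thesis
  proof (rule K.hilbert_spaceI)
    fix s :: "nat \<Rightarrow> nat \<Rightarrow> 'a"
    assume s: "\<And>n. s n \<in> carrier ?K"
      and cauchy: "\<And>e. e > 0 \<Longrightarrow> \<exists>N. \<forall>m\<ge>N. \<forall>n\<ge>N. hnorm ?K (s m \<ominus>\<^bsub>?K\<^esub> s n) < e"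
    have si: "s n i \<in> carrier H" if "i < k" for n i
      using s[of n] that by (auto simp: hilbert_power_simps)
    have "\<exists>p\<in>carrier H. (\<lambda>n. hnorm H (s n i \<ominus> p)) \<longlonglongrightarrow> 0" if i: "i < k" for i
    proof (rule Cauchy_limit[of "\<lambda>n. s n i"])
      fix e :: real assume "e > 0"
      then obtain N where N: "\<And>m n. m \<ge> N \<Longrightarrow> n \<ge> N \<Longrightarrow> hnorm ?K (s m \<ominus>\<^bsub>?K\<^esub> s n) < e"
        using cauchy by metis
      have "hnorm H (s m i \<ominus> s n i) < e" if "m \<ge> N" "n \<ge> N" for m n
      proof -
        have "hnorm H ((s m \<ominus>\<^bsub>?K\<^esub> s n) i) \<le> hnorm ?K (s m \<ominus>\<^bsub>?K\<^esub> s n)"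
          using s i by (intro hnorm_component_le) auto
        then show ?thesis using N[OF that] i by (simp add: hilbert_power_minus s)
      qed
      then show "\<exists>N. \<forall>m\<ge>N. \<forall>n\<ge>N. hnorm H (s m i \<ominus> s n i) < e" by blast
    qed (use si i in auto)
    then obtain p where p: "\<And>i. i < k \<Longrightarrow> p i \<in> carrier H"
      "\<And>i. i < k \<Longrightarrow> (\<lambda>n. hnorm H (s n i \<ominus> p i)) \<longlonglongrightarrow> 0"
      by metis
    define q where "q = restrict p {..<k}"
    have q: "q \<in> carrier ?K" using p by (auto simp: q_def hilbert_power_simps)
    have "(\<lambda>n. sqrt (\<Sum>i<k. (hnorm H (s n i \<ominus> p i))\<^sup>2)) \<longlonglongrightarrow> sqrt (\<Sum>i<k. 0\<^sup>2)"
      using p(2) by (intro tendsto_intros) auto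
    moreover have "hnorm ?K (s n \<ominus>\<^bsub>?K\<^esub> q) = sqrt (\<Sum>i<k. (hnorm H (s n i \<ominus> p i))\<^sup>2)" for n
      using K.minus_closed[OF s q, of n]
      by (simp add: hnorm_hilbert_power) (simp add: hilbert_power_minus s q, simp add: q_def)
    ultimately show "\<exists>p\<in>carrier ?K. (\<lambda>n. hnorm ?K (s n \<ominus>\<^bsub>?K\<^esub> p)) \<longlonglongrightarrow> 0"
      using q by (intro bexI[of _ q]) auto
  qed
qed

end

context star_algebra
begin

lemma star_algebra_diag: "star_algebra (hilbert_power k H) (diag_op k H ` N)"
proof -
  let ?K = "hilbert_power k H" and ?d = "diag_op k H"
  interpret K: hilbert_space ?K by (rule hilbert_power)
  have mem: "x i \<in> carrier H" if "x \<in> carrier ?K" "i < k" for x i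
    using that by (auto simp: hilbert_power_simps)
  have d: "?d a x i = a (x i)" if "x \<in> carrier ?K" "i < k" for a x i
    using that by (simp add: diag_op_def)
  have dc: "?d a x \<in> carrier ?K" if "a \<in> N" "x \<in> carrier ?K" for a x
    using that mem by (auto simp: diag_op_def hilbert_power_simps(1)[of k])
  have dPi: "?d a \<in> carrier ?K \<rightarrow>\<^sub>E carrier ?K" if "a \<in> N" for a
    using dc[OF that] by (auto simp: diag_op_def)
  have adj: "inprod ?K (?d a x) y = inprod ?K x (?d (op_adjoint H a) y)"
    if "a \<in> N" "x \<in> carrier ?K" "y \<in> carrier ?K" for a x y
    using that mem N_bounded
    by (auto simp: hilbert_power_simps(5) d intro!: sum.cong inprod_op_adjoint)
  have bdd: "?d a \<in> bounded_ops ?K" if a: "a \<in> N" for a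
  proof -
    obtain C where C: "C \<ge> 0" "\<And>x. x \<in> carrier H \<Longrightarrow> hnorm H (a x) \<le> C * hnorm H x"
      using bounded_ops_bound a N_bounded by blast
    show ?thesis
    proof (rule K.bounded_opsI[of _ "?d (op_adjoint H a)" C])
      fix x assume x: "x \<in> carrier ?K"
      have "(\<Sum>i<k. (hnorm H (?d a x i))\<^sup>2) \<le> (\<Sum>i<k. (C * hnorm H (x i))\<^sup>2)"
        using C mem[OF x] a x by (intro sum_mono power_mono) (auto simp: d)
      also have "\<dots> = C\<^sup>2 * (\<Sum>i<k. (hnorm H (x i))\<^sup>2)"
        by (simp add: power_mult_distrib sum_distrib_left)
      finally have "sqrt (\<Sum>i<k. (hnorm H (?d a x i))\<^sup>2) \<le> sqrt (C\<^sup>2 * (\<Sum>i<k. (hnorm H (x i))\<^sup>2))"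
        by (rule real_sqrt_le_mono)
      then show "hnorm ?K (?d a x) \<le> C * hnorm ?K x"
        using C by (simp add: hnorm_hilbert_power dc a x real_sqrt_mult)
    qed (use dPi[OF a] dc[OF N_adjoint[OF a]] adj[OF a] in auto)
  qed
  have ext: "S = T" if "S \<in> carrier ?K \<rightarrow>\<^sub>E carrier ?K" "T \<in> carrier ?K \<rightarrow>\<^sub>E carrier ?K"
    "\<And>x i. x \<in> carrier ?K \<Longrightarrow> i < k \<Longrightarrow> S x i = T x i" for S T
  proof (rule PiE_ext[OF that(1,2)])
    fix x assume x: "x \<in> carrier ?K"
    show "S x = T x"
      using PiE_mem[OF that(1) x] PiE_mem[OF that(2) x] that(3)[OF x]
      by (intro PiE_ext[of "S x" "{..<k}" "\<lambda>_. carrier H"]) (auto simp: hilbert_power_simps)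
  qed
  have bPi: "T \<in> carrier ?K \<rightarrow>\<^sub>E carrier ?K" if "T \<in> bounded_ops ?K" for T
    using that by (simp add: bounded_ops_def)
  show ?thesis
  proof unfold_locales
    show "?d ` N \<subseteq> bounded_ops ?K" using bdd by auto
    have "op_id ?K = ?d (op_id H)"
    proof (rule ext)
      show "op_id ?K \<in> carrier ?K \<rightarrow>\<^sub>E carrier ?K" by (intro bPi K.op_id_bounded)
      show "?d (op_id H) \<in> carrier ?K \<rightarrow>\<^sub>E carrier ?K" by (intro dPi N_id)
    qed (use mem in \<open>auto simp: op_id_def d\<close>)
    then show "op_id ?K \<in> ?d ` N" using N_id by auto
    fix S T assume S: "S \<in> ?d ` N" and T: "T \<in> ?d ` N"
    obtain a b where ab: "a \<in> N" "S = ?d a" "b \<in> N" "T = ?d b" using S T by auto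
    have "op_add ?K S T = ?d (op_add H a b)"
    proof (rule ext)
      show "op_add ?K S T \<in> carrier ?K \<rightarrow>\<^sub>E carrier ?K"
        using ab bdd by (intro bPi K.op_add_bounded) auto
      show "?d (op_add H a b) \<in> carrier ?K \<rightarrow>\<^sub>E carrier ?K" using ab by (intro dPi N_add)
    qed (use ab mem in \<open>auto simp: op_add_def d hilbert_power_simps(3)\<close>)
    then show "op_add ?K S T \<in> ?d ` N" using N_add ab by auto
    have "op_comp ?K S T = ?d (op_comp H a b)"
    proof (rule ext)
      show "op_comp ?K S T \<in> carrier ?K \<rightarrow>\<^sub>E carrier ?K"
        using ab bdd by (intro bPi K.op_comp_bounded) auto
      show "?d (op_comp H a b) \<in> carrier ?K \<rightarrow>\<^sub>E carrier ?K" using ab by (intro dPi N_comp)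
    qed (use ab mem dc in \<open>auto simp: compose_def d\<close>)
    then show "op_comp ?K S T \<in> ?d ` N" using N_comp ab by auto
  next
    fix T c assume T: "T \<in> ?d ` N"
    obtain b where b: "b \<in> N" "T = ?d b" using T by auto
    have "op_smult ?K c T = ?d (op_smult H c b)"
    proof (rule ext)
      show "op_smult ?K c T \<in> carrier ?K \<rightarrow>\<^sub>E carrier ?K"
        using b bdd by (intro bPi K.op_smult_bounded) auto
      show "?d (op_smult H c b) \<in> carrier ?K \<rightarrow>\<^sub>E carrier ?K" using b by (intro dPi N_smult)
    qed (use b mem in \<open>auto simp: op_smult_def d hilbert_power_simps(4)\<close>)
    then show "op_smult ?K c T \<in> ?d ` N" using N_smult b by auto
    have "op_adjoint ?K T = ?d (op_adjoint H b)"
      using b bdd N_adjoint adj by (intro K.op_adjoint_eqI) auto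
    then show "op_adjoint ?K T \<in> ?d ` N" using N_adjoint b by auto
  qed
qed

text \<open>The vectors \<open>X\<close> and \<open>Y\<close> are the images of \<open>\<xi>\<close> and \<open>\<eta>\<close> under the matrix \<open>Q\<close>.
  Writing the matrix product weakly, against vectors \<open>w\<close>, keeps sums inside the complex
  numbers.\<close>

definition transports ::
  "nat \<Rightarrow> real \<Rightarrow> (nat \<Rightarrow> 'a) \<Rightarrow> (nat \<Rightarrow> 'a) \<Rightarrow> (nat \<Rightarrow> nat \<Rightarrow> 'a \<Rightarrow> 'a) \<Rightarrow>
     (nat \<Rightarrow> 'a) \<Rightarrow> (nat \<Rightarrow> 'a) \<Rightarrow> ('a \<Rightarrow> 'a) \<Rightarrow> bool" where
  "transports k e \<xi> \<eta> Q X Y v \<longleftrightarrow>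
    (\<forall>i<k. \<forall>j<k. Q i j \<in> commutant H N \<and> (\<forall>x\<in>carrier H. hnorm H (Q i j x) \<le> hnorm H x)) \<and>
    (\<forall>i<k. X i \<in> carrier H \<and> Y i \<in> carrier H) \<and>
    (\<forall>i<k. \<forall>w\<in>carrier H. inprod H (X i) w = (\<Sum>j<k. inprod H (Q i j (\<xi> j)) w)) \<and>
    (\<forall>i<k. \<forall>w\<in>carrier H. inprod H (Y i) w = (\<Sum>j<k. inprod H (Q i j (\<eta> j)) w)) \<and>
    v \<in> contractions \<and>
    (\<Sum>i<k. (hnorm H (\<eta> i \<ominus> v (\<xi> i)))\<^sup>2)
      \<le> (\<Sum>i<k. (hnorm H (Y i))\<^sup>2) - (\<Sum>i<k. (hnorm H (X i))\<^sup>2) + e"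

text \<open>The previous argument for the diagonal action on the power, read off in coordinates:
  a projection that commutes with diagonal operators is a matrix over the commutant.\<close>

lemma matrix_transport:
  fixes k :: nat
  assumes \<xi>: "\<And>i. i < k \<Longrightarrow> \<xi> i \<in> carrier H" and \<eta>: "\<And>i. i < k \<Longrightarrow> \<eta> i \<in> carrier H"
    and e: "e > 0"
  shows "\<exists>Q X Y v. transports k e \<xi> \<eta> Q X Y v"
proof -
  let ?K = "hilbert_power k H" and ?d = "diag_op k H" and ?\<delta> = "single k H"
  interpret K: star_algebra ?K "?d ` N" by (rule star_algebra_diag)
  note K.N_closed [simp del]
  have mem: "x i \<in> carrier H" if "x \<in> carrier ?K" "i < k" for x i
    using that by (auto simp: hilbert_power_simps)
  have d: "?d a x i = a (x i)" if "x \<in> carrier ?K" "i < k" for a x i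
    using that by (simp add: diag_op_def)
  define x where "x = restrict \<xi> {..<k}"
  define y where "y = restrict \<eta> {..<k}"
  have x: "x \<in> carrier ?K" and y: "y \<in> carrier ?K"
    using \<xi> \<eta> by (auto simp: x_def y_def hilbert_power_simps)
  obtain S where S: "K.linear_subset S" and NS: "\<And>a s. a \<in> ?d ` N \<Longrightarrow> s \<in> S \<Longrightarrow> a s \<in> S"
    and v: "\<And>e. e > 0 \<Longrightarrow> \<exists>v\<in>K.contractions. (hnorm ?K (y \<ominus>\<^bsub>?K\<^esub> v x))\<^sup>2
        \<le> (hnorm ?K (K.proj S y))\<^sup>2 - (hnorm ?K (K.proj S x))\<^sup>2 + e"
    by (rule K.approximate_transport[OF x y], rule that)
  let ?q = "K.proj S"
  have qc: "?q z \<in> carrier ?K" if "z \<in> carrier ?K" for z using S that by simp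
  have \<delta>: "?\<delta> j z \<in> carrier ?K" if "z \<in> carrier H" for j z
    using that by (auto simp: single_def hilbert_power_simps)
  have in_\<delta>: "inprod ?K u (?\<delta> i w) = inprod H (u i) w"
    if "u \<in> carrier ?K" "w \<in> carrier H" "i < k" for u w i
  proof -
    have "inprod ?K u (?\<delta> i w) = (\<Sum>l<k. if l = i then inprod H (u i) w else 0)"
      unfolding hilbert_power_simps(5) using that mem by (intro sum.cong) (auto simp: single_def)
    then show ?thesis using that by simp
  qed
  have norm_\<delta>: "hnorm ?K (?\<delta> i w) = hnorm H w" if "w \<in> carrier H" "i < k" for w i
    using in_\<delta>[OF \<delta>[OF that(1)] that, of i] that unfolding hnorm_def by (simp add: single_def)
  define Q where "Q i j = (\<lambda>z\<in>carrier H. ?q (?\<delta> j z) i)" for i j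
  have Q: "Q i j z = ?q (?\<delta> j z) i" if "z \<in> carrier H" for i j z
    using that by (simp add: Q_def)
  have Qc: "Q i j z \<in> carrier H" if "i < k" "z \<in> carrier H" for i j z
    using that qc \<delta> mem by (simp add: Q)
  have Qadj: "inprod H (Q i j z) w = inprod H z (Q j i w)"
    if "i < k" "j < k" "z \<in> carrier H" "w \<in> carrier H" for i j z w
  proof -
    have "inprod H (Q i j z) w = inprod ?K (?q (?\<delta> j z)) (?\<delta> i w)"
      using that qc \<delta> by (simp add: in_\<delta> Q)
    also have "\<dots> = inprod ?K (?\<delta> j z) (?q (?\<delta> i w))"
      using that \<delta> S by (simp add: K.proj_selfadjoint)
    also have "\<dots> = cnj (inprod ?K (?q (?\<delta> i w)) (?\<delta> j z))"
      using that \<delta> qc K.inprod_commute by blast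
    also have "\<dots> = cnj (inprod H (Q j i w) z)"
      using that qc \<delta> by (simp add: in_\<delta> Q)
    also have "\<dots> = inprod H z (Q j i w)"
      using that Qc inprod_commute[of z "Q j i w"] by simp
    finally show ?thesis .
  qed
  have Qle: "hnorm H (Q i j z) \<le> hnorm H z" if "i < k" "j < k" "z \<in> carrier H" for i j z
  proof -
    have "hnorm H (Q i j z) \<le> hnorm ?K (?q (?\<delta> j z))"
      unfolding Q[OF that(3)] using that qc \<delta> by (intro hnorm_component_le) auto
    also have "\<dots> \<le> hnorm ?K (?\<delta> j z)" by (rule K.hnorm_proj_le[OF S \<delta>[OF that(3)]])
    finally show ?thesis using norm_\<delta> that by simp
  qed
  have Qb: "Q i j \<in> bounded_ops H" if "i < k" "j < k" for i j
    by (rule bounded_opsI[of _ "Q j i" 1])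
      (use that Qc Qadj Qle in \<open>auto simp: Q_def extensional_funcset_def\<close>)
  have Qcomm: "Q i j \<in> commutant H N" if ij: "i < k" "j < k" for i j
    unfolding commutant_def
  proof (intro CollectI conjI ballI)
    fix a assume a: "a \<in> N"
    have ab: "a \<in> bounded_ops H" using a N_bounded by auto
    have a0: "a \<zero> = \<zero>" using bounded_opsD(4)[OF ab, of \<zero> 0] a by simp
    have "Q i j (a z) = a (Q i j z)" if z: "z \<in> carrier H" for z
    proof -
      have "?\<delta> j (a z) = ?d a (?\<delta> j z)"
        unfolding diag_op_def using \<delta>[OF z] a0 by (auto simp: single_def)
      moreover have "?q (?d a (?\<delta> j z)) = ?d a (?q (?\<delta> j z))"
      proof (rule K.proj_commute[OF S \<delta>[OF z], where b = "op_adjoint ?K (?d a)"])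
        have da: "?d a \<in> ?d ` N" "op_adjoint ?K (?d a) \<in> ?d ` N" using a K.N_adjoint by auto
        show "\<And>u. u \<in> S \<Longrightarrow> ?d a u \<in> S" "\<And>u. u \<in> S \<Longrightarrow> op_adjoint ?K (?d a) u \<in> S"
          using NS da by auto
        show "\<And>u. u \<in> carrier ?K \<Longrightarrow> ?d a u \<in> carrier ?K"
          "\<And>u. u \<in> carrier ?K \<Longrightarrow> op_adjoint ?K (?d a) u \<in> carrier ?K"
          using K.N_closed da by auto
        show "\<And>u w. u \<in> carrier ?K \<Longrightarrow> w \<in> carrier ?K \<Longrightarrow>
            inprod ?K (?d a u) w = inprod ?K u (op_adjoint ?K (?d a) w)"
          using K.inprod_op_adjoint da K.N_bounded by blast
      qed
      ultimately show ?thesis using z a ij qc \<delta> by (simp add: Q d)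
    qed
    then show "op_comp H (Q i j) a = op_comp H a (Q i j)"
      by (auto simp: compose_def fun_eq_iff)
  qed (rule Qb[OF ij])
  have comp: "inprod H (?q u i) w = (\<Sum>j<k. inprod H (Q i j (u j)) w)"
    if "u \<in> carrier ?K" "i < k" "w \<in> carrier H" for u i w
  proof -
    have "inprod H (?q u i) w = inprod ?K (?q u) (?\<delta> i w)" using that qc by (simp add: in_\<delta>)
    also have "\<dots> = inprod ?K u (?q (?\<delta> i w))" using that \<delta> S by (simp add: K.proj_selfadjoint)
    also have "\<dots> = (\<Sum>j<k. inprod H (Q i j (u j)) w)"
      unfolding hilbert_power_simps(5) using that mem
      by (intro sum.cong) (auto simp: Qadj simp flip: Q)
    finally show ?thesis .
  qed
  have "\<exists>v\<in>contractions. (\<Sum>i<k. (hnorm H (\<eta> i \<ominus> v (\<xi> i)))\<^sup>2)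
      \<le> (\<Sum>i<k. (hnorm H (?q y i))\<^sup>2) - (\<Sum>i<k. (hnorm H (?q x i))\<^sup>2) + e"
  proof -
    obtain V where V: "V \<in> K.contractions" "(hnorm ?K (y \<ominus>\<^bsub>?K\<^esub> V x))\<^sup>2
        \<le> (hnorm ?K (?q y))\<^sup>2 - (hnorm ?K (?q x))\<^sup>2 + e" using v[OF e] by blast
    then obtain v where v: "v \<in> N" "V = ?d v" by (auto simp: K.contractions_def)
    have vc: "hnorm H (v z) \<le> hnorm H z" if z: "z \<in> carrier H" and k: "0 < k" for z
    proof -
      have "?d v (?\<delta> 0 z) 0 = v z" using d[OF \<delta>[OF z] k] k by (simp add: single_def)
      then have "hnorm H (v z) \<le> hnorm ?K (?d v (?\<delta> 0 z))"
        using hnorm_component_le[OF K.N_closed[OF _ \<delta>[OF z]] k, of "?d v" 0] v by simp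
      also have "\<dots> \<le> hnorm ?K (?\<delta> 0 z)" using V v \<delta>[OF z] by (simp add: K.contractions_def)
      finally show ?thesis using norm_\<delta>[OF z k] by simp
    qed
    have sq: "(hnorm ?K u)\<^sup>2 = (\<Sum>i<k. (hnorm H (u i))\<^sup>2)" if "u \<in> carrier ?K" for u
      using that by (simp add: hnorm_hilbert_power sum_nonneg)
    have dx: "?d v x \<in> carrier ?K" using K.N_closed v x by auto
    have "(y \<ominus>\<^bsub>?K\<^esub> ?d v x) i = \<eta> i \<ominus> v (\<xi> i)" if "i < k" for i
      using that x y dx by (simp add: hilbert_power_minus d) (simp add: x_def y_def)
    then have "(hnorm ?K (y \<ominus>\<^bsub>?K\<^esub> V x))\<^sup>2 = (\<Sum>i<k. (hnorm H (\<eta> i \<ominus> v (\<xi> i)))\<^sup>2)"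
      using x y dx v by (simp add: sq)
    then have bound: "(\<Sum>i<k. (hnorm H (\<eta> i \<ominus> v (\<xi> i)))\<^sup>2)
        \<le> (\<Sum>i<k. (hnorm H (?q y i))\<^sup>2) - (\<Sum>i<k. (hnorm H (?q x i))\<^sup>2) + e"
      using V(2) x y qc by (simp add: sq)
    show ?thesis
    proof (cases "k = 0")
      case True
      then show ?thesis
        using e N_id by (intro bexI[of _ "op_id H"]) (auto simp: contractions_def op_id_def)
    next
      case False
      then show ?thesis using bound vc v(1) by (intro bexI[of _ v]) (auto simp: contractions_def)
    qed
  qed
  then obtain v where "v \<in> contractions" "(\<Sum>i<k. (hnorm H (\<eta> i \<ominus> v (\<xi> i)))\<^sup>2)
      \<le> (\<Sum>i<k. (hnorm H (?q y i))\<^sup>2) - (\<Sum>i<k. (hnorm H (?q x i))\<^sup>2) + e" by blast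
  then have "transports k e \<xi> \<eta> Q (?q x) (?q y) v"
    unfolding transports_def using Qcomm Qle mem[OF qc[OF x]] mem[OF qc[OF y]] comp[OF x] comp[OF y]
    by (simp add: x_def y_def)
  then show ?thesis by blast
qed

end


section \<open>The ultraproduct of Hilbert spaces\<close>

locale hilbert_ultra =
  fixes \<omega> :: "nat filter" and H :: "nat \<Rightarrow> ('a, 'm) hilbert_scheme"
  assumes free: "free_ultrafilter \<omega>" and hilbert: "\<And>n. hilbert_space (H n)"

sublocale hilbert_ultra \<subseteq> Hn: hilbert_space "H n" for n
  by (rule hilbert)

context hilbert_ultra
begin

abbreviation U :: "(nat \<Rightarrow> 'a) set hilbert" where "U \<equiv> hilbert_ultraproduct \<omega> H"
abbreviation cls :: "(nat \<Rightarrow> 'a) \<Rightarrow> (nat \<Rightarrow> 'a) set" where "cls \<equiv> ultra_class \<omega> H"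
abbreviation BS :: "(nat \<Rightarrow> 'a) set" where "BS \<equiv> bounded_seqs H"

lemma nontrivial [simp]: "\<omega> \<noteq> bot"
  using free by (simp add: free_ultrafilter_def)

lemma ultra: "eventually Q \<omega> \<or> eventually (\<lambda>n. \<not> Q n) \<omega>"
proof -
  have "eventually (\<lambda>n. n \<in> Collect Q) \<omega> \<or> eventually (\<lambda>n. n \<notin> Collect Q) \<omega>"
    using free unfolding free_ultrafilter_def by blast
  then show ?thesis by simp
qed

lemma eventually_ge: "eventually (\<lambda>n. m \<le> n) \<omega>"
proof (induction m)
  case (Suc m)
  have "eventually (\<lambda>n. n \<noteq> m) \<omega>" using free by (simp add: free_ultrafilter_def)
  with Suc show ?case by eventually_elim auto
qed simp

text \<open>A sequence in a compact set has a cluster point along the filter, and an ultrafilter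
  converges to each of its cluster points.\<close>

lemma ultra_compact_limit:
  assumes K: "compact K" and f: "\<And>n. f n \<in> K"
  obtains l where "l \<in> K" "(f \<longlongrightarrow> l) \<omega>"
proof -
  obtain l where l: "l \<in> K" "inf (nhds l) (filtermap f \<omega>) \<noteq> bot"
    using K f unfolding compact_filter
    by (metis (mono_tags, lifting) eventually_filtermap eventually_True eventually_mono
        filtermap_bot_iff nontrivial)
  have "(f \<longlongrightarrow> l) \<omega>"
  proof (rule topological_tendstoI)
    fix S assume S: "open S" "l \<in> S"
    show "eventually (\<lambda>n. f n \<in> S) \<omega>"
    proof (rule ccontr)
      assume "\<not> ?thesis"
      then have "eventually (\<lambda>n. f n \<notin> S) \<omega>" using ultra by blast
      then have "eventually (\<lambda>y. y \<notin> S) (filtermap f \<omega>)" by (simp add: eventually_filtermap)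
      moreover have "eventually (\<lambda>y. y \<in> S) (nhds l)" using S by (rule eventually_nhds_in_open)
      ultimately have "eventually (\<lambda>_. False) (inf (nhds l) (filtermap f \<omega>))"
        unfolding eventually_inf by blast
      then show False using l by (simp add: eventually_False)
    qed
  qed
  then show thesis using that l by blast
qed

lemma BS_carrier [simp]: "\<xi> \<in> BS \<Longrightarrow> \<xi> n \<in> carrier (H n)"
  by (simp add: bounded_seqs_def)

lemma BS_bound:
  assumes "\<xi> \<in> BS"
  obtains C where "C \<ge> 0" "\<And>n. hnorm (H n) (\<xi> n) \<le> C"
proof -
  have "bdd_above (range (\<lambda>n. hnorm (H n) (\<xi> n)))" using assms by (simp add: bounded_seqs_def del: BS_carrier)
  then obtain C where C: "\<And>n. hnorm (H n) (\<xi> n) \<le> C"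
    unfolding bdd_above_def by blast
  moreover have "C \<ge> 0" using order_trans[OF Hn.hnorm_nonneg C[of 0]] assms by simp
  ultimately show thesis using that by blast
qed

lemma BSI:
  assumes "\<And>n. \<xi> n \<in> carrier (H n)" "\<And>n. hnorm (H n) (\<xi> n) \<le> C"
  shows "\<xi> \<in> BS"
  using assms by (auto simp: bounded_seqs_def simp del: BS_carrier intro: bdd_aboveI2[where M = C])

lemma BS_add [simp]:
  assumes "\<xi> \<in> BS" "\<eta> \<in> BS"
  shows "(\<lambda>n. \<xi> n \<oplus>\<^bsub>H n\<^esub> \<eta> n) \<in> BS"
proof -
  obtain C D where "\<And>n. hnorm (H n) (\<xi> n) \<le> C" "\<And>n. hnorm (H n) (\<eta> n) \<le> D"
    using BS_bound assms by metis
  then show ?thesis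
    using assms by (intro BSI[of _ "C + D"] order_trans[OF Hn.hnorm_triangle] add_mono) auto
qed

lemma BS_smult [simp]:
  assumes "\<xi> \<in> BS"
  shows "(\<lambda>n. c \<odot>\<^bsub>H n\<^esub> \<xi> n) \<in> BS"
proof -
  obtain C where "\<And>n. hnorm (H n) (\<xi> n) \<le> C" using BS_bound assms by metis
  then show ?thesis
    using assms by (intro BSI[of _ "cmod c * C"]) (auto intro: mult_left_mono)
qed

lemma BS_zero [simp]: "(\<lambda>n. \<zero>\<^bsub>H n\<^esub>) \<in> BS"
  by (intro BSI[of _ 0]) auto

lemma BS_minus [simp]:
  assumes "\<xi> \<in> BS" "\<eta> \<in> BS"
  shows "(\<lambda>n. \<xi> n \<ominus>\<^bsub>H n\<^esub> \<eta> n) \<in> BS"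
  using assms by (simp add: Hn.minus_as_add)

lemma inprod_convergent:
  assumes "\<xi> \<in> BS" "\<eta> \<in> BS"
  obtains l where "((\<lambda>n. inprod (H n) (\<xi> n) (\<eta> n)) \<longlongrightarrow> l) \<omega>"
proof -
  obtain C D where C: "C \<ge> 0" "\<And>n. hnorm (H n) (\<xi> n) \<le> C" and D: "\<And>n. hnorm (H n) (\<eta> n) \<le> D"
    using BS_bound assms by metis
  have "inprod (H n) (\<xi> n) (\<eta> n) \<in> cball 0 (C * D)" for n
  proof -
    have "cmod (inprod (H n) (\<xi> n) (\<eta> n)) \<le> hnorm (H n) (\<xi> n) * hnorm (H n) (\<eta> n)"
      using assms by (intro Hn.Cauchy_Schwarz) auto
    also have "\<dots> \<le> C * D" using C D assms by (intro mult_mono) auto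
    finally show ?thesis by simp
  qed
  then show thesis by (rule ultra_compact_limit[OF compact_cball]) (rule that)
qed

abbreviation null_diff :: "(nat \<Rightarrow> 'a) \<Rightarrow> (nat \<Rightarrow> 'a) \<Rightarrow> bool" where
  "null_diff \<xi> \<eta> \<equiv> ((\<lambda>n. hnorm (H n) (\<xi> n \<ominus>\<^bsub>H n\<^esub> \<eta> n)) \<longlongrightarrow> 0) \<omega>"

lemma null_diff_dominated:
  assumes "((\<lambda>n. b n) \<longlongrightarrow> 0) \<omega>" "\<And>n. hnorm (H n) (\<xi> n \<ominus>\<^bsub>H n\<^esub> \<eta> n) \<le> b n"
    "\<And>n. \<xi> n \<in> carrier (H n)" "\<And>n. \<eta> n \<in> carrier (H n)"
  shows "null_diff \<xi> \<eta>"
  by (rule tendsto_sandwich[OF _ _ tendsto_const assms(1)]) (use assms in auto)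

lemma equiv_ultra_rel: "equiv BS (ultra_rel \<omega> H)"
proof (rule equivI)
  show "ultra_rel \<omega> H \<subseteq> BS \<times> BS" by (auto simp: ultra_rel_def)
  show "refl_on BS (ultra_rel \<omega> H)"
    by (auto simp: refl_on_def ultra_rel_def)
  show "sym (ultra_rel \<omega> H)"
    by (auto simp: sym_def ultra_rel_def Hn.hnorm_minus_commute)
  show "trans (ultra_rel \<omega> H)"
  proof (rule transI)
    fix x y z assume xy: "(x, y) \<in> ultra_rel \<omega> H" and yz: "(y, z) \<in> ultra_rel \<omega> H"
    then have BS: "x \<in> BS" "y \<in> BS" "z \<in> BS" and "null_diff x y" "null_diff y z"
      by (auto simp: ultra_rel_def)
    then have "((\<lambda>n. hnorm (H n) (x n \<ominus>\<^bsub>H n\<^esub> y n) + hnorm (H n) (y n \<ominus>\<^bsub>H n\<^esub> z n)) \<longlongrightarrow> 0 + 0) \<omega>"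
      by (intro tendsto_add)
    then have "null_diff x z"
      using BS by (intro null_diff_dominated) (auto intro: Hn.hnorm_triangle_minus)
    then show "(x, z) \<in> ultra_rel \<omega> H" using BS by (simp add: ultra_rel_def)
  qed
qed

lemma cls_eq_iff:
  assumes "\<xi> \<in> BS" "\<eta> \<in> BS"
  shows "cls \<xi> = cls \<eta> \<longleftrightarrow> null_diff \<xi> \<eta>"
  unfolding ultra_class_def using eq_equiv_class_iff[OF equiv_ultra_rel assms] assms
  by (simp add: ultra_rel_def)

lemma mem_cls_iff:
  assumes "\<xi> \<in> BS"
  shows "\<zeta> \<in> cls \<xi> \<longleftrightarrow> \<zeta> \<in> BS \<and> cls \<zeta> = cls \<xi>"
  unfolding ultra_class_def using equiv_class_eq_iff[OF equiv_ultra_rel, of \<xi> \<zeta>] assms by auto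

lemma cls_carrier [simp]: "\<xi> \<in> BS \<Longrightarrow> cls \<xi> \<in> carrier U"
  by (simp add: hilbert_ultraproduct_def ultra_class_def quotientI)

lemma carrier_cases:
  assumes "X \<in> carrier U"
  obtains \<xi> where "\<xi> \<in> BS" "X = cls \<xi>"
  using assms by (auto simp: hilbert_ultraproduct_def ultra_class_def elim: quotientE)

text \<open>Evaluates the unions by which operations on classes are lifted.\<close>

lemma UN_cls:
  assumes "\<xi> \<in> BS" "\<And>\<zeta>. \<zeta> \<in> BS \<Longrightarrow> cls \<zeta> = cls \<xi> \<Longrightarrow> g \<zeta> = g \<xi>"
  shows "(\<Union>\<zeta>\<in>cls \<xi>. g \<zeta>) = g \<xi>"
proof -
  have "\<xi> \<in> cls \<xi>" "\<And>\<zeta>. \<zeta> \<in> cls \<xi> \<Longrightarrow> g \<zeta> = g \<xi>"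
    using assms mem_cls_iff[OF assms(1)] by blast+
  then show ?thesis by blast
qed

lemma UN_cls2:
  assumes "\<xi> \<in> BS" "\<eta> \<in> BS"
    and "\<And>\<xi>' \<eta>'. \<lbrakk>\<xi>' \<in> BS; cls \<xi>' = cls \<xi>; \<eta>' \<in> BS; cls \<eta>' = cls \<eta>\<rbrakk> \<Longrightarrow> g \<xi>' \<eta>' = g \<xi> \<eta>"
  shows "(\<Union>\<xi>'\<in>cls \<xi>. \<Union>\<eta>'\<in>cls \<eta>. g \<xi>' \<eta>') = g \<xi> \<eta>"
proof -
  have "\<xi> \<in> cls \<xi>" "\<eta> \<in> cls \<eta>"
    and "\<And>\<xi>' \<eta>'. \<xi>' \<in> cls \<xi> \<Longrightarrow> \<eta>' \<in> cls \<eta> \<Longrightarrow> g \<xi>' \<eta>' = g \<xi> \<eta>"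
    using assms mem_cls_iff[OF assms(1)] mem_cls_iff[OF assms(2)] by blast+
  then show ?thesis by blast
qed

lemma cls_add:
  assumes \<xi>: "\<xi> \<in> BS" and \<eta>: "\<eta> \<in> BS"
  shows "cls \<xi> \<oplus>\<^bsub>U\<^esub> cls \<eta> = cls (\<lambda>n. \<xi> n \<oplus>\<^bsub>H n\<^esub> \<eta> n)"
proof -
  have eq: "cls (\<lambda>n. \<xi>' n \<oplus>\<^bsub>H n\<^esub> \<eta>' n) = cls (\<lambda>n. \<xi> n \<oplus>\<^bsub>H n\<^esub> \<eta> n)"
    if "\<xi>' \<in> BS" "cls \<xi>' = cls \<xi>" "\<eta>' \<in> BS" "cls \<eta>' = cls \<eta>" "\<xi> \<in> BS" "\<eta> \<in> BS" for \<xi> \<xi>' \<eta> \<eta>'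
  proof -
    have "((\<lambda>n. hnorm (H n) (\<xi>' n \<ominus>\<^bsub>H n\<^esub> \<xi> n) + hnorm (H n) (\<eta>' n \<ominus>\<^bsub>H n\<^esub> \<eta> n)) \<longlongrightarrow> 0 + 0) \<omega>"
      using that by (intro tendsto_add) (simp_all add: cls_eq_iff)
    moreover have "hnorm (H n) ((\<xi>' n \<oplus>\<^bsub>H n\<^esub> \<eta>' n) \<ominus>\<^bsub>H n\<^esub> (\<xi> n \<oplus>\<^bsub>H n\<^esub> \<eta> n))
        \<le> hnorm (H n) (\<xi>' n \<ominus>\<^bsub>H n\<^esub> \<xi> n) + hnorm (H n) (\<eta>' n \<ominus>\<^bsub>H n\<^esub> \<eta> n)" for n
    proof -
      have "(\<xi>' n \<oplus>\<^bsub>H n\<^esub> \<eta>' n) \<ominus>\<^bsub>H n\<^esub> (\<xi> n \<oplus>\<^bsub>H n\<^esub> \<eta> n)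
          = (\<xi>' n \<ominus>\<^bsub>H n\<^esub> \<xi> n) \<oplus>\<^bsub>H n\<^esub> (\<eta>' n \<ominus>\<^bsub>H n\<^esub> \<eta> n)"
        by (rule Hn.vector_eqI) (use that in \<open>auto simp: Hn.inprod_linear\<close>)
      then show ?thesis using that by (simp add: Hn.hnorm_triangle)
    qed
    ultimately have "null_diff (\<lambda>n. \<xi>' n \<oplus>\<^bsub>H n\<^esub> \<eta>' n) (\<lambda>n. \<xi> n \<oplus>\<^bsub>H n\<^esub> \<eta> n)"
      using that by (intro null_diff_dominated) auto
    then show ?thesis using that by (simp add: cls_eq_iff)
  qed
  have "cls \<xi> \<oplus>\<^bsub>U\<^esub> cls \<eta> = (\<Union>\<xi>'\<in>cls \<xi>. \<Union>\<eta>'\<in>cls \<eta>. cls (\<lambda>n. \<xi>' n \<oplus>\<^bsub>H n\<^esub> \<eta>' n))"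
    by (simp add: hilbert_ultraproduct_def)
  also have "\<dots> = cls (\<lambda>n. \<xi> n \<oplus>\<^bsub>H n\<^esub> \<eta> n)"
    by (rule UN_cls2[OF \<xi> \<eta>]) (rule eq[OF _ _ _ _ \<xi> \<eta>])
  finally show ?thesis .
qed

lemma cls_smult:
  assumes \<xi>: "\<xi> \<in> BS"
  shows "c \<odot>\<^bsub>U\<^esub> cls \<xi> = cls (\<lambda>n. c \<odot>\<^bsub>H n\<^esub> \<xi> n)"
proof -
  have "c \<odot>\<^bsub>U\<^esub> cls \<xi> = (\<Union>\<xi>'\<in>cls \<xi>. cls (\<lambda>n. c \<odot>\<^bsub>H n\<^esub> \<xi>' n))"
    by (simp add: hilbert_ultraproduct_def)
  also have "\<dots> = cls (\<lambda>n. c \<odot>\<^bsub>H n\<^esub> \<xi> n)"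
  proof (rule UN_cls[OF \<xi>])
    fix \<zeta> assume \<zeta>: "\<zeta> \<in> BS" "cls \<zeta> = cls \<xi>"
    then have "((\<lambda>n. cmod c * hnorm (H n) (\<zeta> n \<ominus>\<^bsub>H n\<^esub> \<xi> n)) \<longlongrightarrow> cmod c * 0) \<omega>"
      using \<xi> by (intro tendsto_mult tendsto_const) (simp add: cls_eq_iff)
    moreover have "hnorm (H n) (c \<odot>\<^bsub>H n\<^esub> \<zeta> n \<ominus>\<^bsub>H n\<^esub> c \<odot>\<^bsub>H n\<^esub> \<xi> n) = cmod c * hnorm (H n) (\<zeta> n \<ominus>\<^bsub>H n\<^esub> \<xi> n)" for n
    proof -
      have "c \<odot>\<^bsub>H n\<^esub> \<zeta> n \<ominus>\<^bsub>H n\<^esub> c \<odot>\<^bsub>H n\<^esub> \<xi> n = c \<odot>\<^bsub>H n\<^esub> (\<zeta> n \<ominus>\<^bsub>H n\<^esub> \<xi> n)"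
        by (rule Hn.vector_eqI) (use \<xi> \<zeta> in \<open>auto simp: Hn.inprod_linear algebra_simps\<close>)
      then show ?thesis using \<xi> \<zeta> by simp
    qed
    ultimately show "cls (\<lambda>n. c \<odot>\<^bsub>H n\<^esub> \<zeta> n) = cls (\<lambda>n. c \<odot>\<^bsub>H n\<^esub> \<xi> n)"
      using \<xi> \<zeta> by (simp add: cls_eq_iff)
  qed
  finally show ?thesis .
qed

lemma cls_zero: "\<zero>\<^bsub>U\<^esub> = cls (\<lambda>n. \<zero>\<^bsub>H n\<^esub>)"
  by (simp add: hilbert_ultraproduct_def)

lemma inprod_diff_null:
  assumes BS: "\<xi> \<in> BS" "\<xi>' \<in> BS" "\<eta> \<in> BS" "\<eta>' \<in> BS"
    and eq: "cls \<xi>' = cls \<xi>" "cls \<eta>' = cls \<eta>"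
  shows "((\<lambda>n. inprod (H n) (\<xi>' n) (\<eta>' n) - inprod (H n) (\<xi> n) (\<eta> n)) \<longlongrightarrow> 0) \<omega>"
proof -
  obtain C D where C: "\<And>n. hnorm (H n) (\<xi> n) \<le> C" and D: "\<And>n. hnorm (H n) (\<eta>' n) \<le> D"
    using BS_bound BS by metis
  let ?b = "\<lambda>n. hnorm (H n) (\<xi>' n \<ominus>\<^bsub>H n\<^esub> \<xi> n) * D + C * hnorm (H n) (\<eta>' n \<ominus>\<^bsub>H n\<^esub> \<eta> n)"
  have "(?b \<longlongrightarrow> 0 * D + C * 0) \<omega>"
    using BS eq by (intro tendsto_intros) (simp_all add: cls_eq_iff)
  then have lim: "(?b \<longlongrightarrow> 0) \<omega>" by simp
  have "cmod (inprod (H n) (\<xi>' n) (\<eta>' n) - inprod (H n) (\<xi> n) (\<eta> n)) \<le> ?b n" for n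
  proof -
    have "inprod (H n) (\<xi>' n) (\<eta>' n) - inprod (H n) (\<xi> n) (\<eta> n)
        = inprod (H n) (\<xi>' n \<ominus>\<^bsub>H n\<^esub> \<xi> n) (\<eta>' n) + inprod (H n) (\<xi> n) (\<eta>' n \<ominus>\<^bsub>H n\<^esub> \<eta> n)"
      using BS by (simp add: Hn.inprod_linear)
    also have "cmod \<dots> \<le> cmod (inprod (H n) (\<xi>' n \<ominus>\<^bsub>H n\<^esub> \<xi> n) (\<eta>' n)) + cmod (inprod (H n) (\<xi> n) (\<eta>' n \<ominus>\<^bsub>H n\<^esub> \<eta> n))"
      by (rule norm_triangle_ineq)
    also have "\<dots> \<le> hnorm (H n) (\<xi>' n \<ominus>\<^bsub>H n\<^esub> \<xi> n) * hnorm (H n) (\<eta>' n) + hnorm (H n) (\<xi> n) * hnorm (H n) (\<eta>' n \<ominus>\<^bsub>H n\<^esub> \<eta> n)"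
      using BS by (intro add_mono Hn.Cauchy_Schwarz) auto
    also have "\<dots> \<le> ?b n"
      using BS C D by (intro add_mono mult_left_mono mult_right_mono) auto
    finally show ?thesis .
  qed
  then show ?thesis by (intro Lim_null_comparison[OF _ lim]) simp
qed

lemma tendsto_inprod_cls:
  assumes \<xi>: "\<xi> \<in> BS" and \<eta>: "\<eta> \<in> BS"
  shows "((\<lambda>n. inprod (H n) (\<xi> n) (\<eta> n)) \<longlongrightarrow> inprod U (cls \<xi>) (cls \<eta>)) \<omega>"
proof -
  let ?L = "\<lambda>\<xi> \<eta>. Lim \<omega> (\<lambda>n. inprod (H n) (\<xi> n) (\<eta> n))"
  have lim: "((\<lambda>n. inprod (H n) (\<xi> n) (\<eta> n)) \<longlongrightarrow> ?L \<xi> \<eta>) \<omega>" if "\<xi> \<in> BS" "\<eta> \<in> BS" for \<xi> \<eta>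
    using inprod_convergent[OF that] tendsto_Lim[OF nontrivial] by metis
  have eq: "?L \<xi>' \<eta>' = ?L \<xi> \<eta>"
    if "\<xi>' \<in> BS" "cls \<xi>' = cls \<xi>" "\<eta>' \<in> BS" "cls \<eta>' = cls \<eta>" "\<xi> \<in> BS" "\<eta> \<in> BS" for \<xi> \<xi>' \<eta> \<eta>'
  proof -
    have "?L \<xi>' \<eta>' - ?L \<xi> \<eta> = 0"
      by (rule tendsto_unique[OF nontrivial tendsto_diff[OF lim lim] inprod_diff_null])
        (use that in auto)
    then show ?thesis by simp
  qed
  have "(\<Union>\<xi>'\<in>cls \<xi>. \<Union>\<eta>'\<in>cls \<eta>. {?L \<xi>' \<eta>'}) = {?L \<xi> \<eta>}"
    by (rule UN_cls2[OF \<xi> \<eta>]) (simp add: eq[OF _ _ _ _ \<xi> \<eta>])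
  then have "inprod U (cls \<xi>) (cls \<eta>) = ?L \<xi> \<eta>"
    by (simp add: hilbert_ultraproduct_def)
  then show ?thesis using lim \<xi> \<eta> by simp
qed

lemma inprod_cls_eqI:
  assumes "\<xi> \<in> BS" "\<eta> \<in> BS" "((\<lambda>n. inprod (H n) (\<xi> n) (\<eta> n)) \<longlongrightarrow> l) \<omega>"
  shows "inprod U (cls \<xi>) (cls \<eta>) = l"
  using tendsto_unique[OF nontrivial tendsto_inprod_cls[OF assms(1,2)] assms(3)] .

lemma pre_hilbert_ultraproduct: "pre_hilbert_space U"
proof (intro pre_hilbert_space.intro moduleI pre_hilbert_space_axioms.intro)
  show "cring complex_ring" by (rule cring_complex_ring)
  show "abelian_group U"
  proof (rule abelian_groupI)
    fix X Y assume X: "X \<in> carrier U" and Y: "Y \<in> carrier U"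
    show "X \<oplus>\<^bsub>U\<^esub> Y \<in> carrier U"
      using X Y by (elim carrier_cases) (simp add: cls_add)
    show "X \<oplus>\<^bsub>U\<^esub> Y = Y \<oplus>\<^bsub>U\<^esub> X"
      using X Y by (elim carrier_cases) (simp add: cls_add Hn.M.a_comm)
    fix Z assume Z: "Z \<in> carrier U"
    show "X \<oplus>\<^bsub>U\<^esub> Y \<oplus>\<^bsub>U\<^esub> Z = X \<oplus>\<^bsub>U\<^esub> (Y \<oplus>\<^bsub>U\<^esub> Z)"
      using X Y Z by (elim carrier_cases) (simp add: cls_add Hn.M.a_assoc)
  next
    show "\<zero>\<^bsub>U\<^esub> \<in> carrier U" by (simp add: cls_zero)
    fix X assume X: "X \<in> carrier U"
    show "\<zero>\<^bsub>U\<^esub> \<oplus>\<^bsub>U\<^esub> X = X"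
      using X by (elim carrier_cases) (simp add: cls_add cls_zero)
    obtain \<xi> where \<xi>: "\<xi> \<in> BS" "X = cls \<xi>" using X by (rule carrier_cases)
    have "(-1) \<odot>\<^bsub>H n\<^esub> \<xi> n \<oplus>\<^bsub>H n\<^esub> \<xi> n = \<zero>\<^bsub>H n\<^esub>" for n
      by (rule Hn.vector_eqI) (use \<xi> in \<open>auto simp: Hn.inprod_linear\<close>)
    then show "\<exists>Y\<in>carrier U. Y \<oplus>\<^bsub>U\<^esub> X = \<zero>\<^bsub>U\<^esub>"
      using \<xi> by (intro bexI[of _ "cls (\<lambda>n. (-1) \<odot>\<^bsub>H n\<^esub> \<xi> n)"]) (simp_all add: cls_add cls_zero)
  qed
  fix a b :: complex and X Y Z assume X: "X \<in> carrier U"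
  then obtain \<xi> where \<xi>: "\<xi> \<in> BS" "X = cls \<xi>" by (rule carrier_cases)
  show "a \<odot>\<^bsub>U\<^esub> X \<in> carrier U" using \<xi> by (simp add: cls_smult)
  show "(a \<oplus>\<^bsub>complex_ring\<^esub> b) \<odot>\<^bsub>U\<^esub> X = a \<odot>\<^bsub>U\<^esub> X \<oplus>\<^bsub>U\<^esub> b \<odot>\<^bsub>U\<^esub> X"
    using \<xi> Hn.smult_l_distr[of a b] by (simp add: cls_smult cls_add)
  show "(a \<otimes>\<^bsub>complex_ring\<^esub> b) \<odot>\<^bsub>U\<^esub> X = a \<odot>\<^bsub>U\<^esub> (b \<odot>\<^bsub>U\<^esub> X)"
    using \<xi> Hn.smult_assoc1[of a b] by (simp add: cls_smult)
  show "\<one>\<^bsub>complex_ring\<^esub> \<odot>\<^bsub>U\<^esub> X = X"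
    using \<xi> Hn.smult_one by (simp add: cls_smult)
  show "inprod U X X \<in> \<real>\<^sub>\<ge>\<^sub>0"
    unfolding \<xi>(2)
    by (rule Lim_in_closed_set[OF closed_nonneg_Reals_complex _ nontrivial tendsto_inprod_cls])
      (use \<xi> Hn.inprod_nonneg in auto)
  show "X = \<zero>\<^bsub>U\<^esub>" if "inprod U X X = 0"
  proof -
    have "((\<lambda>n. sqrt (Re (inprod (H n) (\<xi> n) (\<xi> n)))) \<longlongrightarrow> sqrt (Re (inprod U X X))) \<omega>"
      unfolding \<xi>(2) by (intro tendsto_real_sqrt tendsto_Re tendsto_inprod_cls \<xi>)
    then have "((\<lambda>n. hnorm (H n) (\<xi> n)) \<longlongrightarrow> 0) \<omega>" using that by (simp add: hnorm_def)
    then show ?thesis using \<xi> by (simp add: cls_zero cls_eq_iff)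
  qed
  assume "Y \<in> carrier U"
  then obtain \<eta> where \<eta>: "\<eta> \<in> BS" "Y = cls \<eta>" by (rule carrier_cases)
  show "a \<odot>\<^bsub>U\<^esub> (X \<oplus>\<^bsub>U\<^esub> Y) = a \<odot>\<^bsub>U\<^esub> X \<oplus>\<^bsub>U\<^esub> a \<odot>\<^bsub>U\<^esub> Y"
    using \<xi> \<eta> Hn.smult_r_distr[of a] by (simp add: cls_smult cls_add)
  show "inprod U (a \<odot>\<^bsub>U\<^esub> X) Y = a * inprod U X Y"
    unfolding \<xi>(2) \<eta>(2) cls_smult[OF \<xi>(1)]
    using tendsto_mult[OF tendsto_const[of a] tendsto_inprod_cls[OF \<xi>(1) \<eta>(1)]] \<xi> \<eta>
    by (intro inprod_cls_eqI) (auto simp: Hn.inprod_smult_left)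
  show "inprod U X Y = cnj (inprod U Y X)"
    unfolding \<xi>(2) \<eta>(2)
    using tendsto_cnj[OF tendsto_inprod_cls[OF \<eta>(1) \<xi>(1)]] \<xi> \<eta>
    by (intro inprod_cls_eqI) (auto simp flip: Hn.inprod_commute)
  assume "Z \<in> carrier U"
  then obtain \<zeta> where \<zeta>: "\<zeta> \<in> BS" "Z = cls \<zeta>" by (rule carrier_cases)
  show "inprod U (X \<oplus>\<^bsub>U\<^esub> Y) Z = inprod U X Z + inprod U Y Z"
    unfolding \<xi>(2) \<eta>(2) \<zeta>(2) cls_add[OF \<xi>(1) \<eta>(1)]
    using tendsto_add[OF tendsto_inprod_cls[OF \<xi>(1) \<zeta>(1)] tendsto_inprod_cls[OF \<eta>(1) \<zeta>(1)]] \<xi> \<eta> \<zeta>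
    by (intro inprod_cls_eqI) (auto simp: Hn.inprod_add_left)
qed

lemma tendsto_hnorm_cls:
  assumes "\<xi> \<in> BS"
  shows "((\<lambda>n. hnorm (H n) (\<xi> n)) \<longlongrightarrow> hnorm U (cls \<xi>)) \<omega>"
  unfolding hnorm_def by (intro tendsto_real_sqrt tendsto_Re tendsto_inprod_cls assms)

lemma cls_minus:
  assumes \<xi>: "\<xi> \<in> BS" and \<eta>: "\<eta> \<in> BS"
  shows "cls \<xi> \<ominus>\<^bsub>U\<^esub> cls \<eta> = cls (\<lambda>n. \<xi> n \<ominus>\<^bsub>H n\<^esub> \<eta> n)"
proof -
  interpret U: pre_hilbert_space U by (rule pre_hilbert_ultraproduct)
  show ?thesis
    using assms by (simp add: U.minus_as_add Hn.minus_as_add cls_smult cls_add)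
qed

lemma hnorm_cls_minus_le:
  assumes "\<xi> \<in> BS" "\<eta> \<in> BS" "eventually (\<lambda>n. hnorm (H n) (\<xi> n \<ominus>\<^bsub>H n\<^esub> \<eta> n) \<le> e) \<omega>"
  shows "hnorm U (cls \<xi> \<ominus>\<^bsub>U\<^esub> cls \<eta>) \<le> e"
  unfolding cls_minus[OF assms(1,2)]
  by (rule tendsto_upperbound[OF tendsto_hnorm_cls assms(3) nontrivial]) (use assms in simp)

text \<open>Countable saturation of the ultraproduct: given a Cauchy sequence with representatives
  \<open>x\<^sub>0, x\<^sub>1, \<dots>\<close> of a fast subsequence, the set of indices at which \<open>x\<^sub>0, \<dots>, x\<^sub>m\<close> are as close to
  each other as their classes belongs to the ultrafilter.  At index \<open>n\<close> the limit follows the representative \<open>x\<^sub>m\<close> with the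
  largest \<open>m \<le> n\<close> for which \<open>n\<close> is in this set; for a free ultrafilter this \<open>m\<close> tends to infinity.\<close>

lemma hilbert_ultraproduct: "hilbert_space U"
proof -
  interpret U: pre_hilbert_space U by (rule pre_hilbert_ultraproduct)
  show ?thesis
  proof (rule U.hilbert_spaceI)
    fix s :: "nat \<Rightarrow> (nat \<Rightarrow> 'a) set"
    assume s: "\<And>n. s n \<in> carrier U"
      and cauchy: "\<And>e. e > 0 \<Longrightarrow> \<exists>N. \<forall>m\<ge>N. \<forall>n\<ge>N. hnorm U (s m \<ominus>\<^bsub>U\<^esub> s n) < e"
    have "\<exists>N. \<forall>m\<ge>N. \<forall>n\<ge>N. hnorm U (s m \<ominus>\<^bsub>U\<^esub> s n) < (1/2)^k" for k :: nat
      by (rule cauchy) simp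
    then obtain N where N: "\<And>k m n. m \<ge> N k \<Longrightarrow> n \<ge> N k \<Longrightarrow> hnorm U (s m \<ominus>\<^bsub>U\<^esub> s n) < (1/2)^k"
      by metis
    \<comment> \<open>partial sums make the indices increasing while staying above \<open>N k\<close>\<close>
    define M where "M k = (\<Sum>i\<le>k. N i)" for k
    have MN: "N i \<le> M j" if "i \<le> j" for i j :: nat
      unfolding M_def using that by (intro member_le_sum) auto
    have "\<exists>\<xi>. \<xi> \<in> BS \<and> s (M k) = cls \<xi>" for k using s carrier_cases by metis
    then obtain x where x: "\<And>k. x k \<in> BS" "\<And>k. s (M k) = cls (x k)" by metis
    define A where "A m n \<longleftrightarrow> (\<forall>j\<in>{..m}. \<forall>i\<in>{..j}. hnorm (H n) (x i n \<ominus>\<^bsub>H n\<^esub> x j n) < (1/2)^i)" for m n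
    \<comment> \<open>the set of \<open>m\<close> below is never empty, and \<open>y\<close> stays within distance 1 of \<open>x 0\<close>\<close>
    have A0: "A 0 n" for n using x by (simp add: A_def)
    have evA: "eventually (A m) \<omega>" for m
      unfolding A_def
    proof (intro eventually_ball_finite ballI finite_atMost)
      fix i j :: nat assume "i \<in> {..j}"
      then have "hnorm U (s (M i) \<ominus>\<^bsub>U\<^esub> s (M j)) < (1/2)^i" using N MN by simp
      then show "eventually (\<lambda>n. hnorm (H n) (x i n \<ominus>\<^bsub>H n\<^esub> x j n) < (1/2)^i) \<omega>"
        using x by (intro order_tendstoD(2)[OF tendsto_hnorm_cls]) (auto simp: cls_minus)
    qed
    define \<mu> where "\<mu> n = Max {m. m \<le> n \<and> A m n}" for n
    have fin: "finite {m. m \<le> n \<and> A m n}" for n by simp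
    have \<mu>: "A (\<mu> n) n" for n
      using Max_in[OF fin, of n] A0 unfolding \<mu>_def by blast
    have \<mu>_ge: "m \<le> \<mu> n" if "m \<le> n" "A m n" for m n
      using Max_ge[OF fin, of m n] that by (simp add: \<mu>_def)
    define y where "y n = x (\<mu> n) n" for n
    have close: "hnorm (H n) (x m n \<ominus>\<^bsub>H n\<^esub> y n) < (1/2)^m" if "m \<le> \<mu> n" for m n
      using \<mu>[of n] that by (auto simp: A_def y_def)
    obtain C where C: "\<And>n. hnorm (H n) (x 0 n) \<le> C" using BS_bound[OF x(1)[of 0]] by metis
    have y: "y \<in> BS"
    proof (rule BSI[of _ "1 + C"])
      fix n show yc: "y n \<in> carrier (H n)" using x by (simp add: y_def)
      have "hnorm (H n) (y n) \<le> hnorm (H n) (y n \<ominus>\<^bsub>H n\<^esub> x 0 n) + hnorm (H n) (x 0 n)"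
        using yc x by (intro Hn.hnorm_le_minus) auto
      then show "hnorm (H n) (y n) \<le> 1 + C"
        using close[of 0 n] C[of n] Hn.hnorm_minus_commute[of "y n" n "x 0 n"] yc x by simp
    qed
    have lim: "hnorm U (s (M m) \<ominus>\<^bsub>U\<^esub> cls y) \<le> (1/2)^m" for m
      unfolding x(2)
    proof (rule hnorm_cls_minus_le[OF x(1) y])
      show "eventually (\<lambda>n. hnorm (H n) (x m n \<ominus>\<^bsub>H n\<^esub> y n) \<le> (1/2)^m) \<omega>"
        using eventually_ge[of m] evA[of m]
        by eventually_elim (use close \<mu>_ge in \<open>auto intro: less_imp_le\<close>)
    qed
    have "(\<lambda>n. hnorm U (s n \<ominus>\<^bsub>U\<^esub> cls y)) \<longlonglongrightarrow> 0"
    proof (rule LIMSEQ_I)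
      fix e :: real assume e: "e > 0"
      then obtain k where k: "(1/2::real)^k < e / 2"
        using real_arch_pow_inv[of "e / 2" "1 / 2"] by auto
      have "hnorm U (s n \<ominus>\<^bsub>U\<^esub> cls y) < e" if n: "n \<ge> N k" for n
      proof -
        have "hnorm U (s n \<ominus>\<^bsub>U\<^esub> cls y) \<le> hnorm U (s n \<ominus>\<^bsub>U\<^esub> s (M k)) + hnorm U (s (M k) \<ominus>\<^bsub>U\<^esub> cls y)"
          using s y by (intro U.hnorm_triangle_minus) auto
        also have "\<dots> < e" using N[OF n MN[of k k]] lim[of k] k by simp
        finally show ?thesis .
      qed
      then show "\<exists>N. \<forall>n\<ge>N. norm (hnorm U (s n \<ominus>\<^bsub>U\<^esub> cls y) - 0) < e"
        using s y by auto
    qed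
    then show "\<exists>p\<in>carrier U. (\<lambda>n. hnorm U (s n \<ominus>\<^bsub>U\<^esub> p)) \<longlonglongrightarrow> 0"
      using y by (intro bexI[of _ "cls y"]) auto
  qed
qed

text \<open>The maps that pass to the ultraproduct; linearity is not part of the definition, so that it
  covers the conjugations as well as the uniformly bounded operators.\<close>

definition equi_lipschitz :: "(nat \<Rightarrow> 'a \<Rightarrow> 'a) \<Rightarrow> bool" where
  "equi_lipschitz f \<longleftrightarrow> (\<forall>n. \<forall>x\<in>carrier (H n). f n x \<in> carrier (H n)) \<and> (\<forall>n. f n \<zero>\<^bsub>H n\<^esub> = \<zero>\<^bsub>H n\<^esub>) \<and>
     (\<exists>C. \<forall>n. \<forall>x\<in>carrier (H n). \<forall>y\<in>carrier (H n).
        hnorm (H n) (f n x \<ominus>\<^bsub>H n\<^esub> f n y) \<le> C * hnorm (H n) (x \<ominus>\<^bsub>H n\<^esub> y))"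

lemma
  assumes f: "equi_lipschitz f" and \<xi>: "\<xi> \<in> BS"
  shows BS_equi_lipschitz: "(\<lambda>n. f n (\<xi> n)) \<in> BS"
    and ultra_map_cls: "ultra_map \<omega> H f (cls \<xi>) = cls (\<lambda>n. f n (\<xi> n))"
proof -
  obtain C where C: "\<And>n x y. x \<in> carrier (H n) \<Longrightarrow> y \<in> carrier (H n) \<Longrightarrow>
      hnorm (H n) (f n x \<ominus>\<^bsub>H n\<^esub> f n y) \<le> C * hnorm (H n) (x \<ominus>\<^bsub>H n\<^esub> y)"
    and fc: "\<And>n x. x \<in> carrier (H n) \<Longrightarrow> f n x \<in> carrier (H n)"
    and f0: "\<And>n. f n \<zero>\<^bsub>H n\<^esub> = \<zero>\<^bsub>H n\<^esub>"
    using f unfolding equi_lipschitz_def by metis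
  have BS: "(\<lambda>n. f n (\<xi> n)) \<in> BS" if \<xi>: "\<xi> \<in> BS" for \<xi>
  proof -
    obtain D where D: "D \<ge> 0" "\<And>n. hnorm (H n) (\<xi> n) \<le> D" using BS_bound[OF \<xi>] by metis
    show ?thesis
    proof (rule BSI[of _ "\<bar>C\<bar> * D"])
      fix n show "f n (\<xi> n) \<in> carrier (H n)" using fc \<xi> by simp
      have "hnorm (H n) (f n (\<xi> n)) \<le> C * hnorm (H n) (\<xi> n)"
        using C[of "\<xi> n" n "\<zero>\<^bsub>H n\<^esub>"] \<xi> f0 fc by simp
      also have "\<dots> \<le> \<bar>C\<bar> * D" using D \<xi> by (intro mult_mono) auto
      finally show "hnorm (H n) (f n (\<xi> n)) \<le> \<bar>C\<bar> * D" .
    qed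
  qed
  then show "(\<lambda>n. f n (\<xi> n)) \<in> BS" using \<xi> by simp
  have "ultra_map \<omega> H f (cls \<xi>) = (\<Union>\<zeta>\<in>cls \<xi>. cls (\<lambda>n. f n (\<zeta> n)))"
    using \<xi> by (simp add: ultra_map_def)
  also have "\<dots> = cls (\<lambda>n. f n (\<xi> n))"
  proof (rule UN_cls[OF \<xi>])
    fix \<zeta> assume \<zeta>: "\<zeta> \<in> BS" "cls \<zeta> = cls \<xi>"
    then have "((\<lambda>n. C * hnorm (H n) (\<zeta> n \<ominus>\<^bsub>H n\<^esub> \<xi> n)) \<longlongrightarrow> C * 0) \<omega>"
      using \<xi> by (intro tendsto_mult tendsto_const) (simp add: cls_eq_iff)
    then have "null_diff (\<lambda>n. f n (\<zeta> n)) (\<lambda>n. f n (\<xi> n))"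
      using \<zeta> \<xi> C fc by (intro null_diff_dominated[of "\<lambda>n. C * hnorm (H n) (\<zeta> n \<ominus>\<^bsub>H n\<^esub> \<xi> n)"]) auto
    then show "cls (\<lambda>n. f n (\<zeta> n)) = cls (\<lambda>n. f n (\<xi> n))"
      using BS \<zeta> \<xi> by (simp add: cls_eq_iff)
  qed
  finally show "ultra_map \<omega> H f (cls \<xi>) = cls (\<lambda>n. f n (\<xi> n))" .
qed

end


section \<open>Operators on the ultraproduct and their commutants\<close>

context hilbert_ultra
begin

sublocale U: hilbert_space U
  by (rule hilbert_ultraproduct)

definition unif_bounded :: "(nat \<Rightarrow> 'a \<Rightarrow> 'a) \<Rightarrow> bool" where
  "unif_bounded a \<longleftrightarrow> (\<forall>n. a n \<in> bounded_ops (H n)) \<and>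
     (\<exists>C\<ge>0. \<forall>n. \<forall>x\<in>carrier (H n). hnorm (H n) (a n x) \<le> C * hnorm (H n) x)"

lemma unif_boundedI:
  assumes "\<And>n. a n \<in> bounded_ops (H n)" "C \<ge> 0"
    "\<And>n x. x \<in> carrier (H n) \<Longrightarrow> hnorm (H n) (a n x) \<le> C * hnorm (H n) x"
  shows "unif_bounded a"
  using assms unfolding unif_bounded_def by blast

lemma unif_boundedE:
  assumes "unif_bounded a"
  obtains C where "\<And>n. a n \<in> bounded_ops (H n)" "C \<ge> 0"
    "\<And>n x. x \<in> carrier (H n) \<Longrightarrow> hnorm (H n) (a n x) \<le> C * hnorm (H n) x"
  using assms unfolding unif_bounded_def by blast

lemma unif_bounded_iff:
  assumes "\<And>n. a n \<in> bounded_ops (H n)"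
  shows "unif_bounded a \<longleftrightarrow> bdd_above (range (\<lambda>n. opnorm (H n) (a n)))"
proof
  assume "unif_bounded a"
  then obtain C where "C \<ge> 0" "\<And>n x. x \<in> carrier (H n) \<Longrightarrow> hnorm (H n) (a n x) \<le> C * hnorm (H n) x"
    unfolding unif_bounded_def by blast
  then have "opnorm (H n) (a n) \<le> C" for n using assms by (intro Hn.opnorm_le) auto
  then show "bdd_above (range (\<lambda>n. opnorm (H n) (a n)))" by (intro bdd_aboveI2)
next
  assume "bdd_above (range (\<lambda>n. opnorm (H n) (a n)))"
  then obtain C where C: "\<And>n. opnorm (H n) (a n) \<le> C" unfolding bdd_above_def by blast
  show "unif_bounded a"
  proof (rule unif_boundedI[OF assms, of C])
    show "C \<ge> 0" using Hn.opnorm_nonneg[OF assms, of 0] C[of 0] by linarith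
    fix n x assume x: "x \<in> carrier (H n)"
    have "hnorm (H n) (a n x) \<le> opnorm (H n) (a n) * hnorm (H n) x" by (rule Hn.opnorm_bound[OF assms x])
    also have "\<dots> \<le> C * hnorm (H n) x" using C x by (intro mult_right_mono) auto
    finally show "hnorm (H n) (a n x) \<le> C * hnorm (H n) x" .
  qed
qed

lemma unif_bounded_equi_lipschitz:
  assumes "unif_bounded a"
  shows "equi_lipschitz a"
proof -
  obtain C where a: "\<And>n. a n \<in> bounded_ops (H n)" and C: "C \<ge> 0"
    "\<And>n x. x \<in> carrier (H n) \<Longrightarrow> hnorm (H n) (a n x) \<le> C * hnorm (H n) x"
    using assms by (rule unif_boundedE) (rule that)
  note ac = Hn.bounded_opsD(1)[OF a]
  have "a n \<zero>\<^bsub>H n\<^esub> = \<zero>\<^bsub>H n\<^esub>" for n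
    using Hn.bounded_opsD(4)[OF a, of "\<zero>\<^bsub>H n\<^esub>" n 0] ac[of "\<zero>\<^bsub>H n\<^esub>" n] by simp
  moreover have "hnorm (H n) (a n x \<ominus>\<^bsub>H n\<^esub> a n y) \<le> C * hnorm (H n) (x \<ominus>\<^bsub>H n\<^esub> y)"
    if "x \<in> carrier (H n)" "y \<in> carrier (H n)" for n x y
    using C(2)[of "x \<ominus>\<^bsub>H n\<^esub> y" n] Hn.bounded_ops_minus[OF a that] that by simp
  ultimately show ?thesis unfolding equi_lipschitz_def using ac by blast
qed

lemmas ultra_map_bounded = ultra_map_cls[OF unif_bounded_equi_lipschitz]
  and BS_bounded = BS_equi_lipschitz[OF unif_bounded_equi_lipschitz]

lemma unif_bounded_adjoint:
  assumes "unif_bounded a"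
  shows "unif_bounded (\<lambda>n. op_adjoint (H n) (a n))"
proof -
  obtain C where a: "\<And>n. a n \<in> bounded_ops (H n)" and C: "C \<ge> 0"
    "\<And>n x. x \<in> carrier (H n) \<Longrightarrow> hnorm (H n) (a n x) \<le> C * hnorm (H n) x"
    using assms by (rule unif_boundedE) (rule that)
  show ?thesis
    using Hn.op_adjoint_bounded[OF a] Hn.hnorm_op_adjoint_le[OF a C] C(1) by (intro unif_boundedI[of _ C]) auto
qed

lemma inprod_ultra_map:
  assumes a: "unif_bounded a" and X: "X \<in> carrier U" and Y: "Y \<in> carrier U"
  shows "inprod U (ultra_map \<omega> H a X) Y = inprod U X (ultra_map \<omega> H (\<lambda>n. op_adjoint (H n) (a n)) Y)"
proof -
  note a' = unif_bounded_adjoint[OF a]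
  have ab: "a n \<in> bounded_ops (H n)" for n using a by (simp add: unif_bounded_def)
  obtain \<xi> \<eta> where \<xi>: "\<xi> \<in> BS" "X = cls \<xi>" and \<eta>: "\<eta> \<in> BS" "Y = cls \<eta>"
    using X Y carrier_cases by metis
  have "((\<lambda>n. inprod (H n) (a n (\<xi> n)) (\<eta> n)) \<longlongrightarrow>
      inprod U (cls \<xi>) (cls (\<lambda>n. op_adjoint (H n) (a n) (\<eta> n)))) \<omega>"
    using tendsto_inprod_cls[OF \<xi>(1) BS_bounded[OF a' \<eta>(1)]] \<xi> \<eta>
    by (simp add: Hn.inprod_op_adjoint[OF ab])
  then show ?thesis
    unfolding \<xi>(2) \<eta>(2) ultra_map_bounded[OF a \<xi>(1)] ultra_map_bounded[OF a' \<eta>(1)]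
    by (intro inprod_cls_eqI BS_bounded[OF a \<xi>(1)] \<eta>(1))
qed

lemma hnorm_ultra_map_le:
  assumes a: "unif_bounded a" and C: "\<And>n x. x \<in> carrier (H n) \<Longrightarrow> hnorm (H n) (a n x) \<le> C * hnorm (H n) x"
    and X: "X \<in> carrier U"
  shows "hnorm U (ultra_map \<omega> H a X) \<le> C * hnorm U X"
proof -
  obtain \<xi> where \<xi>: "\<xi> \<in> BS" "X = cls \<xi>" using X by (rule carrier_cases)
  show ?thesis
    unfolding \<xi>(2) ultra_map_bounded[OF a \<xi>(1)]
    by (rule tendsto_le[OF nontrivial tendsto_mult[OF tendsto_const tendsto_hnorm_cls[OF \<xi>(1)]]
          tendsto_hnorm_cls[OF BS_bounded[OF a \<xi>(1)]]]) (use C \<xi> in auto)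
qed

lemma ultra_map_carrier:
  assumes "unif_bounded a" "X \<in> carrier U"
  shows "ultra_map \<omega> H a X \<in> carrier U"
proof -
  obtain \<xi> where \<xi>: "\<xi> \<in> BS" "X = cls \<xi>" using assms(2) by (rule carrier_cases)
  then show ?thesis by (simp add: ultra_map_bounded[OF assms(1)] BS_bounded[OF assms(1) \<xi>(1)])
qed

lemma ultra_map_bounded_ops:
  assumes a: "unif_bounded a"
  shows "ultra_map \<omega> H a \<in> bounded_ops U"
proof -
  obtain C where C: "\<And>n x. x \<in> carrier (H n) \<Longrightarrow> hnorm (H n) (a n x) \<le> C * hnorm (H n) x"
    using a unfolding unif_bounded_def by blast
  show ?thesis
  proof (rule U.bounded_opsI)
    show "ultra_map \<omega> H a \<in> carrier U \<rightarrow>\<^sub>E carrier U"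
      using ultra_map_carrier[OF a] by (auto simp: ultra_map_def)
  qed (use inprod_ultra_map[OF a] ultra_map_carrier[OF unif_bounded_adjoint[OF a]]
      hnorm_ultra_map_le[OF a C] in auto)
qed

lemma op_adjoint_ultra_map:
  assumes a: "unif_bounded a"
  shows "op_adjoint U (ultra_map \<omega> H a) = ultra_map \<omega> H (\<lambda>n. op_adjoint (H n) (a n))"
  by (rule U.op_adjoint_eqI[OF ultra_map_bounded_ops[OF a]
      ultra_map_bounded_ops[OF unif_bounded_adjoint[OF a]] inprod_ultra_map[OF a]])

definition ultra_ops :: "(nat \<Rightarrow> ('a \<Rightarrow> 'a) set) \<Rightarrow> ((nat \<Rightarrow> 'a) set \<Rightarrow> (nat \<Rightarrow> 'a) set) set" where
  "ultra_ops M = {ultra_map \<omega> H a | a. (\<forall>n. a n \<in> M n) \<and> unif_bounded a}"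

lemma ultra_ops_bounded: "ultra_ops M \<subseteq> bounded_ops U"
  unfolding ultra_ops_def by (blast intro: ultra_map_bounded_ops)

lemma groh_raynaud_closure:
  assumes "\<And>n. M n \<subseteq> bounded_ops (H n)"
  shows "groh_raynaud_ultraproduct \<omega> H M = (strong_op_topology U) closure_of (ultra_ops M)"
proof -
  have "(\<forall>n. a n \<in> M n) \<and> bdd_above (range (\<lambda>n. opnorm (H n) (a n))) \<longleftrightarrow>
      (\<forall>n. a n \<in> M n) \<and> unif_bounded a" for a
  proof (rule conj_cong[OF refl])
    assume "\<forall>n. a n \<in> M n"
    then have "a n \<in> bounded_ops (H n)" for n using assms by auto
    then show "bdd_above (range (\<lambda>n. opnorm (H n) (a n))) \<longleftrightarrow> unif_bounded a"
      by (simp add: unif_bounded_iff)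
  qed
  then show ?thesis by (simp add: groh_raynaud_ultraproduct_def ultra_ops_def)
qed

lemma ultra_ops_adjoint:
  assumes "\<And>n a. a \<in> M n \<Longrightarrow> op_adjoint (H n) a \<in> M n" "T \<in> ultra_ops M"
  shows "op_adjoint U T \<in> ultra_ops M"
proof -
  obtain a where a: "T = ultra_map \<omega> H a" "\<And>n. a n \<in> M n" "unif_bounded a"
    using assms(2) by (auto simp: ultra_ops_def)
  then show ?thesis
    using assms(1) unif_bounded_adjoint[OF a(3)] by (auto simp: ultra_ops_def op_adjoint_ultra_map)
qed

text \<open>Finite sums of vectors pass to the ultraproduct; the sums are written weakly, as in
  \<open>transports\<close>.\<close>

lemma inprod_cls_sum:
  fixes k :: nat
  assumes z: "z \<in> BS" and u: "\<And>j. j < k \<Longrightarrow> u j \<in> BS"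
    and eq: "\<And>n w. w \<in> carrier (H n) \<Longrightarrow> inprod (H n) (z n) w = (\<Sum>j<k. inprod (H n) (u j n) w)"
    and W: "W \<in> carrier U"
  shows "inprod U (cls z) W = (\<Sum>j<k. inprod U (cls (u j)) W)"
proof -
  obtain w where w: "w \<in> BS" "W = cls w" using W by (rule carrier_cases)
  show ?thesis
    unfolding w(2)
  proof (rule inprod_cls_eqI[OF z w(1)])
    have "((\<lambda>n. \<Sum>j<k. inprod (H n) (u j n) (w n)) \<longlongrightarrow> (\<Sum>j<k. inprod U (cls (u j)) (cls w))) \<omega>"
      using u w by (intro tendsto_sum tendsto_inprod_cls) auto
    then show "((\<lambda>n. inprod (H n) (z n) (w n)) \<longlongrightarrow> (\<Sum>j<k. inprod U (cls (u j)) (cls w))) \<omega>"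
      using w by (simp add: eq)
  qed
qed

text \<open>The core of Raynaud's theorem.  At each index, \<open>matrix_transport\<close> is applied to
  \<open>\<xi> = (C x\<^sub>1, \<dots>, C x\<^sub>k)\<close> and \<open>\<eta> = (y\<^sub>1, \<dots>, y\<^sub>k)\<close>, where \<open>x\<^sub>i\<close> represents the \<open>i\<close>-th vector of
  \<open>F\<close> and \<open>y\<^sub>i\<close> its image under \<open>T\<close>.  The matrices \<open>Q\<^sub>n\<close> over the commutants define a matrix over
  the operators that commute with \<open>T\<close>, hence \<open>T\<close> maps the class of \<open>Z = Q\<xi>\<close> to \<open>C\<close> times the class
  of \<open>W = Q\<eta>\<close>.  As \<open>T\<close> is bounded by \<open>C\<close>, the bound \<open>\<parallel>W\<parallel>\<^sup>2 - \<parallel>Z\<parallel>\<^sup>2 + \<delta>\<close> is at most \<open>\<delta>\<close> in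
  the limit.\<close>

lemma bicommutant_approximation:
  assumes M: "\<And>n. star_algebra (H n) (M n)"
    and T: "T \<in> commutant U (ultra_ops (\<lambda>n. commutant (H n) (M n)))"
    and C: "C > 0" "\<And>X. X \<in> carrier U \<Longrightarrow> hnorm U (T X) \<le> C * hnorm U X"
    and F: "finite F" "F \<subseteq> carrier U" and e: "e > 0"
  obtains a where "\<And>n. a n \<in> M n"
    "\<And>n x. x \<in> carrier (H n) \<Longrightarrow> hnorm (H n) (a n x) \<le> C * hnorm (H n) x"
    "\<And>X. X \<in> F \<Longrightarrow> hnorm U (ultra_map \<omega> H a X \<ominus>\<^bsub>U\<^esub> T X) < e"
proof -
  have Tb: "T \<in> bounded_ops U"
    and Tcom: "\<And>b X. b \<in> ultra_ops (\<lambda>n. commutant (H n) (M n)) \<Longrightarrow> X \<in> carrier U \<Longrightarrow> T (b X) = b (T X)"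
    using T by (auto simp: U.mem_commutant_iff)
  note Tc = U.bounded_opsD(1)[OF Tb]
  obtain k :: nat and X where X: "F = X ` {i. i < k}"
    using F(1) unfolding finite_conv_nat_seg_image by blast
  have Xc: "X i \<in> carrier U" if "i < k" for i using X F(2) that by auto
  have "\<forall>i. \<exists>x y. i < k \<longrightarrow> x \<in> BS \<and> X i = cls x \<and> y \<in> BS \<and> T (X i) = cls y"
    using Xc Tc carrier_cases by metis
  then obtain x y where x: "\<And>i. i < k \<Longrightarrow> x i \<in> BS" "\<And>i. i < k \<Longrightarrow> X i = cls (x i)"
    and y: "\<And>i. i < k \<Longrightarrow> y i \<in> BS" "\<And>i. i < k \<Longrightarrow> T (X i) = cls (y i)" by metis
  define \<delta> where "\<delta> = e\<^sup>2 / 2"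
  have \<delta>: "\<delta> > 0" using e by (simp add: \<delta>_def)
  define cx where "cx i n = complex_of_real C \<odot>\<^bsub>H n\<^esub> x i n" for i n
  have cx: "cx i \<in> BS" if "i < k" for i unfolding cx_def using x that by simp
  have "\<exists>Q Z W v. star_algebra.transports (H n) (M n) k \<delta> (\<lambda>i. cx i n) (\<lambda>i. y i n) Q Z W v" for n
    by (rule star_algebra.matrix_transport[OF M]) (use cx y \<delta> in auto)
  then obtain Q Z W v where
    good: "\<And>n. star_algebra.transports (H n) (M n) k \<delta> (\<lambda>i. cx i n) (\<lambda>i. y i n) (Q n) (Z n) (W n) (v n)"
    by metis
  note transports = star_algebra.transports_def[OF M] star_algebra.contractions_def[OF M]
  have Q: "Q n i j \<in> commutant (H n) (M n)"
    "\<And>z. z \<in> carrier (H n) \<Longrightarrow> hnorm (H n) (Q n i j z) \<le> hnorm (H n) z"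
    if "i < k" "j < k" for n i j
    using good[of n] that unfolding transports by blast+
  have ZW: "Z n i \<in> carrier (H n)" "W n i \<in> carrier (H n)"
    "\<And>w. w \<in> carrier (H n) \<Longrightarrow> inprod (H n) (Z n i) w = (\<Sum>j<k. inprod (H n) (Q n i j (cx j n)) w)"
    "\<And>w. w \<in> carrier (H n) \<Longrightarrow> inprod (H n) (W n i) w = (\<Sum>j<k. inprod (H n) (Q n i j (y j n)) w)"
    if "i < k" for n i
    using good[of n] that unfolding transports by blast+
  have v: "v n \<in> M n" "\<And>z. z \<in> carrier (H n) \<Longrightarrow> hnorm (H n) (v n z) \<le> hnorm (H n) z"
    "(\<Sum>i<k. (hnorm (H n) (y i n \<ominus>\<^bsub>H n\<^esub> v n (cx i n)))\<^sup>2)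
      \<le> (\<Sum>i<k. (hnorm (H n) (W n i))\<^sup>2) - (\<Sum>i<k. (hnorm (H n) (Z n i))\<^sup>2) + \<delta>" for n
    using good[of n] unfolding transports by blast+
  define q where "q i j n = Q n i j" for i j n
  have q: "unif_bounded (q i j)" if "i < k" "j < k" for i j
    using Q[OF that] by (intro unif_boundedI[of _ 1]) (auto simp: q_def commutant_def)
  have qops: "ultra_map \<omega> H (q i j) \<in> ultra_ops (\<lambda>n. commutant (H n) (M n))" if "i < k" "j < k" for i j
    unfolding ultra_ops_def using q[OF that] Q(1)[OF that] by (auto simp: q_def)
  define z where "z i n = Z n i" for i n
  define w where "w i n = W n i" for i n
  have sum_BS: "s \<in> BS" if i: "i < k" and u: "\<And>j. j < k \<Longrightarrow> u j \<in> BS" and sc: "\<And>n. s n \<in> carrier (H n)"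
    and eq: "\<And>n w. w \<in> carrier (H n) \<Longrightarrow> inprod (H n) (s n) w = (\<Sum>j<k. inprod (H n) (q i j n (u j n)) w)"
    for i s u
  proof -
    have "\<forall>j. \<exists>D. j < k \<longrightarrow> (\<forall>n. hnorm (H n) (u j n) \<le> D)" using u BS_bound by metis
    then obtain D where D: "\<And>j n. j < k \<Longrightarrow> hnorm (H n) (u j n) \<le> D j" by metis
    have qc: "q i j n (u j n) \<in> carrier (H n)" if "j < k" for j n
      using BS_carrier[OF BS_bounded[OF q[OF i that] u[OF that]]] .
    show ?thesis
    proof (rule BSI[OF sc])
      fix n
      have "hnorm (H n) (s n) \<le> (\<Sum>j<k. hnorm (H n) (q i j n (u j n)))"
        by (rule Hn.hnorm_le_sum[OF sc qc eq])
      also have "\<dots> \<le> (\<Sum>j<k. D j)"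
        using u by (intro sum_mono) (auto simp: q_def intro!: order_trans[OF Q(2)[OF i] D])
      finally show "hnorm (H n) (s n) \<le> (\<Sum>j<k. D j)" .
    qed
  qed
  have z: "z i \<in> BS" if "i < k" for i
    by (rule sum_BS[of i cx]) (use that cx ZW in \<open>auto simp: z_def q_def\<close>)
  have w: "w i \<in> BS" if "i < k" for i
    by (rule sum_BS[of i y]) (use that y ZW in \<open>auto simp: w_def q_def\<close>)
  have zsum: "inprod U (cls (z i)) V = (\<Sum>j<k. inprod U (ultra_map \<omega> H (q i j) (cls (cx j))) V)"
    if i: "i < k" and V: "V \<in> carrier U" for i V
  proof -
    have "inprod U (cls (z i)) V = (\<Sum>j<k. inprod U (cls (\<lambda>n. q i j n (cx j n))) V)"
      by (rule inprod_cls_sum[OF z[OF i] _ _ V])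
        (use ZW(3)[OF i] BS_bounded[OF q[OF i] cx] in \<open>auto simp: z_def q_def\<close>)
    then show ?thesis using i by (simp add: ultra_map_bounded q cx)
  qed
  have wsum: "inprod U (cls (w i)) V = (\<Sum>j<k. inprod U (ultra_map \<omega> H (q i j) (cls (y j))) V)"
    if i: "i < k" and V: "V \<in> carrier U" for i V
  proof -
    have "inprod U (cls (w i)) V = (\<Sum>j<k. inprod U (cls (\<lambda>n. q i j n (y j n))) V)"
      by (rule inprod_cls_sum[OF w[OF i] _ _ V])
        (use ZW(4)[OF i] BS_bounded[OF q[OF i] y(1)] in \<open>auto simp: w_def q_def\<close>)
    then show ?thesis using i by (simp add: ultra_map_bounded q y)
  qed
  have clscx: "cls (cx j) = complex_of_real C \<odot>\<^bsub>U\<^esub> X j" if "j < k" for j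
    unfolding cx_def using that x by (simp add: cls_smult)
  \<comment> \<open>\<open>T\<close> passes through the matrix, whose entries it commutes with\<close>
  have Tz: "T (cls (z i)) = complex_of_real C \<odot>\<^bsub>U\<^esub> cls (w i)" if i: "i < k" for i
  proof (rule U.vector_eqI)
    fix V assume V: "V \<in> carrier U"
    have qy: "T (ultra_map \<omega> H (q i j) (cls (cx j))) = complex_of_real C \<odot>\<^bsub>U\<^esub> ultra_map \<omega> H (q i j) (cls (y j))"
      if j: "j < k" for j
    proof -
      have "T (ultra_map \<omega> H (q i j) (cls (cx j))) = ultra_map \<omega> H (q i j) (T (complex_of_real C \<odot>\<^bsub>U\<^esub> X j))"
        using Tcom[OF qops[OF i j] cls_carrier[OF cx[OF j]]] clscx[OF j] by simp
      also have "\<dots> = ultra_map \<omega> H (q i j) (complex_of_real C \<odot>\<^bsub>U\<^esub> cls (y j))"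
        using U.bounded_opsD(4)[OF Tb Xc[OF j]] y(2)[OF j] by simp
      also have "\<dots> = complex_of_real C \<odot>\<^bsub>U\<^esub> ultra_map \<omega> H (q i j) (cls (y j))"
        using U.bounded_opsD(4)[OF ultra_map_bounded_ops[OF q[OF i j]]] y(1)[OF j] by simp
      finally show ?thesis .
    qed
    have TV: "op_adjoint U T V \<in> carrier U" using U.bounded_opsD(1)[OF U.op_adjoint_bounded[OF Tb] V] .
    have qc: "ultra_map \<omega> H (q i j) (cls (cx j)) \<in> carrier U" "ultra_map \<omega> H (q i j) (cls (y j)) \<in> carrier U"
      if "j < k" for j
      using ultra_map_carrier[OF q[OF i that]] cx[OF that] y[OF that] by auto
    have "inprod U (T (cls (z i))) V = (\<Sum>j<k. inprod U (ultra_map \<omega> H (q i j) (cls (cx j))) (op_adjoint U T V))"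
      using z[OF i] V TV by (simp add: U.inprod_op_adjoint[OF Tb] zsum i)
    also have "\<dots> = (\<Sum>j<k. inprod U (T (ultra_map \<omega> H (q i j) (cls (cx j)))) V)"
      using V qc by (intro sum.cong refl) (simp add: U.inprod_op_adjoint[OF Tb])
    also have "\<dots> = complex_of_real C * inprod U (cls (w i)) V"
      using V qc by (simp add: qy U.inprod_smult_left wsum i sum_distrib_left)
    finally show "inprod U (T (cls (z i))) V = inprod U (complex_of_real C \<odot>\<^bsub>U\<^esub> cls (w i)) V"
      using V w[OF i] by (simp add: U.inprod_smult_left)
  qed (use z[OF i] w[OF i] Tc in auto)
  have wz: "hnorm U (cls (w i)) \<le> hnorm U (cls (z i))" if i: "i < k" for i
    using C(2)[of "cls (z i)"] z[OF i] w[OF i] C(1) by (simp add: Tz[OF i])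
  define a where "a n = op_smult (H n) (complex_of_real C) (v n)" for n
  have vb: "v n \<in> bounded_ops (H n)" for n using star_algebra.N_bounded[OF M] v(1) by blast
  have vU: "unif_bounded v" using vb v(2) by (intro unif_boundedI[of _ 1]) auto
  have a_app: "a n u = v n (complex_of_real C \<odot>\<^bsub>H n\<^esub> u)" "a n u = complex_of_real C \<odot>\<^bsub>H n\<^esub> v n u"
    if "u \<in> carrier (H n)" for n u
    using that Hn.bounded_opsD(4)[OF vb] by (simp_all add: a_def op_smult_def)
  have aM: "a n \<in> M n" for n unfolding a_def by (rule star_algebra.N_smult[OF M v(1)])
  have a_le: "hnorm (H n) (a n u) \<le> C * hnorm (H n) u" if "u \<in> carrier (H n)" for n u
    using that v(2)[OF that] Hn.bounded_opsD(1)[OF vb that] C(1) by (simp add: a_app(2))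
  have aU: "unif_bounded a"
    using star_algebra.N_bounded[OF M] aM a_le C by (intro unif_boundedI[of _ C]) auto
  have aX: "ultra_map \<omega> H a (X i) = cls (\<lambda>n. v n (cx i n))" if "i < k" for i
    using that x by (simp add: ultra_map_bounded aU a_app(1) cx_def)
  have vcx: "(\<lambda>n. v n (cx i n)) \<in> BS" if "i < k" for i by (rule BS_bounded[OF vU cx[OF that]])
  have "(\<Sum>i<k. (hnorm U (T (X i) \<ominus>\<^bsub>U\<^esub> ultra_map \<omega> H a (X i)))\<^sup>2)
      \<le> (\<Sum>i<k. (hnorm U (cls (w i)))\<^sup>2) - (\<Sum>i<k. (hnorm U (cls (z i)))\<^sup>2) + \<delta>"
  proof (rule tendsto_le[OF nontrivial])
    show "((\<lambda>n. (\<Sum>i<k. (hnorm (H n) (w i n))\<^sup>2) - (\<Sum>i<k. (hnorm (H n) (z i n))\<^sup>2) + \<delta>)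
        \<longlongrightarrow> (\<Sum>i<k. (hnorm U (cls (w i)))\<^sup>2) - (\<Sum>i<k. (hnorm U (cls (z i)))\<^sup>2) + \<delta>) \<omega>"
      using w z by (intro tendsto_add tendsto_diff tendsto_sum tendsto_power tendsto_const tendsto_hnorm_cls) auto
    have "((\<lambda>n. \<Sum>i<k. (hnorm (H n) (y i n \<ominus>\<^bsub>H n\<^esub> v n (cx i n)))\<^sup>2)
        \<longlongrightarrow> (\<Sum>i<k. (hnorm U (cls (\<lambda>n. y i n \<ominus>\<^bsub>H n\<^esub> v n (cx i n))))\<^sup>2)) \<omega>"
      using y vcx by (intro tendsto_sum tendsto_power tendsto_hnorm_cls BS_minus) auto
    then show "((\<lambda>n. \<Sum>i<k. (hnorm (H n) (y i n \<ominus>\<^bsub>H n\<^esub> v n (cx i n)))\<^sup>2)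
        \<longlongrightarrow> (\<Sum>i<k. (hnorm U (T (X i) \<ominus>\<^bsub>U\<^esub> ultra_map \<omega> H a (X i)))\<^sup>2)) \<omega>"
      using y vcx by (simp add: aX cls_minus)
    show "eventually (\<lambda>n. (\<Sum>i<k. (hnorm (H n) (y i n \<ominus>\<^bsub>H n\<^esub> v n (cx i n)))\<^sup>2)
        \<le> (\<Sum>i<k. (hnorm (H n) (w i n))\<^sup>2) - (\<Sum>i<k. (hnorm (H n) (z i n))\<^sup>2) + \<delta>) \<omega>"
      using v(3) by (simp add: w_def z_def)
  qed
  also have "\<dots> \<le> \<delta>"
  proof -
    have "(\<Sum>i<k. (hnorm U (cls (w i)))\<^sup>2) \<le> (\<Sum>i<k. (hnorm U (cls (z i)))\<^sup>2)"
      using wz w by (intro sum_mono power_mono) auto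
    then show ?thesis by simp
  qed
  finally have total: "(\<Sum>i<k. (hnorm U (T (X i) \<ominus>\<^bsub>U\<^esub> ultra_map \<omega> H a (X i)))\<^sup>2) \<le> \<delta>" .
  show thesis
  proof (rule that[OF aM a_le])
    fix V assume "V \<in> F"
    then obtain i where i: "i < k" "V = X i" using X by auto
    have aXc: "ultra_map \<omega> H a (X i) \<in> carrier U" by (rule ultra_map_carrier[OF aU Xc[OF i(1)]])
    have "(hnorm U (T (X i) \<ominus>\<^bsub>U\<^esub> ultra_map \<omega> H a (X i)))\<^sup>2 \<le> \<delta>"
      using i(1) by (intro order_trans[OF member_le_sum total]) auto
    also have "\<delta> < e\<^sup>2" using e by (simp add: \<delta>_def)
    finally have "hnorm U (T (X i) \<ominus>\<^bsub>U\<^esub> ultra_map \<omega> H a (X i)) < e"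
      by (rule power2_less_imp_less) (use e in simp)
    then show "hnorm U (ultra_map \<omega> H a V \<ominus>\<^bsub>U\<^esub> T V) < e"
      using U.hnorm_minus_commute[OF aXc Tc[OF Xc[OF i(1)]]] i by simp
  qed
qed

text \<open>Raynaud's theorem in the form used here.  Sequences from the \<open>M\<^sub>n\<close> commute with
  sequences from the \<open>M\<^sub>n'\<close> index by index, and a commutant is strongly closed; the converse inclusion is
  the approximation just proved.\<close>

theorem groh_raynaud_eq_commutant:
  assumes M: "\<And>n. star_algebra (H n) (M n)"
  shows "groh_raynaud_ultraproduct \<omega> H M = commutant U (ultra_ops (\<lambda>n. commutant (H n) (M n)))"
proof -
  let ?B = "ultra_ops (\<lambda>n. commutant (H n) (M n))"
  have Mb: "M n \<subseteq> bounded_ops (H n)" for n by (rule star_algebra.N_bounded[OF M])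
  have "ultra_ops M \<subseteq> commutant U ?B"
  proof
    fix T assume T: "T \<in> ultra_ops M"
    then obtain a where a: "T = ultra_map \<omega> H a" "\<And>n. a n \<in> M n" "unif_bounded a"
      by (auto simp: ultra_ops_def)
    have "T (S X) = S (T X)" if S: "S \<in> ?B" and X: "X \<in> carrier U" for S X
    proof -
      obtain b where b: "S = ultra_map \<omega> H b" "\<And>n. b n \<in> commutant (H n) (M n)" "unif_bounded b"
        using S by (auto simp: ultra_ops_def)
      obtain \<xi> where \<xi>: "\<xi> \<in> BS" "X = cls \<xi>" using X by (rule carrier_cases)
      have "b n (a n (\<xi> n)) = a n (b n (\<xi> n))" for n
        using b(2)[of n] a(2)[of n] \<xi>(1) by (auto simp: Hn.mem_commutant_iff)
      then show ?thesis
        unfolding a(1) b(1) \<xi>(2) using a(3) b(3) \<xi>(1)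
        by (simp add: ultra_map_bounded BS_bounded[OF a(3) \<xi>(1)] BS_bounded[OF b(3) \<xi>(1)])
    qed
    then show "T \<in> commutant U ?B"
      using subsetD[OF ultra_ops_bounded T] by (simp add: U.mem_commutant_iff)
  qed
  then have "strong_op_topology U closure_of ultra_ops M \<subseteq> commutant U ?B"
    by (rule closure_of_minimal) (rule U.commutant_closed[OF ultra_ops_bounded])
  moreover have "T \<in> strong_op_topology U closure_of ultra_ops M" if T: "T \<in> commutant U ?B" for T
    unfolding U.strong_closure_iff[OF ultra_ops_bounded]
  proof (intro conjI allI impI)
    show Tb: "T \<in> bounded_ops U" using T by (simp add: commutant_def)
    obtain C where C: "C \<ge> 0" "\<And>X. X \<in> carrier U \<Longrightarrow> hnorm U (T X) \<le> C * hnorm U X"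
      using U.bounded_ops_bound[OF Tb] by blast
    have C': "hnorm U (T X) \<le> (C + 1) * hnorm U X" if "X \<in> carrier U" for X
      using C(2)[OF that] U.hnorm_nonneg[OF that] by (simp add: algebra_simps)
    fix F and e :: real assume F: "finite F" "F \<subseteq> carrier U" and e: "e > 0"
    obtain a where a: "\<And>n. a n \<in> M n"
      "\<And>n x. x \<in> carrier (H n) \<Longrightarrow> hnorm (H n) (a n x) \<le> (C + 1) * hnorm (H n) x"
      "\<And>X. X \<in> F \<Longrightarrow> hnorm U (ultra_map \<omega> H a X \<ominus>\<^bsub>U\<^esub> T X) < e"
      by (rule bicommutant_approximation[OF M T _ C' F e]) (use C in auto)
    have "unif_bounded a" using a(2) subsetD[OF Mb a(1)] C(1) by (intro unif_boundedI[of _ "C + 1"]) auto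
    then have "ultra_map \<omega> H a \<in> ultra_ops M" using a(1) by (auto simp: ultra_ops_def)
    then show "\<exists>A\<in>ultra_ops M. \<forall>X\<in>F. hnorm U (A X \<ominus>\<^bsub>U\<^esub> T X) < e" using a(3) by blast
  qed
  ultimately show ?thesis unfolding groh_raynaud_closure[OF Mb] by blast
qed

end


section \<open>Conjugations and self-dual cones\<close>

context hilbert_space
begin

lemma inprod_dual_cone_limit:
  assumes "\<And>n. s n \<in> carrier H" "p \<in> carrier H" "((\<lambda>n::nat. hnorm H (s n \<ominus> p)) \<longlongrightarrow> 0) sequentially"
    "y \<in> carrier H" "\<And>n. inprod H (s n) y \<in> \<real>\<^sub>\<ge>\<^sub>0"
  shows "inprod H p y \<in> \<real>\<^sub>\<ge>\<^sub>0"
proof (rule Lim_in_closed_set[OF closed_nonneg_Reals_complex _ sequentially_bot])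
  show "(\<lambda>n. inprod H (s n) y) \<longlonglongrightarrow> inprod H p y"
    by (rule tendsto_inprod) (use assms in auto)
qed (use assms in auto)

text \<open>Applied to a self-dual cone, this yields all the closure properties of the cone
  at once.\<close>

lemma closed_convex_cone_dual_cone:
  assumes S: "S \<subseteq> carrier H"
  shows "closed_convex_cone H (dual_cone H S)"
  unfolding closed_convex_cone_def
proof (intro conjI ballI allI impI)
  note Sc = subsetD[OF S]
  show "dual_cone H S \<subseteq> carrier H" by (auto simp: dual_cone_def)
  have "\<zero> \<in> dual_cone H S" using Sc by (auto simp: dual_cone_def)
  then show "dual_cone H S \<noteq> {}" by blast
  show "closedin dist.mtopology (dual_cone H S)"
    unfolding dist.metric_closedin_iff_sequentially_closed
  proof (intro conjI allI impI)
    show "dual_cone H S \<subseteq> carrier H" by (auto simp: dual_cone_def)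
    fix s l assume "range s \<subseteq> dual_cone H S \<and> limitin dist.mtopology s l sequentially"
    then have s: "\<And>n. s n \<in> dual_cone H S" and l: "l \<in> carrier H" "(\<lambda>n. hdist H (s n) l) \<longlonglongrightarrow> 0"
      by (auto simp: dist.limitin_metric_dist_null)
    have sc: "s n \<in> carrier H" for n using s[of n] by (simp add: dual_cone_def)
    have lim: "(\<lambda>n. hnorm H (s n \<ominus> l)) \<longlonglongrightarrow> 0" using l sc by (simp add: hdist_def)
    have "inprod H l y \<in> \<real>\<^sub>\<ge>\<^sub>0" if y: "y \<in> S" for y
      using s y by (intro inprod_dual_cone_limit[OF sc l(1) lim Sc[OF y]]) (auto simp: dual_cone_def)
    then show "l \<in> dual_cone H S" using l by (simp add: dual_cone_def)
  qed
  fix x assume x: "x \<in> dual_cone H S"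
  {
    fix t :: real assume "0 \<le> t"
    then show "complex_of_real t \<odot> x \<in> dual_cone H S"
      using x Sc by (auto simp: dual_cone_def inprod_smult_left)
  }
  fix y t assume y: "y \<in> dual_cone H S" and t: "t \<in> {0..1::real}"
  have nn: "complex_of_real (1 - t) \<in> \<real>\<^sub>\<ge>\<^sub>0" "complex_of_real t \<in> \<real>\<^sub>\<ge>\<^sub>0"
    using t by (simp_all only: nonneg_Reals_of_real_iff atLeastAtMost_iff) simp_all
  show "complex_of_real (1 - t) \<odot> x \<oplus> complex_of_real t \<odot> y \<in> dual_cone H S"
    using x y Sc nn by (auto simp: dual_cone_def inprod_add_left inprod_smult_left simp del: of_real_diff)
qed

end

locale conjugation = hilbert_space H for H :: "('a, 'm) hilbert_scheme" (structure) and J :: "'a \<Rightarrow> 'a" +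
  assumes J_antilinear: "antilinear_isometry H J"
    and J_J: "op_comp H J J = op_id H"
begin

lemma J_closed [simp]: "x \<in> carrier H \<Longrightarrow> J x \<in> carrier H"
  and J_add: "x \<in> carrier H \<Longrightarrow> y \<in> carrier H \<Longrightarrow> J (x \<oplus> y) = J x \<oplus> J y"
  and J_smult: "x \<in> carrier H \<Longrightarrow> J (c \<odot> x) = cnj c \<odot> J x"
  and hnorm_J: "x \<in> carrier H \<Longrightarrow> hnorm H (J x) = hnorm H x"
  using J_antilinear unfolding antilinear_isometry_def by blast+

lemma J_invol [simp]: "x \<in> carrier H \<Longrightarrow> J (J x) = x"
  using fun_cong[OF J_J, of x] by (simp add: compose_def op_id_def)

lemma J_minus: "x \<in> carrier H \<Longrightarrow> y \<in> carrier H \<Longrightarrow> J (x \<ominus> y) = J x \<ominus> J y"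
  by (simp add: minus_as_add J_add J_smult)

text \<open>Polarisation of \<open>\<parallel>Jx\<parallel> = \<parallel>x\<parallel>\<close>.\<close>

lemma inprod_J_J:
  assumes x: "x \<in> carrier H" and y: "y \<in> carrier H"
  shows "inprod H (J x) (J y) = inprod H y x"
proof -
  have *: "Re (inprod H (J u) (J v)) = Re (inprod H u v)" if "u \<in> carrier H" "v \<in> carrier H" for u v
    using hnorm_add_sq[OF that] hnorm_add_sq[of "J u" "J v"] that
    by (simp add: hnorm_J flip: J_add)
  have "Re (inprod H (J x) (J y)) = Re (inprod H x y)" by (rule *[OF x y])
  moreover have "Im (inprod H (J x) (J y)) = - Im (inprod H x y)"
    using *[of "\<i> \<odot> x" y] x y by (simp add: J_smult inprod_smult_left)
  ultimately have "inprod H (J x) (J y) = cnj (inprod H x y)" by (simp add: complex_eq_iff)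
  also have "\<dots> = inprod H y x" using inprod_commute[OF y x] by simp
  finally show ?thesis .
qed

lemma inprod_J:
  assumes "x \<in> carrier H" "y \<in> carrier H"
  shows "inprod H (J x) y = inprod H (J y) x"
  using inprod_J_J[of x "J y"] assms by simp

lemma conj_op_apply: "x \<in> carrier H \<Longrightarrow> conj_op H J T x = J (T (J x))"
  by (simp add: conj_op_def compose_def)

lemma inprod_conj_op:
  assumes T: "T \<in> bounded_ops H" and x: "x \<in> carrier H" and y: "y \<in> carrier H"
  shows "inprod H (conj_op H J T x) y = inprod H x (conj_op H J (op_adjoint H T) y)"
proof -
  note Tc = bounded_opsD(1)[OF T] and ac = bounded_opsD(1)[OF op_adjoint_bounded[OF T]]
  have "inprod H (J (T (J x))) y = inprod H (J y) (T (J x))"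
    using inprod_J_J[of "T (J x)" "J y"] x y Tc by simp
  also have "\<dots> = inprod H (op_adjoint H T (J y)) (J x)"
    using x y by (simp add: inprod_op_adjoint'[OF T])
  also have "\<dots> = inprod H x (J (op_adjoint H T (J y)))"
    using inprod_J_J[of "J (op_adjoint H T (J y))" x] x y ac by simp
  finally show ?thesis using x y by (simp add: conj_op_apply)
qed

lemma conj_op_bounded:
  assumes T: "T \<in> bounded_ops H"
  shows "conj_op H J T \<in> bounded_ops H"
proof -
  note Tc = bounded_opsD(1)[OF T] and ac = bounded_opsD(1)[OF op_adjoint_bounded[OF T]]
  obtain C where C: "\<And>x. x \<in> carrier H \<Longrightarrow> hnorm H (T x) \<le> C * hnorm H x"
    using bounded_ops_bound[OF T] by blast
  show ?thesis
  proof (rule bounded_opsI[OF _ _ inprod_conj_op[OF T]])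
    show "conj_op H J T \<in> carrier H \<rightarrow>\<^sub>E carrier H" using Tc by (auto simp: conj_op_def compose_def)
    fix x assume x: "x \<in> carrier H"
    show "conj_op H J (op_adjoint H T) x \<in> carrier H" using x ac by (simp add: conj_op_apply)
    show "hnorm H (conj_op H J T x) \<le> C * hnorm H x"
      using x Tc C[of "J x"] by (simp add: conj_op_apply hnorm_J)
  qed
qed

lemma op_adjoint_conj_op:
  assumes T: "T \<in> bounded_ops H"
  shows "op_adjoint H (conj_op H J T) = conj_op H J (op_adjoint H T)"
  by (intro op_adjoint_eqI conj_op_bounded op_adjoint_bounded inprod_conj_op T)

lemma conj_op_conj_op:
  assumes T: "T \<in> bounded_ops H"
  shows "conj_op H J (conj_op H J T) = T"
  by (rule bounded_ops_eqI[OF conj_op_bounded[OF conj_op_bounded[OF T]] T])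
    (use bounded_opsD(1)[OF T] in \<open>simp add: conj_op_apply\<close>)

lemma conj_op_commutant:
  assumes B: "B \<subseteq> bounded_ops H"
  shows "conj_op H J ` commutant H B = commutant H (conj_op H J ` B)"
proof -
  have sub: "conj_op H J T \<in> commutant H (conj_op H J ` B)"
    if B: "B \<subseteq> bounded_ops H" and T: "T \<in> commutant H B" for T B
    unfolding mem_commutant_iff
  proof (intro conjI ballI)
    have Tb: "T \<in> bounded_ops H" and com: "\<And>b x. b \<in> B \<Longrightarrow> x \<in> carrier H \<Longrightarrow> T (b x) = b (T x)"
      using T by (auto simp: mem_commutant_iff)
    show "conj_op H J T \<in> bounded_ops H" by (rule conj_op_bounded[OF Tb])
    fix c x assume "c \<in> conj_op H J ` B" and x: "x \<in> carrier H"
    then obtain b where b: "b \<in> B" "c = conj_op H J b" by auto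
    then have "b \<in> bounded_ops H" using B by auto
    then show "conj_op H J T (c x) = c (conj_op H J T x)"
      using bounded_opsD(1)[OF Tb] bounded_opsD(1)[of b] com[OF b(1), of "J x"] x b
      by (simp add: conj_op_apply)
  qed
  have cB: "conj_op H J ` B \<subseteq> bounded_ops H" using B conj_op_bounded by auto
  have "conj_op H J ` conj_op H J ` B = B"
    using B conj_op_conj_op by (force simp: image_iff)
  then have "T \<in> conj_op H J ` commutant H B" if T: "T \<in> commutant H (conj_op H J ` B)" for T
    using sub[OF cB T] conj_op_conj_op[of T] T by (auto simp: commutant_def intro!: image_eqI[of T])
  then show ?thesis using sub[OF B] by blast
qed

end

context standard_form
begin

sublocale conjugation H J
  by unfold_locales (rule J_antilinear_isometry J_involution)+

lemma P_carrier: "P \<subseteq> carrier H"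
  using P_self_dual by (auto simp: dual_cone_def)

lemma conj_op_commutant_M:
  "a \<in> M \<Longrightarrow> conj_op H J a \<in> commutant H M" "b \<in> commutant H M \<Longrightarrow> conj_op H J b \<in> M"
proof -
  show "a \<in> M \<Longrightarrow> conj_op H J a \<in> commutant H M" using conj_commutant by blast
  assume "b \<in> commutant H M"
  then obtain a where a: "a \<in> M" "b = conj_op H J a" using conj_commutant by blast
  then show "conj_op H J b \<in> M" using conj_op_conj_op[of a] bounded by auto
qed

text \<open>\<open>p\<close> is the nearest point of \<open>P\<close> to \<open>x\<close>, and the variational inequality says that
  \<open>m = p \<ominus> x\<close> has inner products with non-negative real part with all of \<open>P\<close>.  These inner products
  are real because \<open>m\<close> and the elements of \<open>P\<close> are fixed by \<open>J\<close>, so \<open>m\<close> lies in the dual cone,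
  which is \<open>P\<close>.\<close>

lemma Moreau_decomposition:
  assumes x: "x \<in> carrier H" and Jx: "J x = x"
  obtains p m where "p \<in> P" "m \<in> P" "x = p \<ominus> m" "inprod H p m = 0"
    "hnorm H p \<le> hnorm H x" "hnorm H m \<le> hnorm H x"
proof -
  have dual: "y \<in> P" if "y \<in> carrier H" "\<And>k. k \<in> P \<Longrightarrow> inprod H y k \<in> \<real>\<^sub>\<ge>\<^sub>0" for y
    using that P_self_dual by (auto simp: dual_cone_def)
  have nn: "inprod H y k \<in> \<real>\<^sub>\<ge>\<^sub>0" if "y \<in> P" "k \<in> P" for y k
    using that P_self_dual by (auto simp: dual_cone_def)
  note Pc = subsetD[OF P_carrier]
  obtain p s where p: "p \<in> carrier H" and s: "\<And>n. s n \<in> P" "(\<lambda>n::nat. hnorm H (s n \<ominus> p)) \<longlonglongrightarrow> 0"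
    and var: "\<And>k. k \<in> P \<Longrightarrow> Re (inprod H (k \<ominus> p) (x \<ominus> p)) \<le> 0"
    by (rule nearest_point[of P x])
      (use P_closed_convex_cone x P_carrier in \<open>auto simp: closed_convex_cone_def\<close>)
  have pP: "p \<in> P"
    using s nn Pc by (intro dual[OF p] inprod_dual_cone_limit[of s p]) (auto intro: p)
  have scale: "complex_of_real t \<odot> y \<in> P" if "y \<in> P" "t \<ge> 0" for y t
    using that P_closed_convex_cone by (simp add: closed_convex_cone_def)
  have pm0: "Re (inprod H p (x \<ominus> p)) = 0"
  proof (rule antisym)
    have "Re (inprod H (complex_of_real 2 \<odot> p \<ominus> p) (x \<ominus> p)) \<le> 0" using scale[OF pP, of 2] by (intro var) simp
    then show "Re (inprod H p (x \<ominus> p)) \<le> 0" using p x by (simp add: inprod_minus_left inprod_smult_left)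
    have "Re (inprod H (complex_of_real 0 \<odot> p \<ominus> p) (x \<ominus> p)) \<le> 0" using scale[OF pP, of 0] by (intro var) simp
    then show "0 \<le> Re (inprod H p (x \<ominus> p))" using p x by (simp add: inprod_minus_left)
  qed
  define m where "m = p \<ominus> x"
  have m: "m \<in> carrier H" using p x by (simp add: m_def)
  have Jm: "J m = m" using p x Jx J_fixes_P[OF pP] by (simp add: m_def J_minus)
  have real: "Im (inprod H m k) = 0" "Re (inprod H m k) = Re (inprod H k m)" if k: "k \<in> P" for k
    using inprod_J_J[of m k] Jm J_fixes_P[OF k] m Pc[OF k] inprod_commute[of m k]
    by (auto simp: complex_eq_iff)
  have mP: "m \<in> P"
  proof (rule dual[OF m])
    fix k assume k: "k \<in> P"
    have "Re (inprod H k m) = - Re (inprod H (k \<ominus> p) (x \<ominus> p))"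
      using pm0 Pc[OF k] p x by (simp add: m_def inprod_minus_left inprod_minus_right)
    then have "Re (inprod H k m) \<ge> 0" using var[OF k] by simp
    then show "inprod H m k \<in> \<real>\<^sub>\<ge>\<^sub>0" using real[OF k] by (simp add: complex_nonneg_Reals_iff)
  qed
  have "Re (inprod H p m) = 0" using pm0 p x by (simp add: m_def inprod_minus_right)
  then have pm: "inprod H p m = 0"
    using nn[OF pP mP] by (simp add: complex_nonneg_Reals_iff complex_eq_iff)
  have xpm: "x = p \<ominus> m"
    by (rule vector_eqI) (use p x in \<open>auto simp: m_def inprod_linear\<close>)
  have "(hnorm H x)\<^sup>2 = (hnorm H p)\<^sup>2 + (hnorm H m)\<^sup>2"
    unfolding xpm using hnorm_minus_sq[OF p m] pm by simp
  then have "(hnorm H p)\<^sup>2 \<le> (hnorm H x)\<^sup>2" "(hnorm H m)\<^sup>2 \<le> (hnorm H x)\<^sup>2" by simp_all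
  then have "hnorm H p \<le> hnorm H x" "hnorm H m \<le> hnorm H x"
    using power2_le_imp_le[OF _ hnorm_nonneg[OF x]] by blast+
  then show thesis using that pP mP xpm pm by blast
qed

end


section \<open>Ultraproducts of standard forms\<close>

locale standard_form_ultra =
  fixes \<omega> :: "nat filter" and M :: "nat \<Rightarrow> ('a \<Rightarrow> 'a) set" and H :: "nat \<Rightarrow> 'a hilbert"
    and J :: "nat \<Rightarrow> 'a \<Rightarrow> 'a" and P :: "nat \<Rightarrow> 'a set"
  assumes ultrafilter: "free_ultrafilter \<omega>"
    and standard: "\<And>n. standard_form (M n) (H n) (J n) (P n)"

sublocale standard_form_ultra \<subseteq> Sn: standard_form "M n" "H n" "J n" "P n" for n
  by (rule standard)

sublocale standard_form_ultra \<subseteq> hilbert_ultra \<omega> H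
  by unfold_locales (rule ultrafilter)

context standard_form_ultra
begin

abbreviation J\<^sub>\<omega> :: "(nat \<Rightarrow> 'a) set \<Rightarrow> (nat \<Rightarrow> 'a) set" where "J\<^sub>\<omega> \<equiv> ultra_map \<omega> H J"
abbreviation P\<^sub>\<omega> :: "(nat \<Rightarrow> 'a) set set" where "P\<^sub>\<omega> \<equiv> ultra_cone \<omega> H P"
abbreviation M\<^sub>\<omega> :: "((nat \<Rightarrow> 'a) set \<Rightarrow> (nat \<Rightarrow> 'a) set) set" where
  "M\<^sub>\<omega> \<equiv> groh_raynaud_ultraproduct \<omega> H M"
abbreviation M' :: "nat \<Rightarrow> ('a \<Rightarrow> 'a) set" where "M' n \<equiv> commutant (H n) (M n)"

lemma star_algebra_M: "star_algebra (H n) (M n)"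
  by (rule von_neumann_algebra_star_algebra) unfold_locales

lemma J_equi_lipschitz: "equi_lipschitz J"
proof -
  have "J n \<zero>\<^bsub>H n\<^esub> = \<zero>\<^bsub>H n\<^esub>" for n
    using Sn.J_smult[of "\<zero>\<^bsub>H n\<^esub>" n 0] by simp
  moreover have "hnorm (H n) (J n x \<ominus>\<^bsub>H n\<^esub> J n y) \<le> 1 * hnorm (H n) (x \<ominus>\<^bsub>H n\<^esub> y)"
    if "x \<in> carrier (H n)" "y \<in> carrier (H n)" for n x y
    using that by (simp add: Sn.hnorm_J flip: Sn.J_minus)
  ultimately show ?thesis unfolding equi_lipschitz_def using Sn.J_closed by blast
qed

lemmas BS_J = BS_equi_lipschitz[OF J_equi_lipschitz]
  and J_cls = ultra_map_cls[OF J_equi_lipschitz]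

sublocale JU: conjugation U J\<^sub>\<omega>
proof unfold_locales
  have c: "J\<^sub>\<omega> X \<in> carrier U" if "X \<in> carrier U" for X
  proof -
    obtain \<xi> where "\<xi> \<in> BS" "X = cls \<xi>" using \<open>X \<in> carrier U\<close> by (rule carrier_cases)
    then show ?thesis by (simp add: J_cls BS_J)
  qed
  have "J\<^sub>\<omega> (X \<oplus>\<^bsub>U\<^esub> Y) = J\<^sub>\<omega> X \<oplus>\<^bsub>U\<^esub> J\<^sub>\<omega> Y" if X: "X \<in> carrier U" and Y: "Y \<in> carrier U" for X Y
  proof -
    obtain \<xi> where \<xi>: "\<xi> \<in> BS" "X = cls \<xi>" using X by (rule carrier_cases)
    obtain \<eta> where \<eta>: "\<eta> \<in> BS" "Y = cls \<eta>" using Y by (rule carrier_cases)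
    show ?thesis
      unfolding \<xi>(2) \<eta>(2) cls_add[OF \<xi>(1) \<eta>(1)] J_cls[OF BS_add[OF \<xi>(1) \<eta>(1)]] J_cls[OF \<xi>(1)]
        J_cls[OF \<eta>(1)] cls_add[OF BS_J[OF \<xi>(1)] BS_J[OF \<eta>(1)]]
      using \<xi> \<eta> by (simp add: Sn.J_add)
  qed
  moreover have "J\<^sub>\<omega> (c \<odot>\<^bsub>U\<^esub> X) = cnj c \<odot>\<^bsub>U\<^esub> J\<^sub>\<omega> X" if X: "X \<in> carrier U" for c X
  proof -
    obtain \<xi> where \<xi>: "\<xi> \<in> BS" "X = cls \<xi>" using X by (rule carrier_cases)
    show ?thesis
      unfolding \<xi>(2) cls_smult[OF \<xi>(1)] J_cls[OF BS_smult[OF \<xi>(1)]] J_cls[OF \<xi>(1)]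
        cls_smult[OF BS_J[OF \<xi>(1)]]
      using \<xi> by (simp add: Sn.J_smult)
  qed
  moreover have "hnorm U (J\<^sub>\<omega> X) = hnorm U X" if X: "X \<in> carrier U" for X
  proof -
    obtain \<xi> where \<xi>: "\<xi> \<in> BS" "X = cls \<xi>" using X by (rule carrier_cases)
    have "((\<lambda>n. hnorm (H n) (\<xi> n)) \<longlongrightarrow> hnorm U (J\<^sub>\<omega> X)) \<omega>"
      using tendsto_hnorm_cls[OF BS_J[OF \<xi>(1)]] \<xi> by (simp add: J_cls Sn.hnorm_J)
    from tendsto_unique[OF nontrivial this tendsto_hnorm_cls[OF \<xi>(1)]] show ?thesis
      using \<xi> by simp
  qed
  ultimately show "antilinear_isometry U J\<^sub>\<omega>"
    unfolding antilinear_isometry_def using c by (auto simp: ultra_map_def)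
  have "J\<^sub>\<omega> (J\<^sub>\<omega> X) = X" if X: "X \<in> carrier U" for X
  proof -
    obtain \<xi> where \<xi>: "\<xi> \<in> BS" "X = cls \<xi>" using X by (rule carrier_cases)
    then show ?thesis by (simp add: J_cls BS_J)
  qed
  then show "op_comp U J\<^sub>\<omega> J\<^sub>\<omega> = op_id U" unfolding compose_def op_id_def by (rule restrict_ext)
qed

lemma conj_op_ultra_map:
  assumes a: "unif_bounded a"
  shows "unif_bounded (\<lambda>n. conj_op (H n) (J n) (a n))"
    and "conj_op U J\<^sub>\<omega> (ultra_map \<omega> H a) = ultra_map \<omega> H (\<lambda>n. conj_op (H n) (J n) (a n))"
proof -
  obtain C where ab: "\<And>n. a n \<in> bounded_ops (H n)" and C: "C \<ge> 0"
    "\<And>n x. x \<in> carrier (H n) \<Longrightarrow> hnorm (H n) (a n x) \<le> C * hnorm (H n) x"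
    using a by (rule unif_boundedE) (rule that)
  show b: "unif_bounded (\<lambda>n. conj_op (H n) (J n) (a n))"
  proof (rule unif_boundedI[OF Sn.conj_op_bounded[OF ab] C(1)])
    fix n x assume "x \<in> carrier (H n)"
    then show "hnorm (H n) (conj_op (H n) (J n) (a n) x) \<le> C * hnorm (H n) x"
      using C(2)[of "J n x" n] Sn.bounded_opsD(1)[OF ab] by (simp add: Sn.conj_op_apply Sn.hnorm_J)
  qed
  show "conj_op U J\<^sub>\<omega> (ultra_map \<omega> H a) = ultra_map \<omega> H (\<lambda>n. conj_op (H n) (J n) (a n))"
  proof (rule U.bounded_ops_eqI[OF JU.conj_op_bounded[OF ultra_map_bounded_ops[OF a]] ultra_map_bounded_ops[OF b]])
    fix X assume "X \<in> carrier U"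
    then obtain \<xi> where \<xi>: "\<xi> \<in> BS" "X = cls \<xi>" by (rule carrier_cases)
    have J1: "(\<lambda>n. J n (\<xi> n)) \<in> BS" by (rule BS_J[OF \<xi>(1)])
    have J2: "(\<lambda>n. a n (J n (\<xi> n))) \<in> BS" by (rule BS_bounded[OF a J1])
    show "conj_op U J\<^sub>\<omega> (ultra_map \<omega> H a) X = ultra_map \<omega> H (\<lambda>n. conj_op (H n) (J n) (a n)) X"
      using \<xi> by (simp add: JU.conj_op_apply Sn.conj_op_apply ultra_map_bounded[OF b \<xi>(1)] J_cls[OF \<xi>(1)]
          ultra_map_bounded[OF a J1] J_cls[OF J2])
  qed
qed

lemma conj_op_ultra_ops: "conj_op U J\<^sub>\<omega> ` ultra_ops M' = ultra_ops M"
proof -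
  have sub: "conj_op U J\<^sub>\<omega> T \<in> ultra_ops L"
    if T: "T \<in> ultra_ops K" and KL: "\<And>n a. a \<in> K n \<Longrightarrow> conj_op (H n) (J n) a \<in> L n" for T K L
  proof -
    obtain a where a: "T = ultra_map \<omega> H a" "\<And>n. a n \<in> K n" "unif_bounded a"
      using T by (auto simp: ultra_ops_def)
    then show ?thesis
      using conj_op_ultra_map[OF a(3)] KL by (auto simp: ultra_ops_def)
  qed
  have 1: "conj_op U J\<^sub>\<omega> T \<in> ultra_ops M" if "T \<in> ultra_ops M'" for T
    using that Sn.conj_op_commutant_M(2) by (rule sub)
  have "T \<in> conj_op U J\<^sub>\<omega> ` ultra_ops M'" if T: "T \<in> ultra_ops M" for T
  proof -
    have "conj_op U J\<^sub>\<omega> T \<in> ultra_ops M'" using T Sn.conj_op_commutant_M(1) by (rule sub)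
    moreover have "conj_op U J\<^sub>\<omega> (conj_op U J\<^sub>\<omega> T) = T"
      by (rule JU.conj_op_conj_op[OF subsetD[OF ultra_ops_bounded T]])
    ultimately show ?thesis by (metis imageI)
  qed
  then show ?thesis using 1 by blast
qed

lemma M_ultra: "M\<^sub>\<omega> = commutant U (ultra_ops M')"
  by (rule groh_raynaud_eq_commutant[OF star_algebra_M])

lemma commutant_M_ultra: "commutant U M\<^sub>\<omega> = commutant U (ultra_ops M)"
  unfolding groh_raynaud_closure[OF star_algebra.N_bounded[OF star_algebra_M]]
  by (rule U.commutant_closure[OF ultra_ops_bounded])

lemma von_neumann_algebra_M_ultra: "von_neumann_algebra U M\<^sub>\<omega>"
  unfolding M_ultra
proof (rule U.commutant_von_neumann_algebra[OF ultra_ops_bounded])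
  fix T assume "T \<in> ultra_ops M'"
  then show "op_adjoint U T \<in> ultra_ops M'"
  proof (rule ultra_ops_adjoint[rotated])
    fix n b assume "b \<in> M' n"
    have "von_neumann_algebra (H n) (M' n)"
      by (rule Sn.commutant_von_neumann_algebra) (use Sn.bounded Sn.adjoint_closed in auto)
    then show "op_adjoint (H n) b \<in> M' n"
      using \<open>b \<in> M' n\<close> by (rule von_neumann_algebra.adjoint_closed)
  qed
qed

text \<open>With \<open>A\<close> and \<open>B\<close> for the operators that come from the \<open>M\<^sub>n\<close> and the \<open>M\<^sub>n'\<close>, this is
  \<open>JM\<^sub>\<omega>J = JB'J = (JBJ)' = A' = M\<^sub>\<omega>'\<close>.\<close>

lemma conj_commutant_ultra: "conj_op U J\<^sub>\<omega> ` M\<^sub>\<omega> = commutant U M\<^sub>\<omega>"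
proof -
  have "conj_op U J\<^sub>\<omega> ` commutant U (ultra_ops M') = commutant U (ultra_ops M)"
    by (simp only: JU.conj_op_commutant[OF ultra_ops_bounded] conj_op_ultra_ops)
  then show ?thesis unfolding M_ultra[symmetric] commutant_M_ultra .
qed

lemma P_ultraE:
  assumes "X \<in> P\<^sub>\<omega>"
  obtains \<xi> where "\<xi> \<in> BS" "\<And>n. \<xi> n \<in> P n" "X = cls \<xi>"
  using assms by (auto simp: ultra_cone_def)

lemma P_ultraI: "\<xi> \<in> BS \<Longrightarrow> (\<And>n. \<xi> n \<in> P n) \<Longrightarrow> cls \<xi> \<in> P\<^sub>\<omega>"
  by (auto simp: ultra_cone_def)

lemma P_ultra_carrier: "P\<^sub>\<omega> \<subseteq> carrier U"
  by (auto elim: P_ultraE)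

lemma J_fixes_P_ultra:
  assumes "X \<in> P\<^sub>\<omega>"
  shows "J\<^sub>\<omega> X = X"
proof -
  obtain \<xi> where "\<xi> \<in> BS" "\<And>n. \<xi> n \<in> P n" "X = cls \<xi>" using assms by (rule P_ultraE) (rule that)
  then show ?thesis by (simp add: J_cls Sn.J_fixes_P)
qed

lemma inprod_P_ultra:
  assumes "X \<in> P\<^sub>\<omega>" "Y \<in> P\<^sub>\<omega>"
  shows "inprod U X Y \<in> \<real>\<^sub>\<ge>\<^sub>0"
proof -
  obtain \<xi> where \<xi>: "\<xi> \<in> BS" "\<And>n. \<xi> n \<in> P n" "X = cls \<xi>" using assms(1) by (rule P_ultraE) (rule that)
  obtain \<eta> where \<eta>: "\<eta> \<in> BS" "\<And>n. \<eta> n \<in> P n" "Y = cls \<eta>" using assms(2) by (rule P_ultraE) (rule that)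
  have "inprod (H n) (\<xi> n) (\<eta> n) \<in> \<real>\<^sub>\<ge>\<^sub>0" for n
    using \<xi>(2)[of n] \<eta>(2)[of n] Sn.P_self_dual[of n] by (auto simp: dual_cone_def)
  then show ?thesis
    unfolding \<xi>(3) \<eta>(3)
    by (intro Lim_in_closed_set[OF closed_nonneg_Reals_complex _ nontrivial tendsto_inprod_cls[OF \<xi>(1) \<eta>(1)]])
      simp
qed

text \<open>A vector fixed by \<open>J\<^sub>\<omega>\<close> has representatives fixed by the \<open>J\<^sub>n\<close>, obtained by averaging a
  representative with its image.  The parts of their Moreau decompositions are bounded because they
  are no longer than the vector decomposed.\<close>

lemma Moreau_ultra:
  assumes X: "X \<in> carrier U" and JX: "J\<^sub>\<omega> X = X"
  obtains p m where "p \<in> P\<^sub>\<omega>" "m \<in> P\<^sub>\<omega>" "X = p \<ominus>\<^bsub>U\<^esub> m" "inprod U p m = 0"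
proof -
  obtain \<xi> where \<xi>: "\<xi> \<in> BS" "X = cls \<xi>" using X by (rule carrier_cases)
  have J\<xi>: "(\<lambda>n. J n (\<xi> n)) \<in> BS" by (rule BS_J[OF \<xi>(1)])
  define x where "x = (\<lambda>n. (1/2) \<odot>\<^bsub>H n\<^esub> (\<xi> n \<oplus>\<^bsub>H n\<^esub> J n (\<xi> n)))"
  have x: "x \<in> BS" unfolding x_def using \<xi> J\<xi> by simp
  have "cls x = (1/2) \<odot>\<^bsub>U\<^esub> (cls \<xi> \<oplus>\<^bsub>U\<^esub> J\<^sub>\<omega> (cls \<xi>))"
    using \<xi> J\<xi> by (simp add: x_def cls_smult cls_add J_cls)
  also have "\<dots> = X"
    unfolding \<xi>(2)[symmetric] JX by (rule U.vector_eqI) (use X in \<open>auto simp: U.inprod_linear\<close>)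
  finally have Xx: "X = cls x" ..
  have Jx: "J n (x n) = x n" for n
    using \<xi>(1) by (simp add: x_def Sn.J_smult Sn.J_add Sn.M.a_comm)
  have "\<exists>p m. p \<in> P n \<and> m \<in> P n \<and> x n = p \<ominus>\<^bsub>H n\<^esub> m \<and> inprod (H n) p m = 0 \<and>
      hnorm (H n) p \<le> hnorm (H n) (x n) \<and> hnorm (H n) m \<le> hnorm (H n) (x n)" for n
    by (rule Sn.Moreau_decomposition[OF BS_carrier[OF x] Jx]) blast
  then obtain p m where pm: "\<And>n. p n \<in> P n" "\<And>n. m n \<in> P n" "\<And>n. x n = p n \<ominus>\<^bsub>H n\<^esub> m n"
    "\<And>n. inprod (H n) (p n) (m n) = 0"
    "\<And>n. hnorm (H n) (p n) \<le> hnorm (H n) (x n)" "\<And>n. hnorm (H n) (m n) \<le> hnorm (H n) (x n)"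
    by metis
  obtain C where C: "\<And>n. hnorm (H n) (x n) \<le> C" using BS_bound[OF x] by metis
  have p: "p \<in> BS" using pm(1) Sn.P_carrier by (intro BSI[OF _ order_trans[OF pm(5) C]]) auto
  have m: "m \<in> BS" using pm(2) Sn.P_carrier by (intro BSI[OF _ order_trans[OF pm(6) C]]) auto
  show thesis
  proof (rule that[of "cls p" "cls m"])
    show "cls p \<in> P\<^sub>\<omega>" "cls m \<in> P\<^sub>\<omega>" using p m pm by (auto intro: P_ultraI)
    have "x = (\<lambda>n. p n \<ominus>\<^bsub>H n\<^esub> m n)" using pm(3) by blast
    then show "X = cls p \<ominus>\<^bsub>U\<^esub> cls m" unfolding Xx using p m by (simp add: cls_minus)
    show "inprod U (cls p) (cls m) = 0" using p m pm(4) by (intro inprod_cls_eqI) auto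
  qed
qed

text \<open>Every vector is \<open>A + \<i>B\<close> with \<open>A\<close> and \<open>B\<close> fixed by \<open>J\<^sub>\<omega>\<close>, and such vectors are
  differences of elements of the cone.\<close>

lemma P_ultra_total:
  assumes X: "X \<in> carrier U" and orth: "\<And>p. p \<in> P\<^sub>\<omega> \<Longrightarrow> inprod U X p = 0"
  shows "X = \<zero>\<^bsub>U\<^esub>"
proof -
  note Pc = subsetD[OF P_ultra_carrier]
  have fixed: "inprod U X A = 0" if A: "A \<in> carrier U" "J\<^sub>\<omega> A = A" for A
  proof -
    obtain p m where pm: "p \<in> P\<^sub>\<omega>" "m \<in> P\<^sub>\<omega>" "A = p \<ominus>\<^bsub>U\<^esub> m"
      by (rule Moreau_ultra[OF A]) (rule that)
    then show ?thesis using X Pc orth by (simp add: U.inprod_minus_right)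
  qed
  define A where "A = (1/2) \<odot>\<^bsub>U\<^esub> (X \<oplus>\<^bsub>U\<^esub> J\<^sub>\<omega> X)"
  \<comment> \<open>the imaginary part, that is, minus \<open>\<i>\<close> times half of \<open>X \<ominus> J\<^sub>\<omega> X\<close>\<close>
  define B where "B = (\<i>/2) \<odot>\<^bsub>U\<^esub> (J\<^sub>\<omega> X \<ominus>\<^bsub>U\<^esub> X)"
  have AB: "A \<in> carrier U" "B \<in> carrier U" using X by (auto simp: A_def B_def)
  have JA: "J\<^sub>\<omega> A = A"
    by (rule U.vector_eqI) (use X in \<open>auto simp: A_def JU.J_smult JU.J_add U.inprod_linear\<close>)
  have JB: "J\<^sub>\<omega> B = B"
    by (rule U.vector_eqI) (use X in \<open>auto simp: B_def JU.J_smult JU.J_minus U.inprod_linear algebra_simps\<close>)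
  have "X = A \<oplus>\<^bsub>U\<^esub> \<i> \<odot>\<^bsub>U\<^esub> B"
    by (rule U.vector_eqI) (use X in \<open>auto simp: A_def B_def U.inprod_linear algebra_simps\<close>)
  then have "inprod U X X = inprod U X A + cnj \<i> * inprod U X B"
    using U.inprod_add_right[of X A "\<i> \<odot>\<^bsub>U\<^esub> B"] U.inprod_smult_right[of X B \<i>] X AB by simp
  then have "inprod U X X = 0" using fixed AB JA JB by simp
  then show ?thesis using X by (rule U.inprod_definite[rotated])
qed

text \<open>An element \<open>X\<close> of the dual cone has real inner products with the cone, hence so has
  \<open>J\<^sub>\<omega>X\<close>, with the same values, and \<open>J\<^sub>\<omega>X = X\<close> by totality.  In the decomposition \<open>X = p - m\<close>, the
  inner product of \<open>X\<close> with \<open>m\<close> is \<open>-\<parallel>m\<parallel>\<^sup>2\<close>, so \<open>m\<close> vanishes.\<close>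

lemma P_ultra_self_dual: "P\<^sub>\<omega> = dual_cone U P\<^sub>\<omega>"
proof
  note Pc = subsetD[OF P_ultra_carrier]
  show "P\<^sub>\<omega> \<subseteq> dual_cone U P\<^sub>\<omega>"
    using Pc inprod_P_ultra by (auto simp: dual_cone_def)
  show "dual_cone U P\<^sub>\<omega> \<subseteq> P\<^sub>\<omega>"
  proof
    fix X assume "X \<in> dual_cone U P\<^sub>\<omega>"
    then have X: "X \<in> carrier U" and nn: "\<And>p. p \<in> P\<^sub>\<omega> \<Longrightarrow> inprod U X p \<in> \<real>\<^sub>\<ge>\<^sub>0"
      by (auto simp: dual_cone_def)
    have "J\<^sub>\<omega> X \<ominus>\<^bsub>U\<^esub> X = \<zero>\<^bsub>U\<^esub>"
    proof (rule P_ultra_total)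
      fix p assume p: "p \<in> P\<^sub>\<omega>"
      have "inprod U (J\<^sub>\<omega> X) p = inprod U p X"
        using JU.inprod_J[OF X Pc[OF p]] J_fixes_P_ultra[OF p] by simp
      also have "\<dots> = cnj (inprod U X p)" by (rule U.inprod_commute[OF Pc[OF p] X])
      also have "\<dots> = inprod U X p"
        using nn[OF p] by (auto simp: complex_eq_iff complex_nonneg_Reals_iff)
      finally show "inprod U (J\<^sub>\<omega> X \<ominus>\<^bsub>U\<^esub> X) p = 0" using X Pc[OF p] by (simp add: U.inprod_minus_left)
    qed (use X in auto)
    then have JX: "J\<^sub>\<omega> X = X" using X by (simp add: U.minus_eq_zero_iff)
    obtain p m where pm: "p \<in> P\<^sub>\<omega>" "m \<in> P\<^sub>\<omega>" "X = p \<ominus>\<^bsub>U\<^esub> m" "inprod U p m = 0"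
      by (rule Moreau_ultra[OF X JX]) (rule that)
    have mc: "m \<in> carrier U" and pc: "p \<in> carrier U" using pm Pc by auto
    have "inprod U X m = - complex_of_real ((hnorm U m)\<^sup>2)"
      unfolding pm(3) using pm(4) mc pc by (simp add: U.inprod_minus_left U.inprod_self)
    then have "(hnorm U m)\<^sup>2 \<le> 0" using nn[OF pm(2)] by (simp add: complex_nonneg_Reals_iff)
    then have "m = \<zero>\<^bsub>U\<^esub>" using mc by (simp add: U.hnorm_eq_0)
    then have "X = p"
      unfolding pm(3) by (intro U.vector_eqI) (use pc in \<open>auto simp: U.inprod_minus_left\<close>)
    then show "X \<in> P\<^sub>\<omega>" using pm by simp
  qed
qed

text \<open>For \<open>T\<close> that comes from a sequence this holds index by index.  Multiplication is
  jointly strongly continuous on bounded sets only, so the passage to the closure depends on the uniform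
  bound in \<open>bicommutant_approximation\<close>.\<close>

lemma P_invariant_ultra:
  assumes T: "T \<in> M\<^sub>\<omega>" and X: "X \<in> P\<^sub>\<omega>"
  shows "T (J\<^sub>\<omega> (T (J\<^sub>\<omega> X))) \<in> P\<^sub>\<omega>"
proof -
  note Pc = subsetD[OF P_ultra_carrier]
  have Tcom: "T \<in> commutant U (ultra_ops M')" using T by (simp add: M_ultra)
  then have Tb: "T \<in> bounded_ops U" by (simp add: commutant_def)
  note Tc = U.bounded_opsD(1)[OF Tb]
  have Xc: "X \<in> carrier U" by (rule Pc[OF X])
  define Y where "Y = J\<^sub>\<omega> (T X)"
  have Y: "Y \<in> carrier U" using Tc Xc by (simp add: Y_def)
  obtain C where C0: "C \<ge> 0" and C: "\<And>X. X \<in> carrier U \<Longrightarrow> hnorm U (T X) \<le> C * hnorm U X"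
    using U.bounded_ops_bound[OF Tb] by blast
  have C': "hnorm U (T X) \<le> (C + 1) * hnorm U X" if "X \<in> carrier U" for X
    using C[OF that] U.hnorm_nonneg[OF that] by (simp add: algebra_simps)
  have approx: "\<exists>Z\<in>P\<^sub>\<omega>. hnorm U (Z \<ominus>\<^bsub>U\<^esub> T Y) \<le> (C + 2) * e" if e: "e > 0" for e
  proof -
    obtain a where a: "\<And>n. a n \<in> M n"
      "\<And>n x. x \<in> carrier (H n) \<Longrightarrow> hnorm (H n) (a n x) \<le> (C + 1) * hnorm (H n) x"
      "\<And>V. V \<in> {X, Y} \<Longrightarrow> hnorm U (ultra_map \<omega> H a V \<ominus>\<^bsub>U\<^esub> T V) < e"
      by (rule bicommutant_approximation[OF star_algebra_M Tcom _ C' _ _ e, of "{X, Y}"])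
        (use C0 Xc Y in auto)
    have aU: "unif_bounded a"
      using a(2) subsetD[OF Sn.bounded a(1)] C0 by (intro unif_boundedI[of _ "C + 1"]) auto
    let ?A = "ultra_map \<omega> H a"
    have Ab: "?A \<in> bounded_ops U" by (rule ultra_map_bounded_ops[OF aU])
    note Ac = U.bounded_opsD(1)[OF Ab]
    have AX: "?A X \<in> carrier U" "T X \<in> carrier U" using Ac Tc Xc by auto
    define Z where "Z = ?A (J\<^sub>\<omega> (?A X))"
    have "Z \<in> P\<^sub>\<omega>"
    proof -
      obtain \<xi> where \<xi>: "\<xi> \<in> BS" "\<And>n. \<xi> n \<in> P n" "X = cls \<xi>" using X by (rule P_ultraE) (rule that)
      have 1: "(\<lambda>n. a n (\<xi> n)) \<in> BS" by (rule BS_bounded[OF aU \<xi>(1)])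
      have 2: "(\<lambda>n. J n (a n (\<xi> n))) \<in> BS" by (rule BS_J[OF 1])
      have 3: "(\<lambda>n. a n (J n (a n (\<xi> n)))) \<in> BS" by (rule BS_bounded[OF aU 2])
      have "a n (J n (a n (\<xi> n))) \<in> P n" for n
      proof -
        have "op_comp (H n) (a n) (conj_op (H n) (J n) (a n)) (\<xi> n) \<in> P n"
          using Sn.P_invariant[OF a(1), of n] \<xi>(2)[of n] by blast
        then show ?thesis
          using \<xi> by (simp add: Sn.op_comp_apply Sn.conj_op_apply Sn.J_fixes_P)
      qed
      then have "cls (\<lambda>n. a n (J n (a n (\<xi> n)))) \<in> P\<^sub>\<omega>" using 3 by (intro P_ultraI)
      then show ?thesis
        unfolding Z_def \<xi>(3) ultra_map_bounded[OF aU \<xi>(1)] J_cls[OF 1] ultra_map_bounded[OF aU 2] .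
    qed
    moreover have "hnorm U (Z \<ominus>\<^bsub>U\<^esub> T Y) \<le> (C + 2) * e"
    proof -
      have "hnorm U (Z \<ominus>\<^bsub>U\<^esub> T Y) \<le> hnorm U (Z \<ominus>\<^bsub>U\<^esub> ?A Y) + hnorm U (?A Y \<ominus>\<^bsub>U\<^esub> T Y)"
        using Ac Tc Y AX by (intro U.hnorm_triangle_minus) (auto simp: Z_def)
      also have "Z \<ominus>\<^bsub>U\<^esub> ?A Y = ?A (J\<^sub>\<omega> (?A X \<ominus>\<^bsub>U\<^esub> T X))"
        using AX Y by (simp add: Z_def Y_def U.bounded_ops_minus[OF Ab] JU.J_minus)
      also have "hnorm U (?A (J\<^sub>\<omega> (?A X \<ominus>\<^bsub>U\<^esub> T X))) \<le> (C + 1) * hnorm U (J\<^sub>\<omega> (?A X \<ominus>\<^bsub>U\<^esub> T X))"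
        by (rule hnorm_ultra_map_le[OF aU a(2)]) (use AX in auto)
      also have "hnorm U (J\<^sub>\<omega> (?A X \<ominus>\<^bsub>U\<^esub> T X)) = hnorm U (?A X \<ominus>\<^bsub>U\<^esub> T X)"
        using AX by (simp add: JU.hnorm_J)
      also have "(C + 1) * hnorm U (?A X \<ominus>\<^bsub>U\<^esub> T X) \<le> (C + 1) * e"
        using a(3)[of X] C0 by (intro mult_left_mono) auto
      finally show ?thesis using a(3)[of Y] by (simp add: algebra_simps)
    qed
    ultimately show ?thesis by blast
  qed
  have "\<exists>Z. Z \<in> P\<^sub>\<omega> \<and> hnorm U (Z \<ominus>\<^bsub>U\<^esub> T Y) \<le> (C + 2) * (1 / real (Suc n))" for n
    using approx[of "1 / real (Suc n)"] by auto
  then obtain Z where Z: "\<And>n. Z n \<in> P\<^sub>\<omega>" "\<And>n. hnorm U (Z n \<ominus>\<^bsub>U\<^esub> T Y) \<le> (C + 2) * (1 / real (Suc n))"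
    by metis
  have Zc: "Z n \<in> carrier U" for n by (rule Pc[OF Z(1)])
  have TY: "T Y \<in> carrier U" by (rule Tc[OF Y])
  have "(\<lambda>n. (C + 2) * (1 / real (Suc n))) \<longlonglongrightarrow> (C + 2) * 0"
    by (intro tendsto_mult tendsto_const LIMSEQ_Suc lim_1_over_n)
  then have bnd: "(\<lambda>n. (C + 2) * (1 / real (Suc n))) \<longlonglongrightarrow> 0" by simp
  have lim: "(\<lambda>n. hnorm U (Z n \<ominus>\<^bsub>U\<^esub> T Y)) \<longlonglongrightarrow> 0"
    by (rule tendsto_sandwich[OF _ _ tendsto_const bnd]) (use Z(2) Zc TY in auto)
  have "T Y \<in> dual_cone U P\<^sub>\<omega>"
    unfolding dual_cone_def
    using U.inprod_dual_cone_limit[OF Zc TY lim Pc inprod_P_ultra[OF Z(1)]] TY by blast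
  then show ?thesis
    using P_ultra_self_dual J_fixes_P_ultra[OF X] by (simp add: Y_def)
qed

text \<open>For central \<open>c\<close> the operator \<open>d = c - Jc\<^sup>*J\<close> belongs to the algebra and satisfies
  \<open>JdJ = -d\<^sup>*\<close>.  For \<open>p\<close> in the cone, invariance gives \<open>0 \<le> \<langle>dJdJp, p\<rangle> = -\<parallel>d\<^sup>*p\<parallel>\<^sup>2\<close>.
  Thus \<open>d\<^sup>*\<close> vanishes on a total set, and \<open>d = 0\<close>.\<close>

lemma conj_center_ultra:
  assumes c: "c \<in> center U M\<^sub>\<omega>"
  shows "conj_op U J\<^sub>\<omega> c = op_adjoint U c"
proof -
  interpret MU: von_neumann_algebra U "M\<^sub>\<omega>" by (rule von_neumann_algebra_M_ultra)
  note Pc = subsetD[OF P_ultra_carrier]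
  have cM: "c \<in> M\<^sub>\<omega>" and cM': "c \<in> commutant U M\<^sub>\<omega>" using c by (auto simp: center_def)
  have cb: "c \<in> bounded_ops U" using cM MU.bounded by auto
  let ?s = "op_adjoint U c"
  have sb: "?s \<in> bounded_ops U" by (rule U.op_adjoint_bounded[OF cb])
  have "?s \<in> commutant U M\<^sub>\<omega>"
  proof -
    have "von_neumann_algebra U (commutant U M\<^sub>\<omega>)"
      by (rule U.commutant_von_neumann_algebra) (use MU.bounded MU.adjoint_closed in auto)
    then show ?thesis using cM' by (rule von_neumann_algebra.adjoint_closed)
  qed
  then obtain t where t: "t \<in> M\<^sub>\<omega>" "?s = conj_op U J\<^sub>\<omega> t" using conj_commutant_ultra by blast
  have "conj_op U J\<^sub>\<omega> ?s = t"
    unfolding t(2) using t(1) MU.bounded by (intro JU.conj_op_conj_op) auto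
  then have jM: "conj_op U J\<^sub>\<omega> ?s \<in> M\<^sub>\<omega>" using t(1) by simp
  let ?j = "conj_op U J\<^sub>\<omega> ?s"
  have jb: "?j \<in> bounded_ops U" by (rule JU.conj_op_bounded[OF sb])
  define d where "d = op_add U c (op_smult U (-1) ?j)"
  have dM: "d \<in> M\<^sub>\<omega>" unfolding d_def by (intro MU.add_closed MU.scalar_closed cM jM)
  have db: "d \<in> bounded_ops U" using dM MU.bounded by auto
  note carr = U.bounded_opsD(1)[OF cb] U.bounded_opsD(1)[OF sb] U.bounded_opsD(1)[OF jb]
    U.bounded_opsD(1)[OF db] U.bounded_opsD(1)[OF U.op_adjoint_bounded[OF db]]
  have d: "d x = c x \<ominus>\<^bsub>U\<^esub> J\<^sub>\<omega> (?s (J\<^sub>\<omega> x))" if x: "x \<in> carrier U" for x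
    by (rule U.vector_eqI)
      (use x carr in \<open>auto simp: d_def op_add_def op_smult_def U.inprod_linear JU.conj_op_apply\<close>)
  have adj_j: "op_adjoint U ?j = conj_op U J\<^sub>\<omega> c"
    using JU.op_adjoint_conj_op[OF sb] U.op_adjoint_adjoint[OF cb] by simp
  have d_adj: "op_adjoint U d x = ?s x \<ominus>\<^bsub>U\<^esub> J\<^sub>\<omega> (c (J\<^sub>\<omega> x))" if x: "x \<in> carrier U" for x
  proof (rule U.vector_eqI)
    fix z assume z: "z \<in> carrier U"
    have "inprod U (op_adjoint U d x) z = inprod U x (c z \<ominus>\<^bsub>U\<^esub> ?j z)"
      using x z by (simp add: U.inprod_op_adjoint'[OF db] d JU.conj_op_apply)
    also have "\<dots> = inprod U (?s x) z - inprod U (op_adjoint U ?j x) z"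
      using x z carr by (simp add: U.inprod_minus_right U.inprod_op_adjoint'[OF cb] U.inprod_op_adjoint'[OF jb])
    finally show "inprod U (op_adjoint U d x) z = inprod U (?s x \<ominus>\<^bsub>U\<^esub> J\<^sub>\<omega> (c (J\<^sub>\<omega> x))) z"
      using x z carr by (simp add: adj_j JU.conj_op_apply U.inprod_minus_left)
  qed (use x carr in auto)
  have JdJ: "J\<^sub>\<omega> (d (J\<^sub>\<omega> x)) = (-1) \<odot>\<^bsub>U\<^esub> op_adjoint U d x" if x: "x \<in> carrier U" for x
  proof -
    have "J\<^sub>\<omega> (d (J\<^sub>\<omega> x)) = J\<^sub>\<omega> (c (J\<^sub>\<omega> x)) \<ominus>\<^bsub>U\<^esub> ?s x"
      using x carr by (simp add: d JU.J_minus)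
    also have "\<dots> = (-1) \<odot>\<^bsub>U\<^esub> op_adjoint U d x"
      by (rule U.vector_eqI) (use x carr in \<open>auto simp: d_adj U.inprod_linear\<close>)
    finally show ?thesis .
  qed
  have dP: "op_adjoint U d p = \<zero>\<^bsub>U\<^esub>" if p: "p \<in> P\<^sub>\<omega>" for p
  proof -
    have pc: "p \<in> carrier U" by (rule Pc[OF p])
    let ?a = "op_adjoint U d p"
    have ac: "?a \<in> carrier U" using pc carr by simp
    have "d (J\<^sub>\<omega> (d (J\<^sub>\<omega> p))) \<in> P\<^sub>\<omega>" by (rule P_invariant_ultra[OF dM p])
    then have "inprod U (d ((-1) \<odot>\<^bsub>U\<^esub> ?a)) p \<in> \<real>\<^sub>\<ge>\<^sub>0"
      using inprod_P_ultra[OF _ p] by (simp add: JdJ[OF pc])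
    moreover have "inprod U (d ((-1) \<odot>\<^bsub>U\<^esub> ?a)) p = - complex_of_real ((hnorm U ?a)\<^sup>2)"
      using U.inprod_op_adjoint[OF db _ pc, of "(-1) \<odot>\<^bsub>U\<^esub> ?a"] ac
      by (simp add: U.inprod_smult_left U.inprod_self)
    ultimately have "(hnorm U ?a)\<^sup>2 \<le> 0" by (simp add: complex_nonneg_Reals_iff)
    then show ?thesis using ac by (simp add: U.hnorm_eq_0)
  qed
  have d0: "d x = \<zero>\<^bsub>U\<^esub>" if x: "x \<in> carrier U" for x
  proof (rule P_ultra_total)
    show "d x \<in> carrier U" using x carr by simp
    show "inprod U (d x) p = 0" if p: "p \<in> P\<^sub>\<omega>" for p
      using U.inprod_op_adjoint[OF db x Pc[OF p]] dP[OF p] x by simp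
  qed
  show ?thesis
  proof (rule U.bounded_ops_eqI[OF JU.conj_op_bounded[OF cb] sb])
    fix x assume x: "x \<in> carrier U"
    have "c (J\<^sub>\<omega> x) = J\<^sub>\<omega> (?s x)"
      using d0[of "J\<^sub>\<omega> x"] d[of "J\<^sub>\<omega> x"] x carr by (simp add: U.minus_eq_zero_iff)
    then show "conj_op U J\<^sub>\<omega> c x = ?s x" using x carr by (simp add: JU.conj_op_apply)
  qed
qed

theorem standard_form_ultraproduct: "standard_form M\<^sub>\<omega> U J\<^sub>\<omega> P\<^sub>\<omega>"
proof (intro standard_form.intro standard_form_axioms.intro)
  show "von_neumann_algebra U M\<^sub>\<omega>" by (rule von_neumann_algebra_M_ultra)
  show "antilinear_isometry U J\<^sub>\<omega>" by (rule JU.J_antilinear)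
  show "op_comp U J\<^sub>\<omega> J\<^sub>\<omega> = op_id U" by (rule JU.J_J)
  show "closed_convex_cone U P\<^sub>\<omega>"
    using U.closed_convex_cone_dual_cone[OF P_ultra_carrier] P_ultra_self_dual by simp
  show "P\<^sub>\<omega> = dual_cone U P\<^sub>\<omega>" by (rule P_ultra_self_dual)
  show "conj_op U J\<^sub>\<omega> ` M\<^sub>\<omega> = commutant U M\<^sub>\<omega>" by (rule conj_commutant_ultra)
  show "J\<^sub>\<omega> X = X" if "X \<in> P\<^sub>\<omega>" for X using that by (rule J_fixes_P_ultra)
  show "op_comp U T (conj_op U J\<^sub>\<omega> T) ` P\<^sub>\<omega> \<subseteq> P\<^sub>\<omega>" if "T \<in> M\<^sub>\<omega>" for T
    using P_invariant_ultra[OF that] P_ultra_carrier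
    by (auto simp: U.op_comp_apply JU.conj_op_apply subset_iff)
  show "conj_op U J\<^sub>\<omega> T = op_adjoint U T" if "T \<in> center U M\<^sub>\<omega>" for T
    using that by (rule conj_center_ultra)
qed

end

theorem theorem3p18:
  fixes \<omega> :: "nat filter"
    and M :: "nat \<Rightarrow> ('a \<Rightarrow> 'a) set"
    and H :: "nat \<Rightarrow> 'a hilbert"
    and J :: "nat \<Rightarrow> 'a \<Rightarrow> 'a"
    and P :: "nat \<Rightarrow> 'a set"
  assumes "free_ultrafilter \<omega>"
    and "\<And>n. standard_form (M n) (H n) (J n) (P n)"
  shows "standard_form
           (groh_raynaud_ultraproduct \<omega> H M)
           (hilbert_ultraproduct \<omega> H)
           (ultra_map \<omega> H J)
           (ultra_cone \<omega> H P)"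
proof -
  interpret standard_form_ultra \<omega> M H J P
    using assms by (rule standard_form_ultra.intro)
  show ?thesis by (rule standard_form_ultraproduct)
qed

end
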